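(* Let $\{X_t\}_{t\ge1}$ be a stationary Gaussian sequence with $\mathbb E X_t=0$, $\mathbb E X_t^2=1$ and covariance $\rho(h)=\mathbb E[X_tX_{t+h}]\sim c\,h^{-\alpha}L_0(h)$ as $h\to\infty$, where $c>0$, $0<\alpha<1$, and $L_0$ is slowly varying at infinity. Let $G\in L^2(\mathbb R,\phi)$ have Hermite rank $m\ge1$, and let $a_n=n^{-d}\ell_a(n)$, $n\ge1$, where $d\in\mathbb R$ and $\ell_a$ is slowly varying at infinity. Assume $\alpha m<1$ and $2d+\alpha m<1$. Let $S_n=\sum_{t=1}^n a_tG(X_t)$ and $A_n^2=\operatorname{Var}(S_n)$. Then there exists a (deterministic) constant $C_{\mathrm{up}}<\infty$ such that $$\limsup_{n\to\infty}\frac{|S_n|}{A_n(2\log\log n)^{m/2}}\le C_{\mathrm{up}}\qquad\text{a.s.}$$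
   Context: $\phi$ is the standard Gaussian measure on $\mathbb R$; $H_q(x)=(-1)^qe^{x^2/2}\frac{d^q}{dx^q}e^{-x^2/2}$ is the $q$-th Hermite polynomial. $G\in L^2(\mathbb R,\phi)$ has Hermite rank $m\ge1$ if $G=\sum_{q=m}^\infty\frac{J_q}{q!}H_q$ in $L^2(\mathbb R,\phi)$ with $J_q=\int_{\mathbb R}G H_q\,d\phi$ and $J_m\ne0$. Slowly varying functions $L$ are measurable, eventually positive, with $L(rx)/L(x)\to1$ as $x\to\infty$ for every $r>0$. $A_n\ge0$ is the square root of $\operatorname{Var}(S_n)$ (it is positive for all large $n$). *)

theory Defs
  imports "HOL-Probability.Probability" "HOL-Library.Landau_Symbols"
begin

definition hermite :: "nat \<Rightarrow> real \<Rightarrow> real" where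
  "hermite q x = (-1) ^ q * exp (x\<^sup>2 / 2) * (deriv ^^ q) (\<lambda>y. exp (- (y\<^sup>2 / 2))) x"

definition std_gaussian :: "real measure" where
  "std_gaussian = density lborel std_normal_density"

definition square_integrable :: "'a measure \<Rightarrow> ('a \<Rightarrow> real) \<Rightarrow> bool" where
  "square_integrable M f \<longleftrightarrow> f \<in> borel_measurable M \<and> integrable M (\<lambda>x. (f x)\<^sup>2)"

definition hermite_coeff :: "(real \<Rightarrow> real) \<Rightarrow> nat \<Rightarrow> real" where
  "hermite_coeff G q = (\<integral>x. G x * hermite q x \<partial>std_gaussian)"

text \<open>The expansion is convergence of the partial sums in the mean square, stated with the
  nonnegative integral so that no integrability is presupposed.\<close>

definition has_hermite_rank :: "(real \<Rightarrow> real) \<Rightarrow> nat \<Rightarrow> bool" where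
  "has_hermite_rank G m \<longleftrightarrow>
     (\<lambda>N. \<integral>\<^sup>+x. ennreal ((G x - (\<Sum>q=m..N. hermite_coeff G q / fact q * hermite q x))\<^sup>2)
            \<partial>std_gaussian) \<longlonglongrightarrow> 0 \<and>
     hermite_coeff G m \<noteq> 0"

text \<open>Only the restriction of \<open>L\<close> to the positive half-line matters.\<close>

definition slowly_varying :: "(real \<Rightarrow> real) \<Rightarrow> bool" where
  "slowly_varying L \<longleftrightarrow>
     L \<in> borel_measurable (restrict_space borel {0<..}) \<and>
     eventually (\<lambda>x. L x > 0) at_top \<and>
     (\<forall>r>0. ((\<lambda>x. L (r * x) / L x) \<longlongrightarrow> 1) at_top)"

text \<open>Almost surely constant variables count as Gaussian; they need a separate clause because
  \<open>normal_density \<mu> 0\<close> is the zero function.\<close>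

definition gaussian_variable :: "'a measure \<Rightarrow> ('a \<Rightarrow> real) \<Rightarrow> bool" where
  "gaussian_variable M Y \<longleftrightarrow>
     Y \<in> borel_measurable M \<and>
     ((\<exists>\<mu> \<sigma>. \<sigma> > 0 \<and> distributed M lborel Y (normal_density \<mu> \<sigma>)) \<or>
      (\<exists>\<mu>. AE \<omega> in M. Y \<omega> = \<mu>))"

text \<open>The random sequences below are indexed by the positive integers; the value at index
  \<open>0\<close> is irrelevant.\<close>

definition gaussian_sequence :: "'a measure \<Rightarrow> (nat \<Rightarrow> 'a \<Rightarrow> real) \<Rightarrow> bool" where
  "gaussian_sequence M X \<longleftrightarrow>
     (\<forall>F b. finite F \<and> F \<subseteq> {1..} \<longrightarrow> gaussian_variable M (\<lambda>\<omega>. \<Sum>t\<in>F. b t * X t \<omega>))"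

definition stationary_sequence :: "'a measure \<Rightarrow> (nat \<Rightarrow> 'a \<Rightarrow> real) \<Rightarrow> bool" where
  "stationary_sequence M X \<longleftrightarrow>
     (\<forall>t\<ge>1. X t \<in> borel_measurable M) \<and>
     (\<forall>F k. finite F \<and> F \<subseteq> {1..} \<longrightarrow>
        distr M (\<Pi>\<^sub>M t\<in>F. borel) (\<lambda>\<omega>. \<lambda>t\<in>F. X (t + k) \<omega>) =
        distr M (\<Pi>\<^sub>M t\<in>F. borel) (\<lambda>\<omega>. \<lambda>t\<in>F. X t \<omega>))"

end

theory Submission
  imports Defs "HOL-Combinatorics.Multiset_Permutations"
begin

text \<open>
  Write \<open>G = c\<^sub>m H\<^sub>m + (terms of rank > m)\<close>. The higher rank part of \<open>S\<^sub>n\<close> has variance smaller than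
  \<open>A\<^sub>n\<^sup>2\<close> by a factor \<open>n\<^sup>-\<^sup>\<delta>\<close>, so Chebyshev's inequality over dyadic blocks makes it negligible. The
  leading part lies in the \<open>m\<close>-th Wiener chaos: writing \<open>H\<^sub>m(X\<^sub>t)\<close> as the conditional mean of
  \<open>(X\<^sub>t + \<i> X'\<^sub>t)\<^sup>m\<close> with \<open>X'\<close> an independent copy, Wick's formula for the circular family
  \<open>X + \<i> X'\<close> and the Cauchy--Schwarz inequality give moments of order \<open>2 q\<close> bounded by
  \<open>(2 q m)\<^sup>q\<^sup>m\<close> times the \<open>q\<close>-th power of the variance. With \<open>q\<close> of order \<open>log k\<close> a union bound over
  all dyadic blocks of \<open>{1..2\<^sup>k}\<close> is summable in \<open>k\<close>; chaining over the dyadic scales and the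
  Borel--Cantelli lemma give the factor \<open>(log log n)\<^sup>m\<^sup>/\<^sup>2\<close>. Potter's bounds for slowly varying
  functions show that the variance of a block of relative length \<open>u\<close> is at most \<open>C u\<^sup>\<gamma> A\<^sub>n\<^sup>2\<close>, which
  makes the chaining sum geometric, and that \<open>A\<^sub>n\<close> is comparable along dyadic scales.
\<close>

section \<open>Slowly varying functions\<close>

text \<open>The diagram formula for products of real Hermite polynomials has to exclude contractions
  inside each factor. In the circular family \<open>Z\<close> is correlated only with conjugates, so
  the moment of order 2q is a plain sum over the (qm)! ways to match \<open>Z\<close> factors with
  conjugate factors. The covariance kernel is positive semidefinite, hence every matching
  contributes at most as much as the identical one, and that one factorizes into the q-th power of
  the variance. Per standard deviation the bound (2qm)^(qm) costs a multiple of q^(m/2) in the norm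
  of order 2q; this is where the exponent m/2 comes from once q is of order log k, that is log log
  n. All estimates are measured against \<open>D n\<close>, the sum of the squared weights times the
  sum of the |\<rho>(h)|^m for h up to n. It is explicit, monotone and doubling, and A_n enters only
  through a lower bound of its square by a multiple of \<open>D n\<close>. In the block bound all
  squared weights are charged to the full sum, so the small factor comes from the lags alone; blocks
  near the origin, where the weights may be large, are then treated like all others.\<close>

lemma measure_Inter_tail_gt:
  fixes E :: "nat \<Rightarrow> real set"
  assumes E: "\<And>n. E n \<in> sets lebesgue" and sub: "\<And>n. E n \<subseteq> {0..3}"
    and ev: "\<And>u. u \<in> {0..3} \<Longrightarrow> eventually (\<lambda>n. u \<in> E n) sequentially"
  shows "eventually (\<lambda>k. measure lebesgue (\<Inter>n\<in>{k..}. E n) > 5 / 2) sequentially"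
proof -
  define V where "V k = (\<Inter>n\<in>{k..}. E n)" for k
  have V: "V k \<in> sets lebesgue" for k
    unfolding V_def using E by (intro sets.countable_INT'') auto
  have "incseq V"
    unfolding V_def by (intro incseq_SucI) (auto intro!: INF_superset_mono)
  have U: "(\<Union>k. V k) = {0..3}"
  proof
    show "(\<Union>k. V k) \<subseteq> {0..3}" using sub by (force simp: V_def)
    show "{0..3} \<subseteq> (\<Union>k. V k)"
    proof
      fix u :: real assume "u \<in> {0..3}"
      from ev[OF this] obtain k where "\<And>n. n \<ge> k \<Longrightarrow> u \<in> E n"
        unfolding eventually_sequentially by blast
      then show "u \<in> (\<Union>k. V k)" by (auto simp: V_def)
    qed
  qed
  have "(\<lambda>k. measure lebesgue (V k)) \<longlonglongrightarrow> measure lebesgue (\<Union>k. V k)"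
    by (rule Lim_measure_incseq) (use V \<open>incseq V\<close> U in auto)
  then have "(\<lambda>k. measure lebesgue (V k)) \<longlonglongrightarrow> 3" unfolding U by simp
  \<comment> \<open>The sets increase to an interval of length 3. Any threshold in (2, 3) serves:
    two such sets inside an interval of length 4 cannot be disjoint.\<close>
  from order_tendstoD(1)[OF this, of "5 / 2"] show ?thesis unfolding V_def by simp
qed

text \<open>Two subsets of an interval of length 4 whose measures exceed 5/2 intersect; the common point
  links \<open>h\<close> at \<open>X n\<close> with \<open>h\<close> at \<open>X n + U n\<close>.\<close>

lemma slowly_varying_uniform:
  fixes h :: "real \<Rightarrow> real"
  assumes h[measurable]: "h \<in> borel_measurable borel"
    and lim: "\<And>u. ((\<lambda>x. h (x + u) - h x) \<longlongrightarrow> 0) at_top" and \<eta>: "\<eta> > 0"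
  shows "\<exists>x0. \<forall>x\<ge>x0. \<forall>u\<in>{0..1}. \<bar>h (x + u) - h x\<bar> < \<eta>"
proof (rule ccontr)
  assume "\<not> ?thesis"
  then have "\<forall>n::nat. \<exists>x u. x \<ge> real n \<and> u \<in> {0..1} \<and> \<not> \<bar>h (x + u) - h x\<bar> < \<eta>" by meson
  then obtain X U where XU: "\<And>n::nat. X n \<ge> real n" "\<And>n. U n \<in> {0..1}"
    and far: "\<And>n. \<not> \<bar>h (X n + U n) - h (X n)\<bar> < \<eta>" by metis
  have limY: "eventually (\<lambda>n. u \<in> {u\<in>{0..3}. \<bar>h (Y n + u) - h (Y n)\<bar> < \<eta> / 2}) sequentially"
    if "\<And>n. Y n \<ge> real n" "u \<in> {0..3}" for Y :: "nat \<Rightarrow> real" and u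
  proof -
    have "filterlim Y at_top sequentially"
      by (rule filterlim_at_top_mono[OF filterlim_real_sequentially]) (use that in auto)
    from filterlim_compose[OF lim this] have "(\<lambda>n. h (Y n + u) - h (Y n)) \<longlonglongrightarrow> 0" by simp
    then have "eventually (\<lambda>n. \<bar>h (Y n + u) - h (Y n)\<bar> < \<eta> / 2) sequentially"
      using \<eta> by (auto simp: tendsto_iff dist_real_def dest: spec[of _ "\<eta> / 2"])
    then show ?thesis using that by simp
  qed
  have meas: "{u\<in>{0..3}. \<bar>h (y + u) - h y\<bar> < \<eta> / 2} \<in> sets lebesgue" for y
  proof -
    have "{u\<in>{0..3}. \<bar>h (y + u) - h y\<bar> < \<eta> / 2} \<in> sets borel" by measurable
    then show ?thesis by simp
  qed
  define E where "E y = {u\<in>{0..3}. \<bar>h (y + u) - h y\<bar> < \<eta> / 2}" for y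
  have XU': "X n + U n \<ge> real n" for n using XU(1)[of n] XU(2)[of n] by simp
  have "eventually (\<lambda>k. measure lebesgue (\<Inter>n\<in>{k..}. E (X n)) > 5 / 2 \<and>
      measure lebesgue (\<Inter>n\<in>{k..}. E (X n + U n)) > 5 / 2) sequentially"
    unfolding E_def
    by (intro eventually_conj measure_Inter_tail_gt meas limY XU(1) XU') auto
  then obtain k where k: "measure lebesgue (\<Inter>n\<in>{k..}. E (X n)) > 5 / 2"
      "measure lebesgue (\<Inter>n\<in>{k..}. E (X n + U n)) > 5 / 2"
    unfolding eventually_sequentially by blast
  define P where "P = (\<Inter>n\<in>{k..}. E (X n))"
  \<comment> \<open>Translation by \<open>U k\<close> expresses the good increments from
    \<open>X k + U k\<close> as increments from \<open>X k\<close>, so that \<open>P\<close> and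
    \<open>Q\<close> can be compared. Since \<open>U k\<close> is at most 1, both lie in
    {0..4}.\<close>
  define Q where "Q = (\<lambda>w. U k + w) ` (\<Inter>n\<in>{k..}. E (X n + U n))"
  have lP: "P \<in> lmeasurable"
  proof (rule fmeasurableI2[of "{0..3::real}"])
    show "P \<in> sets lebesgue" unfolding P_def E_def by (intro sets.countable_INT'' meas) auto
    show "P \<subseteq> {0..3}" unfolding P_def E_def by auto
  qed simp
  have lW: "(\<Inter>n\<in>{k..}. E (X n + U n)) \<in> lmeasurable"
  proof (rule fmeasurableI2[of "{0..3::real}"])
    show "(\<Inter>n\<in>{k..}. E (X n + U n)) \<in> sets lebesgue" unfolding E_def by (intro sets.countable_INT'' meas) auto
    show "(\<Inter>n\<in>{k..}. E (X n + U n)) \<subseteq> {0..3}" unfolding E_def by auto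
  qed simp
  have lQ: "Q \<in> lmeasurable" unfolding Q_def by (rule measurable_translation[OF lW])
  have mQ: "measure lebesgue Q > 5 / 2" unfolding Q_def measure_translation by (rule k(2))
  have sub: "P \<union> Q \<subseteq> {0..4}"
  proof -
    have "P \<subseteq> {0..3}" unfolding P_def E_def by auto
    moreover have "Q \<subseteq> {0..4}" unfolding Q_def E_def using XU(2)[of k] by force
    ultimately show ?thesis by fastforce
  qed
  have "P \<inter> Q \<noteq> {}"
  proof
    assume d: "P \<inter> Q = {}"
    have "measure lebesgue (P \<union> Q) = measure lebesgue P + measure lebesgue Q"
      using measure_Un3[OF lP lQ] d by simp
    moreover have "measure lebesgue (P \<union> Q) \<le> measure lebesgue {0..4::real}"
      using lP lQ by (intro measure_mono_fmeasurable sub) auto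
    ultimately show False using k(1) mQ unfolding P_def by simp
  qed
  then obtain v w where v: "v \<in> P" "v = U k + w" "w \<in> (\<Inter>n\<in>{k..}. E (X n + U n))"
    unfolding Q_def by auto
  then have "\<bar>h (X k + v) - h (X k)\<bar> < \<eta> / 2" "\<bar>h (X k + U k + w) - h (X k + U k)\<bar> < \<eta> / 2"
    unfolding P_def E_def by auto
  then have "\<bar>h (X k + U k) - h (X k)\<bar> < \<eta>" unfolding v(2) add.assoc by linarith
  with far show False by blast
qed

text \<open>On the logarithmic scale \<open>h\<close> changes by less than \<eta> over any step of
  length at most 1, uniformly far out. Adding up unit steps bounds the change over a distance t by
  \<eta>(t + 1); exponentiating turns the linear part into the power of y/x and the extra step into
  the constant.\<close>

lemma slowly_varying_potter:
  assumes L: "slowly_varying L" and e: "e > 0"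
  obtains x0 where "x0 > 0" and "\<And>x. x \<ge> x0 \<Longrightarrow> L x > 0"
    and "\<And>x y. x0 \<le> x \<Longrightarrow> x \<le> y \<Longrightarrow> L y \<le> 2 * (y / x) powr e * L x"
    and "\<And>x y. x0 \<le> x \<Longrightarrow> x \<le> y \<Longrightarrow> L x \<le> 2 * (y / x) powr e * L y"
proof -
  define h where "h x = ln (L (exp x))" for x
  have "(\<lambda>x::real. exp x) \<in> borel \<rightarrow>\<^sub>M restrict_space borel {0<..}"
    by (rule measurable_restrict_space2) auto
  then have "(\<lambda>x. L (exp x)) \<in> borel_measurable borel"
    using L unfolding slowly_varying_def by (blast intro: measurable_compose)
  then have h: "h \<in> borel_measurable borel" unfolding h_def by measurable
  have "eventually (\<lambda>x. L x > 0) at_top" using L by (simp add: slowly_varying_def)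
  then have "eventually (\<lambda>x. \<forall>y\<ge>x. L y > 0) at_top"
    unfolding eventually_at_top_linorder by (meson order_trans)
  then obtain x1 where x1: "\<And>y. y \<ge> x1 \<Longrightarrow> L y > 0"
    unfolding eventually_at_top_linorder by blast
  have lim: "((\<lambda>x. h (x + u) - h x) \<longlongrightarrow> 0) at_top" for u
  proof -
    have "((\<lambda>x. L (exp u * x) / L x) \<longlongrightarrow> 1) at_top"
      using L by (simp add: slowly_varying_def)
    from filterlim_compose[OF this exp_at_top]
    have "((\<lambda>x. ln (L (exp u * exp x) / L (exp x))) \<longlongrightarrow> ln 1) at_top"
      by (rule tendsto_ln) simp
    moreover have "eventually (\<lambda>x. ln (L (exp u * exp x) / L (exp x)) = h (x + u) - h x) at_top"
    proof -
      have ev: "eventually (\<lambda>x::real. exp (x + v) \<ge> x1) at_top" for v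
        using eventually_ge_at_top[of "ln (max x1 1) - v"]
      proof eventually_elim
        case (elim x)
        then have "exp (ln (max x1 1)) \<le> exp (x + v)" by (subst exp_le_cancel_iff) simp
        then show ?case by simp
      qed
      from ev[of 0] ev[of u]
      show ?thesis
      proof eventually_elim
        case (elim x)
        then show ?case
          using x1[OF elim(1)] x1[OF elim(2)] by (simp add: h_def ln_div exp_add mult.commute)
      qed
    qed
    ultimately show ?thesis by (simp add: tendsto_cong)
  qed
  \<comment> \<open>The bound \<open>e\<close> controls the exponent, and the bound
    \<open>ln 2\<close> makes the one surplus step cost a factor of at most 2.\<close>
  define \<eta> where "\<eta> = min e (ln 2)"
  have \<eta>: "\<eta> > 0" "\<eta> \<le> e" "\<eta> \<le> ln 2" using e by (auto simp: \<eta>_def)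
  from slowly_varying_uniform[OF h lim \<eta>(1)] obtain t0 where
    t0: "\<And>x u. x \<ge> t0 \<Longrightarrow> u \<in> {0..1} \<Longrightarrow> \<bar>h (x + u) - h x\<bar> < \<eta>" by blast
  have step: "\<bar>h (x + v) - h x\<bar> \<le> \<eta> * real (Suc n)" if "x \<ge> t0" "0 \<le> v" "v \<le> real (Suc n)" for x v n
    using that
  proof (induction n arbitrary: v)
    case 0
    then show ?case using t0[of x v] by simp
  next
    case (Suc n)
    show ?case
    proof (cases "v \<le> real (Suc n)")
      case True
      then have "\<bar>h (x + v) - h x\<bar> \<le> \<eta> * real (Suc n)" using Suc by blast
      also have "\<dots> \<le> \<eta> * real (Suc (Suc n))" using \<eta>(1) by simp
      finally show ?thesis .
    next
      case False
      have "\<bar>h (x + (v - 1)) - h x\<bar> \<le> \<eta> * real (Suc n)" using Suc False by auto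
      moreover have "\<bar>h (x + (v - 1) + 1) - h (x + (v - 1))\<bar> < \<eta>"
        using Suc.prems False by (intro t0) auto
      ultimately show ?thesis by (simp add: algebra_simps abs_if split: if_splits)
    qed
  qed
  have step': "\<bar>h y - h x\<bar> \<le> e * (y - x) + ln 2" if "x \<ge> t0" "x \<le> y" for x y
  proof -
    define n where "n = nat \<lfloor>y - x\<rfloor>"
    have n: "real n \<le> y - x" "y - x \<le> real (Suc n)" using that unfolding n_def by linarith+
    have "\<bar>h (x + (y - x)) - h x\<bar> \<le> \<eta> * real (Suc n)" using that n by (intro step) auto
    also have "\<dots> = \<eta> * real n + \<eta>" by (simp add: algebra_simps)
    also have "\<dots> \<le> e * (y - x) + ln 2" using n \<eta> by (intro add_mono mult_mono) auto
    finally show ?thesis by simp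
  qed
  define x0 where "x0 = max (max x1 1) (exp t0)"
  have main: "L y \<le> 2 * (y / x) powr e * L x \<and> L x \<le> 2 * (y / x) powr e * L y" if xy: "x0 \<le> x" "x \<le> y" for x y
  proof -
    have pos: "x > 0" "y > 0" "L x > 0" "L y > 0" using xy x1 by (auto simp: x0_def)
    have "exp t0 \<le> x" using xy by (auto simp: x0_def)
    then have "t0 \<le> ln x" using pos by (simp add: ln_ge_iff)
    then have b: "\<bar>h (ln y) - h (ln x)\<bar> \<le> e * (ln y - ln x) + ln 2"
      using xy pos by (intro step') auto
    have hx: "h (ln x) = ln (L x)" "h (ln y) = ln (L y)" using pos by (simp_all add: h_def)
    have r: "ln (2 * (y / x) powr e * z) = ln 2 + e * (ln y - ln x) + ln z" if "z > 0" for z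
      using pos that by (simp add: ln_mult ln_powr ln_div)
    have "ln (L y) \<le> ln (2 * (y / x) powr e * L x)" "ln (L x) \<le> ln (2 * (y / x) powr e * L y)"
      unfolding r[OF pos(3)] r[OF pos(4)] using b unfolding hx by linarith+
    then show ?thesis using pos by simp
  qed
  show ?thesis
  proof (rule that)
    show "x0 > 0" by (simp add: x0_def)
    show "L x > 0" if "x \<ge> x0" for x using x1 that by (simp add: x0_def)
  qed (use main in blast)+
qed

section \<open>Regularly varying sequences and their partial sums\<close>

text \<open>Potter's bounds, taken as the definition of regular variation of a sequence.\<close>

definition regular_seq :: "(nat \<Rightarrow> real) \<Rightarrow> real \<Rightarrow> bool" where
  "regular_seq f \<beta> \<longleftrightarrow> (\<forall>e>0. \<exists>C n0. C > 0 \<and> n0 \<ge> 1 \<and> (\<forall>n\<ge>n0. f n > 0) \<and>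
     (\<forall>s n. n0 \<le> s \<longrightarrow> s \<le> n \<longrightarrow> f s \<le> C * (real s / real n) powr (\<beta> - e) * f n \<and>
        (real s / real n) powr (\<beta> + e) * f n \<le> C * f s))"

lemma regular_seqE:
  assumes "regular_seq f \<beta>" "e > 0"
  obtains C n0 where "C > 0" "n0 \<ge> (1::nat)" "\<And>n. n \<ge> n0 \<Longrightarrow> f n > 0"
    "\<And>s n. n0 \<le> s \<Longrightarrow> s \<le> n \<Longrightarrow> f s \<le> C * (real s / real n) powr (\<beta> - e) * f n"
    "\<And>s n. n0 \<le> s \<Longrightarrow> s \<le> n \<Longrightarrow> (real s / real n) powr (\<beta> + e) * f n \<le> C * f s"
proof -
  from assms obtain C n0 where *: "C > 0 \<and> n0 \<ge> 1 \<and> (\<forall>n\<ge>n0. f n > 0) \<and>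
     (\<forall>s n. n0 \<le> s \<longrightarrow> s \<le> n \<longrightarrow> f s \<le> C * (real s / real n) powr (\<beta> - e) * f n \<and>
        (real s / real n) powr (\<beta> + e) * f n \<le> C * f s)"
    unfolding regular_seq_def by blast
  show ?thesis by (rule that[of C n0]) (use * in blast)+
qed

lemma regular_seq_posE:
  assumes "regular_seq f \<beta>"
  obtains n0 where "n0 \<ge> (1::nat)" "\<And>n. n \<ge> n0 \<Longrightarrow> f n > 0"
  using regular_seqE[OF assms zero_less_one] by metis

lemma regular_seq_slowly_varying:
  assumes L: "slowly_varying L" and c: "c > 0"
    and f: "\<And>n. n \<ge> 1 \<Longrightarrow> f n = c * real n powr \<beta> * L (real n)"
  shows "regular_seq f \<beta>"
  unfolding regular_seq_def
proof (intro allI impI)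
  fix e :: real assume e: "e > 0"
  from slowly_varying_potter[OF L e] obtain x0 where x0: "x0 > 0" "\<And>x. x \<ge> x0 \<Longrightarrow> L x > 0"
    "\<And>x y. x0 \<le> x \<Longrightarrow> x \<le> y \<Longrightarrow> L y \<le> 2 * (y / x) powr e * L x"
    "\<And>x y. x0 \<le> x \<Longrightarrow> x \<le> y \<Longrightarrow> L x \<le> 2 * (y / x) powr e * L y" by blast
  define n0 where "n0 = Suc (nat \<lceil>x0\<rceil>)"
  have n0: "x0 \<le> real n" "n \<ge> 1" if "n \<ge> n0" for n
    using that unfolding n0_def by linarith+
  have main: "f s \<le> 2 * (real s / real n) powr (\<beta> - e) * f n \<and> (real s / real n) powr (\<beta> + e) * f n \<le> 2 * f s"
    if sn: "n0 \<le> s" "s \<le> n" for s n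
  proof -
    have n: "n \<ge> n0" using sn by simp
    have pos: "real s > 0" "real n > 0" using n0[OF sn(1)] n0[OF n] by auto
    have inv: "(real n / real s) powr e = (real s / real n) powr (- e)"
      using pos by (simp add: powr_divide powr_minus field_simps)
    have p: "(real s / real n) powr (\<beta> - e) * real n powr \<beta> = real s powr \<beta> * (real s / real n) powr (- e)"
      "(real s / real n) powr (\<beta> + e) * real n powr \<beta> = real s powr \<beta> * (real s / real n) powr e"
      using pos by (simp_all add: powr_divide powr_add powr_diff powr_minus field_simps)
    have ee: "(real s / real n) powr e * (real s / real n) powr (- e) = 1"
      using pos by (simp flip: powr_add)
    have 1: "L (real s) \<le> 2 * (real s / real n) powr (- e) * L (real n)"
      using x0(4)[of "real s" "real n"] n0(1)[OF sn(1)] sn inv by simp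
    have 2: "(real s / real n) powr e * L (real n) \<le> 2 * L (real s)"
    proof -
      have "(real s / real n) powr e * L (real n) \<le> (real s / real n) powr e * (2 * (real s / real n) powr (- e) * L (real s))"
        using x0(3)[of "real s" "real n"] n0(1)[OF sn(1)] sn inv by (intro mult_left_mono) auto
      also have "\<dots> = 2 * ((real s / real n) powr e * (real s / real n) powr (- e)) * L (real s)" by simp
      finally show ?thesis unfolding ee by simp
    qed
    have fs: "f s = c * real s powr \<beta> * L (real s)" "f n = c * real n powr \<beta> * L (real n)"
      using f n0(2)[OF sn(1)] n0(2)[OF n] by auto
    have "f s \<le> c * real s powr \<beta> * (2 * (real s / real n) powr (- e) * L (real n))"
      unfolding fs using 1 c by (intro mult_left_mono) auto
    also have "\<dots> = 2 * c * ((real s / real n) powr (\<beta> - e) * real n powr \<beta>) * L (real n)"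
      unfolding p by simp
    also have "\<dots> = 2 * (real s / real n) powr (\<beta> - e) * f n" unfolding fs by simp
    finally have A: "f s \<le> 2 * (real s / real n) powr (\<beta> - e) * f n" .
    have "(real s / real n) powr (\<beta> + e) * f n = c * ((real s / real n) powr (\<beta> + e) * real n powr \<beta>) * L (real n)"
      unfolding fs by simp
    also have "\<dots> = c * real s powr \<beta> * ((real s / real n) powr e * L (real n))" unfolding p by simp
    also have "\<dots> \<le> c * real s powr \<beta> * (2 * L (real s))"
      using 2 c by (intro mult_left_mono) auto
    finally show ?thesis using A unfolding fs by simp
  qed
  have "f n > 0" if "n \<ge> n0" for n
    using f[OF n0(2)[OF that]] x0(2)[OF n0(1)[OF that]] n0(2)[OF that] c by simp
  with main show "\<exists>C n0. C > 0 \<and> n0 \<ge> 1 \<and> (\<forall>n\<ge>n0. f n > 0) \<and>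
     (\<forall>s n. n0 \<le> s \<longrightarrow> s \<le> n \<longrightarrow> f s \<le> C * (real s / real n) powr (\<beta> - e) * f n \<and>
        (real s / real n) powr (\<beta> + e) * f n \<le> C * f s)"
    by (intro exI[of _ 2] exI[of _ n0]) (auto simp: n0_def)
qed

text \<open>The definition leaves a free constant, so it survives two-sided comparison up to a
  factor. This covers asymptotic equivalence as well as changes at finitely many indices, such as
  passing to absolute values.\<close>

lemma regular_seq_comparable:
  assumes g: "regular_seq g \<beta>" and K: "K > 0"
    and fg: "eventually (\<lambda>n. g n \<le> K * f n \<and> f n \<le> K * g n) sequentially"
  shows "regular_seq f \<beta>"
  unfolding regular_seq_def
proof (intro allI impI)
  fix e :: real assume e: "e > 0"
  from regular_seqE[OF g e] obtain C n0 where C: "C > 0" "n0 \<ge> (1::nat)" "\<And>n. n \<ge> n0 \<Longrightarrow> g n > 0"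
    "\<And>s n. n0 \<le> s \<Longrightarrow> s \<le> n \<Longrightarrow> g s \<le> C * (real s / real n) powr (\<beta> - e) * g n"
    "\<And>s n. n0 \<le> s \<Longrightarrow> s \<le> n \<Longrightarrow> (real s / real n) powr (\<beta> + e) * g n \<le> C * g s" by blast
  from fg obtain n1 where n1: "\<And>n. n \<ge> n1 \<Longrightarrow> g n \<le> K * f n" "\<And>n. n \<ge> n1 \<Longrightarrow> f n \<le> K * g n"
    unfolding eventually_sequentially by blast
  define N where "N = max n0 n1"
  have "f s \<le> K * C * K * (real s / real n) powr (\<beta> - e) * f n \<and>
      (real s / real n) powr (\<beta> + e) * f n \<le> K * C * K * f s" if sn: "N \<le> s" "s \<le> n" for s n
  proof
    have "f s \<le> K * g s" using n1(2) sn by (simp add: N_def)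
    also have "\<dots> \<le> K * (C * (real s / real n) powr (\<beta> - e) * g n)"
      using C(4)[of s n] K sn by (intro mult_left_mono) (auto simp: N_def)
    also have "\<dots> \<le> K * (C * (real s / real n) powr (\<beta> - e) * (K * f n))"
      using n1(1)[of n] K C(1) sn by (intro mult_left_mono mult_nonneg_nonneg) (auto simp: N_def)
    finally show "f s \<le> K * C * K * (real s / real n) powr (\<beta> - e) * f n" by (simp add: mult_ac)
    have "(real s / real n) powr (\<beta> + e) * f n \<le> (real s / real n) powr (\<beta> + e) * (K * g n)"
      using n1(2)[of n] sn by (intro mult_left_mono) (auto simp: N_def)
    also have "\<dots> = K * ((real s / real n) powr (\<beta> + e) * g n)" by simp
    also have "\<dots> \<le> K * (C * g s)"
      using C(5)[of s n] K sn by (intro mult_left_mono) (auto simp: N_def)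
    also have "\<dots> \<le> K * (C * (K * f s))"
      using n1(1)[of s] K C(1) sn by (intro mult_left_mono) (auto simp: N_def)
    finally show "(real s / real n) powr (\<beta> + e) * f n \<le> K * C * K * f s" by (simp add: mult_ac)
  qed
  moreover have "f n > 0" if "n \<ge> N" for n
  proof -
    have "0 < K * f n" using C(3)[of n] n1(1)[of n] that by (simp add: N_def)
    then show ?thesis using K by (simp add: zero_less_mult_iff)
  qed
  ultimately show "\<exists>C n0. C > 0 \<and> n0 \<ge> 1 \<and> (\<forall>n\<ge>n0. f n > 0) \<and>
     (\<forall>s n. n0 \<le> s \<longrightarrow> s \<le> n \<longrightarrow> f s \<le> C * (real s / real n) powr (\<beta> - e) * f n \<and>
        (real s / real n) powr (\<beta> + e) * f n \<le> C * f s)"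
    using C(1,2) K by (intro exI[of _ "K * C * K"] exI[of _ N]) (auto simp: N_def)
qed

lemma regular_seq_asymp_equiv:
  assumes g: "regular_seq g \<beta>" and "f \<sim>[at_top] g"
  shows "regular_seq f \<beta>"
proof (rule regular_seq_comparable[OF g])
  obtain n0 where g0: "\<And>n. n \<ge> n0 \<Longrightarrow> g n > 0" using regular_seq_posE[OF g] by metis
  have "((\<lambda>n. if f n = 0 \<and> g n = 0 then 1 else f n / g n) \<longlongrightarrow> 1) sequentially"
    using assms(2) by (simp add: asymp_equiv_def)
  from order_tendstoD(1)[OF this, of "1/2"] order_tendstoD(2)[OF this, of 2] eventually_ge_at_top[of n0]
  have "eventually (\<lambda>n. (if f n = 0 \<and> g n = 0 then 1 else f n / g n) > 1 / 2 \<and>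
    (if f n = 0 \<and> g n = 0 then 1 else f n / g n) < 2 \<and> n \<ge> n0) sequentially"
    by (simp add: eventually_conj_iff)
  then show "eventually (\<lambda>n. g n \<le> 2 * f n \<and> f n \<le> 2 * g n) sequentially"
  proof eventually_elim
    case (elim n)
    then show ?case using g0[of n] by (auto simp: field_simps split: if_splits)
  qed
qed simp

lemma regular_seq_cong:
  assumes "regular_seq g \<beta>" and "eventually (\<lambda>n. f n = g n) sequentially"
  shows "regular_seq f \<beta>"
proof (rule regular_seq_comparable[OF assms(1), of 1])
  obtain n0 where "\<And>n. n \<ge> n0 \<Longrightarrow> g n > 0" using regular_seq_posE[OF assms(1)] by metis
  then show "eventually (\<lambda>n. g n \<le> 1 * f n \<and> f n \<le> 1 * g n) sequentially"
    using assms(2) by (auto elim: eventually_mono)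
qed simp

lemma regular_seq_power:
  assumes f: "regular_seq f \<beta>" and m: "m \<ge> 1"
  shows "regular_seq (\<lambda>n. f n ^ m) (real m * \<beta>)"
  unfolding regular_seq_def
proof (intro allI impI)
  fix e :: real assume e: "e > 0"
  then have "e / m > 0" using m by simp
  from regular_seqE[OF f this] obtain C n0 where C: "C > 0" "n0 \<ge> (1::nat)" "\<And>n. n \<ge> n0 \<Longrightarrow> f n > 0"
    "\<And>s n. n0 \<le> s \<Longrightarrow> s \<le> n \<Longrightarrow> f s \<le> C * (real s / real n) powr (\<beta> - e / m) * f n"
    "\<And>s n. n0 \<le> s \<Longrightarrow> s \<le> n \<Longrightarrow> (real s / real n) powr (\<beta> + e / m) * f n \<le> C * f s" by blast
  have pw: "(x powr (\<beta> - e / m)) ^ m = x powr (real m * \<beta> - e)" "(x powr (\<beta> + e / m)) ^ m = x powr (real m * \<beta> + e)"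
    if "x > 0" for x :: real
  proof -
    have "real m * (\<beta> - e / m) = real m * \<beta> - e" "real m * (\<beta> + e / m) = real m * \<beta> + e"
      using m by (simp_all add: field_simps)
    then show "(x powr (\<beta> - e / m)) ^ m = x powr (real m * \<beta> - e)" "(x powr (\<beta> + e / m)) ^ m = x powr (real m * \<beta> + e)"
      using that m by (simp_all add: powr_power)
  qed
  have "f s ^ m \<le> C ^ m * (real s / real n) powr (real m * \<beta> - e) * f n ^ m \<and>
      (real s / real n) powr (real m * \<beta> + e) * f n ^ m \<le> C ^ m * f s ^ m" if sn: "n0 \<le> s" "s \<le> n" for s n
  proof
    have pos: "real s / real n > 0" using sn C(2) by simp
    have "f s ^ m \<le> (C * (real s / real n) powr (\<beta> - e / m) * f n) ^ m"
      using C(4)[OF sn] C(3)[of s] sn by (intro power_mono) auto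
    then show "f s ^ m \<le> C ^ m * (real s / real n) powr (real m * \<beta> - e) * f n ^ m"
      by (simp add: power_mult_distrib pw[OF pos])
    have "((real s / real n) powr (\<beta> + e / m) * f n) ^ m \<le> (C * f s) ^ m"
      using C(5)[OF sn] C(3)[of n] sn by (intro power_mono) auto
    then show "(real s / real n) powr (real m * \<beta> + e) * f n ^ m \<le> C ^ m * f s ^ m"
      by (simp add: power_mult_distrib pw[OF pos])
  qed
  then show "\<exists>C n0. C > 0 \<and> n0 \<ge> 1 \<and> (\<forall>n\<ge>n0. f n ^ m > 0) \<and>
     (\<forall>s n. n0 \<le> s \<longrightarrow> s \<le> n \<longrightarrow> f s ^ m \<le> C * (real s / real n) powr (real m * \<beta> - e) * f n ^ m \<and>
        (real s / real n) powr (real m * \<beta> + e) * f n ^ m \<le> C * f s ^ m)"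
    using C(1-3) by (intro exI[of _ "C ^ m"] exI[of _ n0]) auto
qed

text \<open>Comparison with an integral: the power is nonincreasing, so by the mean value theorem
  each term is at most the increment of the primitive over the preceding unit interval. The first
  interval is treated apart because the primitive need not be differentiable at 0.\<close>

lemma sum_powr_le:
  assumes "-1 < \<gamma>" "\<gamma> \<le> 0"
  shows "(\<Sum>s=1..n. real s powr \<gamma>) \<le> real n powr (\<gamma> + 1) / (\<gamma> + 1)"
proof (induction n)
  case (Suc n)
  have "(\<gamma> + 1) * real (Suc n) powr \<gamma> \<le> real (Suc n) powr (\<gamma> + 1) - real n powr (\<gamma> + 1)"
  proof (cases "n = 0")
    case True
    then show ?thesis using assms by simp
  next
    case False
    have "\<exists>z. real n < z \<and> z < real (Suc n) \<and>
      real (Suc n) powr (\<gamma> + 1) - real n powr (\<gamma> + 1) = (real (Suc n) - real n) * ((\<gamma> + 1) * z powr \<gamma>)"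
    proof (rule MVT2)
      fix x assume "real n \<le> x" "x \<le> real (Suc n)"
      then have "x > 0" using False by simp
      then show "((\<lambda>x. x powr (\<gamma> + 1)) has_real_derivative (\<gamma> + 1) * x powr \<gamma>) (at x)"
        using has_real_derivative_powr[of x "\<gamma> + 1"] by simp
    qed simp
    then obtain z where z: "real n < z" "z < real (Suc n)"
      "real (Suc n) powr (\<gamma> + 1) - real n powr (\<gamma> + 1) = (\<gamma> + 1) * z powr \<gamma>" by auto
    have "real (Suc n) powr \<gamma> \<le> z powr \<gamma>"
      using z assms False by (intro powr_mono2') auto
    then show ?thesis unfolding z(3) using assms by (intro mult_left_mono) auto
  qed
  with Suc assms show ?case by (simp add: field_simps)
qed simp

lemma filterlim_real_powr_at_top:
  assumes "\<gamma> > 0"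
  shows "filterlim (\<lambda>n. real n powr \<gamma>) at_top sequentially"
  unfolding filterlim_at_top
proof
  fix Z :: real
  show "eventually (\<lambda>n. Z \<le> real n powr \<gamma>) sequentially"
    using eventually_ge_at_top[of "nat \<lceil>(max Z 1) powr (1 / \<gamma>)\<rceil>"]
  proof eventually_elim
    case (elim n)
    then have "(max Z 1) powr (1 / \<gamma>) \<le> real n" by linarith
    then have "((max Z 1) powr (1 / \<gamma>)) powr \<gamma> \<le> real n powr \<gamma>"
      using assms by (intro powr_mono2) auto
    then show ?case using assms by (simp add: powr_powr)
  qed
qed

text \<open>The setting of Karamata's theorem at the level of orders of magnitude: for an index
  above -1 the partial sums are of order n f(n). Finitely many initial values may be irregular or
  zero, and the sums start at index 0 because lag 0 has to be counted.\<close>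

locale regular_partial_sums =
  fixes f :: "nat \<Rightarrow> real" and \<beta> :: real
  assumes regular: "regular_seq f \<beta>" and \<beta>: "\<beta> > -1" and nonneg: "\<And>n. f n \<ge> 0"
begin

definition F :: "nat \<Rightarrow> real" where "F n = (\<Sum>s\<le>n. f s)"

lemma F_mono: "k \<le> n \<Longrightarrow> F k \<le> F n"
  unfolding F_def by (intro sum_mono2) (auto simp: nonneg)

lemma F_nonneg: "F n \<ge> 0"
  unfolding F_def by (intro sum_nonneg nonneg)

text \<open>The upper half of the range suffices: about n/2 indices s lie above n/2, and there f(s)
  is at least a fixed multiple of f(n). Taking \<open>e = 1\<close> makes the Potter exponent
  positive, hence monotone in s/n.\<close>

lemma lower: "\<exists>c>0. \<exists>N. \<forall>n\<ge>N. c * real n * f n \<le> F n"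
proof -
  from regular_seqE[OF regular, of 1] obtain C n0 where C: "C > 0" "n0 \<ge> (1::nat)" "\<And>n. n \<ge> n0 \<Longrightarrow> f n > 0"
    "\<And>s n. n0 \<le> s \<Longrightarrow> s \<le> n \<Longrightarrow> (real s / real n) powr (\<beta> + 1) * f n \<le> C * f s" by (metis zero_less_one)
  define c where "c = (1 / 2) powr (\<beta> + 1) / C"
  have "c > 0" using C by (simp add: c_def)
  have main: "c / 2 * real n * f n \<le> F n" if n: "n \<ge> 2 * n0" for n
  proof -
    have fs: "c * f n \<le> f s" if s: "s \<in> {n div 2 + 1..n}" for s
    proof -
      have "1 / 2 \<le> real s / real n" using s n C(2) by (auto simp: field_simps)
      then have "(1 / 2) powr (\<beta> + 1) * f n \<le> (real s / real n) powr (\<beta> + 1) * f n"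
        using \<beta> by (intro mult_right_mono powr_mono2 nonneg) auto
      also have "\<dots> \<le> C * f s" using s n by (intro C(4)) auto
      finally show ?thesis using C(1) by (simp add: c_def field_simps)
    qed
    have "c / 2 * real n * f n \<le> real (card {n div 2 + 1..n}) * (c * f n)"
    proof -
      have "real n / 2 \<le> real (card {n div 2 + 1..n})" by simp
      then have "real n / 2 * (c * f n) \<le> real (card {n div 2 + 1..n}) * (c * f n)"
        using \<open>c > 0\<close> nonneg by (intro mult_right_mono) auto
      then show ?thesis by (simp add: mult_ac)
    qed
    also have "\<dots> \<le> (\<Sum>s=n div 2 + 1..n. f s)"
      using sum_bounded_below[of "{n div 2 + 1..n}" "c * f n" f] fs by simp
    also have "\<dots> \<le> F n" unfolding F_def by (intro sum_mono2) (auto simp: nonneg)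
    finally show ?thesis .
  qed
  then show ?thesis using \<open>c > 0\<close> by (intro exI[of _ "c / 2"]) auto
qed

text \<open>An exponent \<gamma> strictly between -1 and \<beta>, and not positive, makes Potter's
  bound f(s) <= C (s/n)^\<gamma> f(n) summable at the right order. The sum up to \<open>n0\<close>
  is a constant, and it is absorbed because n f(n) stays bounded away from 0.\<close>

lemma upper: "\<exists>C>0. \<exists>N. \<forall>n\<ge>N. F n \<le> C * real n * f n"
proof -
  define \<gamma> where "\<gamma> = min ((\<beta> - 1) / 2) 0"
  have \<gamma>: "-1 < \<gamma>" "\<gamma> \<le> 0" "\<gamma> < \<beta>" using \<beta> by (auto simp: \<gamma>_def min_def)
  have "\<beta> - \<gamma> > 0" using \<gamma> by simp
  from regular_seqE[OF regular this] obtain C n0 where C: "C > 0" "n0 \<ge> (1::nat)" "\<And>n. n \<ge> n0 \<Longrightarrow> f n > 0"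
    "\<And>s n. n0 \<le> s \<Longrightarrow> s \<le> n \<Longrightarrow> f s \<le> C * (real s / real n) powr (\<beta> - (\<beta> - \<gamma>)) * f n"
    by metis
  have C4: "f s \<le> C * (real s / real n) powr \<gamma> * f n" if "n0 \<le> s" "s \<le> n" for s n
    using C(4)[OF that] by simp
  define H where "H = F n0"
  have H: "H \<ge> 0" unfolding H_def by (rule F_nonneg)
  \<comment> \<open>A lower bound for n f(n) when n is at least \<open>n0\<close>: since \<gamma> >
    -1, Potter's bound gives f(n0) <= C (n/n0) f(n).\<close>
  define \<kappa> where "\<kappa> = real n0 * f n0 / C"
  have \<kappa>: "\<kappa> > 0" using C by (simp add: \<kappa>_def)
  have main: "F n \<le> (H / \<kappa> + C / (\<gamma> + 1)) * real n * f n" if n: "n \<ge> n0" for n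
  proof -
    have np: "real n > 0" "real n0 > 0" using n C(2) by auto
    have "f n0 \<le> C * (real n0 / real n) powr \<gamma> * f n" using n by (intro C4) auto
    also have "\<dots> \<le> C * (real n / real n0) * f n"
    proof -
      have "(real n0 / real n) powr \<gamma> \<le> (real n0 / real n) powr (-1)"
        using \<gamma> np n by (intro powr_mono') auto
      also have "\<dots> = real n / real n0" using np by (simp add: powr_minus_divide)
      finally show ?thesis using C nonneg by (intro mult_right_mono mult_left_mono) auto
    qed
    finally have "\<kappa> \<le> real n * f n" using np C by (simp add: \<kappa>_def field_simps)
    then have 1: "H \<le> H / \<kappa> * (real n * f n)"
      using H \<kappa> by (simp add: field_simps mult_left_mono)
    have "(\<Sum>s\<in>{n0<..n}. f s) \<le> (\<Sum>s\<in>{n0<..n}. C * (real s / real n) powr \<gamma> * f n)"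
      by (intro sum_mono C4) auto
    also have "\<dots> \<le> (\<Sum>s=1..n. C * (real s / real n) powr \<gamma> * f n)"
      using C nonneg by (intro sum_mono2) auto
    also have "\<dots> = C * f n / real n powr \<gamma> * (\<Sum>s=1..n. real s powr \<gamma>)"
      unfolding sum_distrib_left using np by (intro sum.cong refl) (auto simp: powr_divide)
    also have "\<dots> \<le> C * f n / real n powr \<gamma> * (real n powr (\<gamma> + 1) / (\<gamma> + 1))"
      using C nonneg by (intro mult_left_mono sum_powr_le \<gamma>) auto
    also have "\<dots> = C / (\<gamma> + 1) * (real n * f n)"
      using np by (simp add: powr_add)
    finally have 2: "(\<Sum>s\<in>{n0<..n}. f s) \<le> C / (\<gamma> + 1) * (real n * f n)" .
    have "{..n} = {..n0} \<union> {n0<..n}" using n by auto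
    then have "F n = H + (\<Sum>s\<in>{n0<..n}. f s)"
      unfolding F_def H_def by (simp add: sum.union_disjoint ivl_disj_int)
    with 1 2 show ?thesis by (simp add: algebra_simps)
  qed
  have "H / \<kappa> + C / (\<gamma> + 1) > 0" using H \<kappa> C \<gamma> by (intro add_nonneg_pos) auto
  then show ?thesis using main by blast
qed

lemma karamata:
  obtains c C N where "c > 0" "C > 0" "N \<ge> (1::nat)" "\<And>n. n \<ge> N \<Longrightarrow> f n > 0"
    "\<And>n. n \<ge> N \<Longrightarrow> c * real n * f n \<le> F n" "\<And>n. n \<ge> N \<Longrightarrow> F n \<le> C * real n * f n"
proof -
  obtain c N1 where "c > 0" "\<And>n. n \<ge> N1 \<Longrightarrow> c * real n * f n \<le> F n" using lower by blast
  moreover obtain C N2 where "C > 0" "\<And>n. n \<ge> N2 \<Longrightarrow> F n \<le> C * real n * f n" using upper by blast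
  moreover obtain N3 where "N3 \<ge> 1" "\<And>n. n \<ge> N3 \<Longrightarrow> f n > 0" using regular_seq_posE[OF regular] by metis
  ultimately show ?thesis by (intro that[of c C "max N1 (max N2 N3)"]) auto
qed

lemma doubling:
  obtains K N where "K > 0" "N \<ge> (1::nat)" "\<And>n. n \<ge> N \<Longrightarrow> F n > 0" "\<And>n. n \<ge> N \<Longrightarrow> F (2 * n) \<le> K * F n"
proof -
  obtain c C N where k: "c > 0" "C > 0" "N \<ge> (1::nat)" "\<And>n. n \<ge> N \<Longrightarrow> f n > 0"
    "\<And>n. n \<ge> N \<Longrightarrow> c * real n * f n \<le> F n" "\<And>n. n \<ge> N \<Longrightarrow> F n \<le> C * real n * f n" using karamata by blast
  from regular_seqE[OF regular, of 1] obtain D n0 where D: "D > 0" "n0 \<ge> (1::nat)"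
    "\<And>s n. n0 \<le> s \<Longrightarrow> s \<le> n \<Longrightarrow> (real s / real n) powr (\<beta> + 1) * f n \<le> D * f s" by (metis zero_less_one)
  define h where "h = (1 / 2 :: real) powr (\<beta> + 1)"
  have h: "h > 0" by (simp add: h_def)
  have main: "F (2 * n) \<le> C * 2 * D / (h * c) * F n" if n: "n \<ge> max N n0" for n
  proof -
    have "h * f (2 * n) \<le> D * f n" using D(3)[of n "2 * n"] n D(2) by (simp add: h_def)
    then have "f (2 * n) \<le> D / h * f n" using h by (simp add: field_simps)
    then have "C * real (2 * n) * f (2 * n) \<le> C * real (2 * n) * (D / h * f n)"
      using k(2) by (intro mult_left_mono) auto
    moreover have "F (2 * n) \<le> C * real (2 * n) * f (2 * n)" using n by (intro k(6)) auto
    moreover have "C * real (2 * n) * (D / h * f n) = C * 2 * D / (h * c) * (c * real n * f n)"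
      using k(1) by (simp add: field_simps)
    moreover have "\<dots> \<le> C * 2 * D / (h * c) * F n"
      using n k D h by (intro mult_left_mono k(5)) auto
    ultimately show ?thesis by linarith
  qed
  have "F n > 0" if "n \<ge> max N n0" for n
  proof -
    have "0 < c * real n * f n" using k(1,3) k(4)[of n] that by auto
    then show ?thesis using k(5)[of n] that by auto
  qed
  with main show ?thesis
    using k D h by (intro that[of "C * 2 * D / (h * c)" "max N n0"]) auto
qed

text \<open>By Karamata F(l) is of order l f(l), and Potter's bound for f then yields a positive
  power of l/n. The bound has to hold from l = 1 on, since it will be applied to dyadic blocks of
  every size.\<close>

lemma growth:
  assumes "f 0 > 0"
  obtains K \<gamma> where "K > 0" "\<gamma> > 0" "\<And>l n. 1 \<le> l \<Longrightarrow> l \<le> n \<Longrightarrow> F l \<le> K * (real l / real n) powr \<gamma> * F n"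
proof -
  obtain c C N where k: "c > 0" "C > 0" "N \<ge> (1::nat)" "\<And>n. n \<ge> N \<Longrightarrow> f n > 0"
    "\<And>n. n \<ge> N \<Longrightarrow> c * real n * f n \<le> F n" "\<And>n. n \<ge> N \<Longrightarrow> F n \<le> C * real n * f n" using karamata by blast
  \<comment> \<open>Half of 1 + \<beta> is given up in Potter's bound, so that the remaining
    exponent 1 + \<beta> - e is again e.\<close>
  define e where "e = (1 + \<beta>) / 2"
  have e: "e > 0" using \<beta> by (simp add: e_def)
  from regular_seqE[OF regular e] obtain D n0 where D: "D > 0" "n0 \<ge> (1::nat)"
    "\<And>s n. n0 \<le> s \<Longrightarrow> s \<le> n \<Longrightarrow> f s \<le> D * (real s / real n) powr (\<beta> - e) * f n" by metis
  define P where "P = max N n0"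
  define K where "K = max 1 (C * D / c)"
  have K: "K \<ge> 1" "K \<ge> C * D / c" by (auto simp: K_def)
  have big: "F l \<le> K * (real l / real n) powr e * F n" if l: "P \<le> l" "l \<le> n" for l n
  proof -
    have pos: "real l > 0" "real n > 0" using l k(3) by (auto simp: P_def)
    have "F l \<le> C * real l * f l" using l by (intro k(6)) (auto simp: P_def)
    also have "\<dots> \<le> C * real l * (D * (real l / real n) powr (\<beta> - e) * f n)"
      using l k(2) by (intro mult_left_mono D(3)) (auto simp: P_def)
    also have "\<dots> = C * D / c * (real l / real n * (real l / real n) powr (\<beta> - e)) * (c * real n * f n)"
      using pos k(1) by simp
    also have "real l / real n * (real l / real n) powr (\<beta> - e) = (real l / real n) powr e"
    proof -
      have e': "e = 1 + (\<beta> - e)" by (simp add: e_def field_simps)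
      have "(real l / real n) powr e = (real l / real n) powr (1 + (\<beta> - e))" by (rule arg_cong[OF e'])
      also have "\<dots> = (real l / real n) powr 1 * (real l / real n) powr (\<beta> - e)" by (rule powr_add)
      finally show ?thesis using pos by simp
    qed
    also have "C * D / c * (real l / real n) powr e * (c * real n * f n) \<le> C * D / c * (real l / real n) powr e * F n"
      using l k(1,2) D(1) by (intro mult_left_mono k(5)) (auto simp: P_def)
    also have "\<dots> \<le> K * (real l / real n) powr e * F n"
      using K F_nonneg by (intro mult_right_mono) auto
    finally show ?thesis .
  qed
  \<comment> \<open>Indices below the threshold \<open>P\<close> cost the factor P^e: for l >= 1 the
    ratio P/n is at most P l/n, and P l/n is at least 1 when n itself lies below P.\<close>
  have all: "F l \<le> (K * real P powr e) * (real l / real n) powr e * F n" if l: "1 \<le> l" "l \<le> n" for l n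
  proof -
    have P1: "real P \<ge> 1" using k(3) by (auto simp: P_def)
    have pp: "real P powr e \<ge> 1" using P1 e by (simp add: ge_one_powr_ge_zero)
    have pm: "(real P * (real l / real n)) powr e = real P powr e * (real l / real n) powr e"
      by (simp only: powr_mult of_nat_0_le_iff divide_nonneg_nonneg)
    consider "P \<le> l" | "l < P" "P \<le> n" | "n < P" by linarith
    then show ?thesis
    proof cases
      case 1
      have "F l \<le> K * (real l / real n) powr e * F n" by (rule big[OF 1 l(2)])
      also have "\<dots> \<le> K * real P powr e * (real l / real n) powr e * F n"
        using K pp F_nonneg by (intro mult_right_mono) auto
      finally show ?thesis .
    next
      case 2
      have "F l \<le> F P" using 2 by (intro F_mono) auto
      also have "\<dots> \<le> K * (real P / real n) powr e * F n" by (rule big[OF _ 2(2)]) simp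
      also have "\<dots> \<le> K * (real P * (real l / real n)) powr e * F n"
      proof -
        have "real P * 1 \<le> real P * real l" using l by (intro mult_left_mono) auto
        then have "real P / real n \<le> real P * (real l / real n)"
          by (simp add: divide_right_mono)
        then show ?thesis
          using K F_nonneg e by (intro mult_right_mono mult_left_mono powr_mono2) auto
      qed
      finally show ?thesis unfolding pm by (simp only: mult_ac)
    next
      case 3
      have "F l \<le> F n" by (intro F_mono l)
      also have "\<dots> \<le> (K * (real P * (real l / real n)) powr e) * F n"
      proof -
        have "real n * 1 \<le> real P * real l" using 3 l by (intro mult_mono) auto
        then have "1 \<le> real P * (real l / real n)" using l by (simp add: field_simps)
        then have "1 \<le> (real P * (real l / real n)) powr e" using e by (simp add: ge_one_powr_ge_zero)
        then have "1 * 1 \<le> K * (real P * (real l / real n)) powr e" using K by (intro mult_mono) auto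
        from mult_right_mono[OF this F_nonneg[of n]] show ?thesis by simp
      qed
      finally show ?thesis unfolding pm by (simp only: mult_ac)
    qed
  qed
  show ?thesis using K(1) k(3) by (intro that[OF _ e all]) (auto simp: P_def)
qed

lemma F_at_top:
  assumes "f 0 > 0"
  shows "filterlim F at_top sequentially"
proof -
  obtain K \<gamma> where K: "K > 0" "\<gamma> > 0" "\<And>l n. 1 \<le> l \<Longrightarrow> l \<le> n \<Longrightarrow> F l \<le> K * (real l / real n) powr \<gamma> * F n"
    using growth[OF assms] by metis
  have "F 0 \<le> F 1" by (rule F_mono) simp
  then have F1: "F 1 > 0" using assms by (simp add: F_def)
  have "filterlim (\<lambda>n. real n powr \<gamma>) at_top sequentially"
    by (rule filterlim_real_powr_at_top[OF K(2)])
  then have "filterlim (\<lambda>n. F 1 / K * real n powr \<gamma>) at_top sequentially"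
    using F1 K(1) by (intro filterlim_tendsto_pos_mult_at_top[OF tendsto_const]) auto
  then show ?thesis
  proof (rule filterlim_at_top_mono)
    show "eventually (\<lambda>n. F 1 / K * real n powr \<gamma> \<le> F n) sequentially"
      using eventually_ge_at_top[of 1]
    proof eventually_elim
      case (elim n)
      have "F 1 \<le> K * (1 / real n) powr \<gamma> * F n" using K(3)[of 1 n] elim by simp
      then show ?case using K(1) elim by (simp add: powr_divide field_simps)
    qed
  qed
qed

end

section \<open>Variances of weighted long memory sums\<close>

definition lag :: "nat \<Rightarrow> nat \<Rightarrow> nat" where
  "lag s t = (if s \<le> t then t - s else s - t)"

lemma lag_sym: "lag s t = lag t s"
  by (auto simp: lag_def)

text \<open>Each lag occurs at most once to the left of s and once to the right; lag 0 occurs once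
  and is covered by the right half.\<close>

lemma sum_lag_le:
  fixes g :: "nat \<Rightarrow> real"
  assumes g: "\<And>h. g h \<ge> 0" and T: "T \<subseteq> {t. lag s t \<le> l}"
  shows "(\<Sum>t\<in>T. g (lag s t)) \<le> 2 * (\<Sum>h\<le>l. g h)"
proof -
  have fin: "finite {t. lag s t \<le> l}"
    by (rule finite_subset[of _ "{..s + l}"]) (auto simp: lag_def split: if_splits)
  have "(\<Sum>t\<in>T. g (lag s t)) \<le> (\<Sum>t\<in>{t. lag s t \<le> l}. g (lag s t))"
    by (intro sum_mono2 fin T g)
  also have "{t. lag s t \<le> l} = {t\<in>{..<s}. lag s t \<le> l} \<union> {s..s + l}"
    by (auto simp: lag_def split: if_splits)
  also have "(\<Sum>t\<in>{t\<in>{..<s}. lag s t \<le> l} \<union> {s..s + l}. g (lag s t)) =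
    (\<Sum>t\<in>{t\<in>{..<s}. lag s t \<le> l}. g (lag s t)) + (\<Sum>t\<in>{s..s + l}. g (lag s t))"
    by (intro sum.union_disjoint) auto
  also have "(\<Sum>t\<in>{t\<in>{..<s}. lag s t \<le> l}. g (lag s t)) = (\<Sum>h\<in>lag s ` {t\<in>{..<s}. lag s t \<le> l}. g h)"
    by (subst sum.reindex) (auto simp: inj_on_def lag_def split: if_splits)
  also have "\<dots> \<le> (\<Sum>h\<le>l. g h)"
    by (intro sum_mono2 g) auto
  also have "(\<Sum>t\<in>{s..s + l}. g (lag s t)) = (\<Sum>h\<in>lag s ` {s..s + l}. g h)"
    by (subst sum.reindex) (auto simp: inj_on_def lag_def split: if_splits)
  also have "\<dots> \<le> (\<Sum>h\<le>l. g h)"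
    by (intro sum_mono2 g) (auto simp: lag_def)
  finally show ?thesis by simp
qed

text \<open>Schur's test for a nonnegative symmetric kernel: |a_s a_t| is at most half the sum of
  the squares, and by symmetry both halves reduce to row sums.\<close>

lemma sum_product_le_sum_squares:
  fixes a :: "nat \<Rightarrow> real"
  assumes I: "finite I" and k: "\<And>s t. k s t \<ge> 0" "\<And>s t. k s t = k t s"
    and S: "\<And>s. s \<in> I \<Longrightarrow> (\<Sum>t\<in>I. k s t) \<le> S"
  shows "(\<Sum>s\<in>I. \<Sum>t\<in>I. \<bar>a s\<bar> * \<bar>a t\<bar> * k s t) \<le> (\<Sum>s\<in>I. (a s)\<^sup>2) * S"
proof -
  have "(\<Sum>s\<in>I. \<Sum>t\<in>I. \<bar>a s\<bar> * \<bar>a t\<bar> * k s t) \<le> (\<Sum>s\<in>I. \<Sum>t\<in>I. (a s)\<^sup>2 * k s t / 2 + (a t)\<^sup>2 * k s t / 2)"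
  proof (intro sum_mono)
    fix s t
    have "0 \<le> (\<bar>a s\<bar> - \<bar>a t\<bar>)\<^sup>2" by simp
    then have "\<bar>a s\<bar> * \<bar>a t\<bar> \<le> ((a s)\<^sup>2 + (a t)\<^sup>2) / 2" unfolding power2_diff by simp
    from mult_right_mono[OF this k(1)[of s t]]
    show "\<bar>a s\<bar> * \<bar>a t\<bar> * k s t \<le> (a s)\<^sup>2 * k s t / 2 + (a t)\<^sup>2 * k s t / 2"
      by (simp add: field_simps)
  qed
  also have "\<dots> = (\<Sum>s\<in>I. \<Sum>t\<in>I. (a s)\<^sup>2 * k s t / 2) + (\<Sum>s\<in>I. \<Sum>t\<in>I. (a t)\<^sup>2 * k s t / 2)"
    by (simp add: sum.distrib)
  also have "(\<Sum>s\<in>I. \<Sum>t\<in>I. (a t)\<^sup>2 * k s t / 2) = (\<Sum>s\<in>I. \<Sum>t\<in>I. (a s)\<^sup>2 * k s t / 2)"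
    by (subst sum.swap) (simp add: k(2))
  also have "(\<Sum>s\<in>I. \<Sum>t\<in>I. (a s)\<^sup>2 * k s t / 2) + (\<Sum>s\<in>I. \<Sum>t\<in>I. (a s)\<^sup>2 * k s t / 2) = (\<Sum>s\<in>I. (a s)\<^sup>2 * (\<Sum>t\<in>I. k s t))"
    unfolding sum.distrib[symmetric] sum_distrib_left by (simp add: mult.commute)
  also have "\<dots> \<le> (\<Sum>s\<in>I. (a s)\<^sup>2 * S)"
    by (intro sum_mono mult_left_mono S) auto
  finally show ?thesis by (simp add: sum_distrib_right)
qed

locale long_memory =
  fixes a \<rho> :: "nat \<Rightarrow> real" and \<alpha> d :: real and m :: nat
  assumes a_regular: "regular_seq a (- d)" and \<rho>_regular: "regular_seq \<rho> (- \<alpha>)"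
    and \<alpha>: "\<alpha> > 0" and m: "m \<ge> 1" and \<alpha>m: "\<alpha> * real m < 1" and d: "2 * d < 1"
    and \<rho>0: "\<rho> 0 = 1" and \<rho>_le_1: "\<And>h. \<bar>\<rho> h\<bar> \<le> 1"
begin

definition r where "r h = \<bar>\<rho> h\<bar> ^ m"
text \<open>The value at 0 is erased because the partial sums of the locale start at index 0,
  whereas the weights are indexed from 1.\<close>

definition a2 where "a2 s = (if s = 0 then 0 else (a s)\<^sup>2)"

lemma abs_\<rho>_regular: "regular_seq (\<lambda>h. \<bar>\<rho> h\<bar>) (- \<alpha>)"
proof (rule regular_seq_cong[OF \<rho>_regular])
  obtain n0 where "\<And>n. n \<ge> n0 \<Longrightarrow> \<rho> n > 0" using regular_seq_posE[OF \<rho>_regular] by metis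
  then show "eventually (\<lambda>n. \<bar>\<rho> n\<bar> = \<rho> n) sequentially"
    unfolding eventually_sequentially by (intro exI[of _ n0]) (auto simp: less_imp_le)
qed

sublocale B: regular_partial_sums r "- (\<alpha> * real m)"
proof
  show "regular_seq r (- (\<alpha> * real m))"
    using regular_seq_power[OF abs_\<rho>_regular m] unfolding r_def[abs_def] by (simp add: mult.commute)
qed (use \<alpha>m in \<open>auto simp: r_def\<close>)

sublocale Al: regular_partial_sums a2 "- (2 * d)"
proof
  have "regular_seq (\<lambda>n. (a n)\<^sup>2) (real 2 * (- d))" by (rule regular_seq_power[OF a_regular]) simp
  then have "regular_seq (\<lambda>n. (a n)\<^sup>2) (- (2 * d))" by simp
  then show "regular_seq a2 (- (2 * d))"
    by (rule regular_seq_cong)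
      (auto simp: a2_def eventually_sequentially intro!: exI[of _ 1])
qed (use d in \<open>auto simp: a2_def\<close>)

abbreviation B where "B \<equiv> B.F"
abbreviation Al where "Al \<equiv> Al.F"

text \<open>The benchmark for the variance of the sum up to n. Block variances are bounded above in
  terms of it, and \<open>variance_lower\<close> bounds the variance of the whole sum below by a
  multiple of it.\<close>

definition D where "D n = Al n * B n"

lemma r0: "r 0 = 1" by (simp add: r_def \<rho>0)

lemma r0_pos: "r 0 > 0" by (simp add: r0)

lemma D_nonneg: "D n \<ge> 0"
  unfolding D_def by (intro mult_nonneg_nonneg Al.F_nonneg B.F_nonneg)

lemma Al_eq: "Al n = (\<Sum>s=1..n. (a s)\<^sup>2)"
proof -
  have "Al n = (\<Sum>s=1..n. a2 s)"
    unfolding Al.F_def by (rule sum.mono_neutral_right) (auto simp: a2_def)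
  then show ?thesis by (simp add: a2_def)
qed

lemma sum_a2_le_Al:
  assumes "I \<subseteq> {1..n}" shows "(\<Sum>s\<in>I. (a s)\<^sup>2) \<le> Al n"
  unfolding Al_eq by (intro sum_mono2 assms) auto

text \<open>For index sets avoiding 0, p! times this is the second moment of the weighted sum of the
  p-th Hermite polynomials. Its majorant \<open>W\<close> carries absolute values; it decreases in p
  because |\<rho>| <= 1, so one value of p controls all higher ones.\<close>

definition V where "V p I = (\<Sum>s\<in>I. \<Sum>t\<in>I. a s * a t * \<rho> (lag s t) ^ p)"
definition W where "W p I = (\<Sum>s\<in>I. \<Sum>t\<in>I. \<bar>a s\<bar> * \<bar>a t\<bar> * \<bar>\<rho> (lag s t)\<bar> ^ p)"

lemma V_le_W: "V p I \<le> W p I"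
  unfolding V_def W_def
proof (intro sum_mono)
  fix s t
  have "a s * a t * \<rho> (lag s t) ^ p \<le> \<bar>a s * a t * \<rho> (lag s t) ^ p\<bar>" by (rule abs_ge_self)
  then show "a s * a t * \<rho> (lag s t) ^ p \<le> \<bar>a s\<bar> * \<bar>a t\<bar> * \<bar>\<rho> (lag s t)\<bar> ^ p"
    by (simp add: abs_mult power_abs)
qed

lemma W_le:
  assumes "I \<subseteq> {i<..i + l}"
  shows "W p I \<le> (\<Sum>s\<in>I. (a s)\<^sup>2) * (2 * (\<Sum>h\<le>l. \<bar>\<rho> h\<bar> ^ p))"
  unfolding W_def
proof (rule sum_product_le_sum_squares)
  show "finite I" using assms by (rule finite_subset) simp
  fix s assume s: "s \<in> I"
  have "I \<subseteq> {t. lag s t \<le> l}"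
  proof
    fix t assume "t \<in> I"
    then have "s \<in> {i<..i + l}" "t \<in> {i<..i + l}" using s assms by blast+
    then show "t \<in> {t. lag s t \<le> l}" by (auto simp: lag_def)
  qed
  then show "(\<Sum>t\<in>I. \<bar>\<rho> (lag s t)\<bar> ^ p) \<le> 2 * (\<Sum>h\<le>l. \<bar>\<rho> h\<bar> ^ p)"
    by (intro sum_lag_le[where g = "\<lambda>h. \<bar>\<rho> h\<bar> ^ p"]) auto
qed (auto simp: lag_sym)

text \<open>Schur's test leaves the squared weights of the block times the lag sum up to the block
  length. The former are bounded by \<open>Al n\<close>, wherever the block lies, and the growth of
  \<open>B\<close> supplies the power of the relative length.\<close>

lemma V_block_le:
  obtains K \<gamma> where "K > 0" "\<gamma> > 0"
    "\<And>i l n. 1 \<le> l \<Longrightarrow> i + l \<le> n \<Longrightarrow> V m {i<..i + l} \<le> K * (real l / real n) powr \<gamma> * D n"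
proof -
  obtain K \<gamma> where K: "K > 0" "\<gamma> > 0" "\<And>l n. 1 \<le> l \<Longrightarrow> l \<le> n \<Longrightarrow> B l \<le> K * (real l / real n) powr \<gamma> * B n"
    using B.growth[OF r0_pos] by metis
  show ?thesis
  proof (rule that[of "2 * K" \<gamma>])
    fix i l n :: nat assume l: "1 \<le> l" "i + l \<le> n"
    have "V m {i<..i + l} \<le> W m {i<..i + l}" by (rule V_le_W)
    also have "\<dots> \<le> (\<Sum>s\<in>{i<..i + l}. (a s)\<^sup>2) * (2 * B l)"
      using W_le[of "{i<..i + l}" i l m] by (simp add: B.F_def r_def)
    also have "\<dots> \<le> Al n * (2 * (K * (real l / real n) powr \<gamma> * B n))"
    proof (rule mult_mono)
      show "2 * B l \<le> 2 * (K * (real l / real n) powr \<gamma> * B n)" using K(3)[of l n] l by simp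
      show "(\<Sum>s\<in>{i<..i + l}. (a s)\<^sup>2) \<le> Al n" using l by (intro sum_a2_le_Al) auto
    qed (auto simp: Al.F_nonneg B.F_nonneg)
    finally show "V m {i<..i + l} \<le> 2 * K * (real l / real n) powr \<gamma> * D n"
      by (simp add: D_def mult_ac)
  qed (use K in auto)
qed

lemma abs_\<rho>_decay:
  obtains K where "K > 0" "\<And>h. \<bar>\<rho> h\<bar> \<le> K * (real h + 1) powr (- (\<alpha> / 2))"
proof -
  have "\<alpha> / 2 > 0" using \<alpha> by simp
  from regular_seqE[OF abs_\<rho>_regular this] obtain C n0 where C: "C > 0" "n0 \<ge> (1::nat)"
    "\<And>s n. n0 \<le> s \<Longrightarrow> s \<le> n \<Longrightarrow> (real s / real n) powr (- \<alpha> + \<alpha> / 2) * \<bar>\<rho> n\<bar> \<le> C * \<bar>\<rho> s\<bar>"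
    by metis
  define q where "q = \<alpha> / 2"
  have q: "q > 0" using \<alpha> by (simp add: q_def)
  \<comment> \<open>The factor (2 n0)^q serves two purposes: it replaces h by h + 1 in the Potter
    range, and it makes the right-hand side at least 1 for h < n0, where only |\<rho>| <= 1 is
    available.\<close>
  define K where "K = max 1 C * (real (2 * n0)) powr q"
  have "\<bar>\<rho> h\<bar> \<le> K * (real h + 1) powr (- q)" for h
  proof (cases "h \<ge> n0")
    case True
    have "(real n0 / real h) powr (- q) * \<bar>\<rho> h\<bar> \<le> C * \<bar>\<rho> n0\<bar>"
      using C(3)[OF order_refl True] by (simp add: q_def)
    also have "\<dots> \<le> C" using \<rho>_le_1[of n0] C(1) by (simp add: mult_left_le)
    finally have "\<bar>\<rho> h\<bar> \<le> C * (real n0 / real h) powr q"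
      using True C(2) by (simp add: powr_minus field_simps)
    also have "\<dots> \<le> C * (real (2 * n0) / (real h + 1)) powr q"
      using True C q by (intro mult_left_mono powr_mono2) (auto simp: field_simps)
    also have "\<dots> = C * real (2 * n0) powr q * (real h + 1) powr (- q)"
      by (simp add: powr_divide powr_minus field_simps)
    also have "\<dots> \<le> K * (real h + 1) powr (- q)"
      unfolding K_def by (intro mult_right_mono) auto
    finally show ?thesis .
  next
    case False
    have "(real h + 1) powr q \<le> real (2 * n0) powr q" using False q by (intro powr_mono2) auto
    also have "\<dots> \<le> K" unfolding K_def using mult_right_mono[of 1 "max 1 C" "real (2 * n0) powr q"] by simp
    finally have "1 \<le> K * (real h + 1) powr (- q)" by (simp add: powr_minus field_simps)
    then show ?thesis using \<rho>_le_1[of h] by linarith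
  qed
  moreover have "K > 0" using C(2) by (simp add: K_def)
  ultimately show ?thesis using that unfolding q_def by blast
qed

text \<open>The lags are split at the square root of n. Short lags contribute at most B at about
  sqrt n, which is smaller than \<open>B n\<close> by a power of n; for long lags the additional
  factor |\<rho>| is itself a negative power of n.\<close>

lemma sum_higher_power_le:
  obtains K \<delta> where "K > 0" "\<delta> > 0"
    "\<And>n. n \<ge> 1 \<Longrightarrow> (\<Sum>h\<le>n. \<bar>\<rho> h\<bar> ^ Suc m) \<le> K * real n powr (- \<delta>) * B n"
proof -
  obtain K where K: "K > 0" "\<And>h. \<bar>\<rho> h\<bar> \<le> K * (real h + 1) powr (- (\<alpha> / 2))" using abs_\<rho>_decay by metis
  obtain C \<gamma> where C: "C > 0" "\<gamma> > 0" "\<And>l n. 1 \<le> l \<Longrightarrow> l \<le> n \<Longrightarrow> B l \<le> C * (real l / real n) powr \<gamma> * B n"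
    using B.growth[OF r0_pos] by metis
  define q where "q = \<alpha> / 2"
  define \<delta> where "\<delta> = min \<gamma> q / 2"
  have q: "q > 0" "\<delta> > 0" "\<delta> \<le> \<gamma> / 2" "\<delta> \<le> q / 2" using \<alpha> C(2) by (auto simp: q_def \<delta>_def)
  have main: "(\<Sum>h\<le>n. \<bar>\<rho> h\<bar> ^ Suc m) \<le> (C + K) * real n powr (- \<delta>) * B n" if n: "n \<ge> 1" for n
  proof -
    define l where "l = nat \<lfloor>sqrt (real n)\<rfloor>"
    have s1: "sqrt (real n) \<ge> 1" using n by simp
    have l: "1 \<le> l" "real l \<le> sqrt (real n)" "sqrt (real n) \<le> real l + 1"
      using s1 unfolding l_def by linarith+
    have "sqrt (real n) \<le> real n" by (rule real_le_lsqrt) (use n in \<open>auto simp: power2_eq_square\<close>)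
    then have ln: "l \<le> n" using l(2) by linarith
    have sq: "sqrt (real n) = real n powr (1 / 2)" using n by (simp add: powr_half_sqrt)
    have t: "\<bar>\<rho> h\<bar> ^ Suc m \<le> r h * (if h \<le> l then 1 else K * real n powr (- \<delta>))" for h
    proof (cases "h \<le> l")
      case True
      have "\<bar>\<rho> h\<bar> * r h \<le> 1 * r h" using \<rho>_le_1[of h] by (intro mult_right_mono B.nonneg)
      then show ?thesis using True by (simp add: r_def)
    next
      case False
      have "\<bar>\<rho> h\<bar> \<le> K * (real h + 1) powr (- q)" using K(2) by (simp add: q_def)
      also have "\<dots> \<le> K * (real n powr (1 / 2)) powr (- q)"
        using l False K(1) q n unfolding sq[symmetric] by (intro mult_left_mono powr_mono2') auto
      also have "\<dots> \<le> K * real n powr (- \<delta>)"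
        unfolding powr_powr using K(1) q n by (intro mult_left_mono powr_mono) auto
      finally have "\<bar>\<rho> h\<bar> * r h \<le> K * real n powr (- \<delta>) * r h" by (intro mult_right_mono B.nonneg)
      then show ?thesis using False by (simp add: r_def mult_ac)
    qed
    have "(\<Sum>h\<le>n. \<bar>\<rho> h\<bar> ^ Suc m) \<le> (\<Sum>h\<le>n. (if h \<le> l then r h else 0) + K * real n powr (- \<delta>) * r h)"
    proof (intro sum_mono)
      fix h
      have "0 \<le> K * real n powr (- \<delta>) * r h" using K(1) B.nonneg by simp
      then show "\<bar>\<rho> h\<bar> ^ Suc m \<le> (if h \<le> l then r h else 0) + K * real n powr (- \<delta>) * r h"
        using t[of h] by (auto simp: mult_ac split: if_splits)
    qed
    also have "\<dots> = (\<Sum>h\<le>n. (if h \<le> l then r h else 0)) + K * real n powr (- \<delta>) * B n"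
      by (simp add: sum.distrib sum_distrib_left B.F_def)
    also have "(\<Sum>h\<le>n. (if h \<le> l then r h else 0)) = B l"
    proof -
      have "{..n} \<inter> {h. h \<le> l} = {..l}" using ln by auto
      then show ?thesis unfolding B.F_def using sum.inter_restrict[of "{..n}" r "{h. h \<le> l}"] by simp
    qed
    also have "B l \<le> C * (real l / real n) powr \<gamma> * B n" by (rule C(3)[OF l(1) ln])
    also have "\<dots> \<le> C * real n powr (- \<delta>) * B n"
    proof -
      have "real l / real n \<le> sqrt (real n) / real n" using l(2) by (intro divide_right_mono) auto
      also have "\<dots> = real n powr (- (1 / 2))"
        using n unfolding sq by (simp add: powr_minus_divide powr_half_sqrt real_div_sqrt field_simps)
      finally have "(real l / real n) powr \<gamma> \<le> (real n powr (- (1 / 2))) powr \<gamma>"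
        using C(2) by (intro powr_mono2) auto
      also have "\<dots> \<le> real n powr (- \<delta>)"
        unfolding powr_powr using q n by (intro powr_mono) auto
      finally show ?thesis using C(1) B.F_nonneg by (intro mult_right_mono mult_left_mono) auto
    qed
    finally show ?thesis by (simp add: algebra_simps)
  qed
  show ?thesis by (rule that[OF _ q(2) main]) (use C K in auto)
qed

text \<open>The squared weights of the block are kept instead of being bounded by
  \<open>Al n\<close>: when all dyadic blocks of one scale are added, they make up
  \<open>Al n\<close> exactly once.\<close>

lemma W_block_le:
  obtains K \<delta> where "K > 0" "\<delta> > 0"
    "\<And>i l n. i + l \<le> n \<Longrightarrow> 1 \<le> n \<Longrightarrow>
      W (Suc m) {i<..i + l} \<le> (\<Sum>s\<in>{i<..i + l}. (a s)\<^sup>2) * (K * real n powr (- \<delta>) * B n)"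
proof -
  obtain K \<delta> where K: "K > 0" "\<delta> > 0"
    "\<And>n. n \<ge> 1 \<Longrightarrow> (\<Sum>h\<le>n. \<bar>\<rho> h\<bar> ^ Suc m) \<le> K * real n powr (- \<delta>) * B n" using sum_higher_power_le by metis
  show ?thesis
  proof (rule that[of "2 * K" \<delta>])
    fix i l n :: nat assume l: "i + l \<le> n" "1 \<le> n"
    have "W (Suc m) {i<..i + l} \<le> (\<Sum>s\<in>{i<..i + l}. (a s)\<^sup>2) * (2 * (\<Sum>h\<le>l. \<bar>\<rho> h\<bar> ^ Suc m))"
      by (rule W_le[OF order_refl])
    also have "\<dots> \<le> (\<Sum>s\<in>{i<..i + l}. (a s)\<^sup>2) * (2 * K * real n powr (- \<delta>) * B n)"
    proof (rule mult_left_mono)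
      have "(\<Sum>h\<le>l. \<bar>\<rho> h\<bar> ^ Suc m) \<le> (\<Sum>h\<le>n. \<bar>\<rho> h\<bar> ^ Suc m)"
        using l by (intro sum_mono2) auto
      also have "\<dots> \<le> K * real n powr (- \<delta>) * B n" by (rule K(3)[OF l(2)])
      finally show "2 * (\<Sum>h\<le>l. \<bar>\<rho> h\<bar> ^ Suc m) \<le> 2 * K * real n powr (- \<delta>) * B n" by simp
    qed (simp add: sum_nonneg)
    finally show "W (Suc m) {i<..i + l} \<le> (\<Sum>s\<in>{i<..i + l}. (a s)\<^sup>2) * (2 * K * real n powr (- \<delta>) * B n)" .
  qed (use K in auto)
qed

lemma D_doubling:
  obtains K N where "K > 0" "N \<ge> (1::nat)" "\<And>n. n \<ge> N \<Longrightarrow> D n > 0" "\<And>k n. n \<ge> N \<Longrightarrow> k \<le> 2 * n \<Longrightarrow> D k \<le> K * D n"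
proof -
  obtain K1 N1 where 1: "K1 > 0" "N1 \<ge> (1::nat)" "\<And>n. n \<ge> N1 \<Longrightarrow> B n > 0" "\<And>n. n \<ge> N1 \<Longrightarrow> B (2 * n) \<le> K1 * B n"
    using B.doubling by metis
  obtain K2 N2 where 2: "K2 > 0" "N2 \<ge> (1::nat)" "\<And>n. n \<ge> N2 \<Longrightarrow> Al n > 0" "\<And>n. n \<ge> N2 \<Longrightarrow> Al (2 * n) \<le> K2 * Al n"
    using Al.doubling by metis
  show ?thesis
  proof (rule that[of "K2 * K1" "max N1 N2"])
    fix n k assume n: "max N1 N2 \<le> n" "k \<le> 2 * n"
    have "D k \<le> Al (2 * n) * B (2 * n)"
      unfolding D_def by (intro mult_mono Al.F_mono B.F_mono n Al.F_nonneg B.F_nonneg)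
    also have "\<dots> \<le> (K2 * Al n) * (K1 * B n)"
      using 1 2 n by (intro mult_mono Al.F_nonneg B.F_nonneg mult_nonneg_nonneg) auto
    finally show "D k \<le> K2 * K1 * D n" by (simp add: D_def mult_ac)
  qed (use 1 2 in \<open>auto simp: D_def\<close>)
qed

lemma D_at_top: "filterlim D at_top sequentially"
proof -
  obtain K2 N2 where 2: "\<And>n. n \<ge> N2 \<Longrightarrow> Al n > 0" using Al.doubling by metis
  have "filterlim (\<lambda>n. Al N2 * B n) at_top sequentially"
    using 2[of N2] by (intro filterlim_tendsto_pos_mult_at_top[OF tendsto_const] B.F_at_top r0_pos) auto
  then show ?thesis
    by (rule filterlim_at_top_mono)
      (auto simp: eventually_sequentially D_def intro!: exI[of _ N2] mult_right_mono Al.F_mono B.F_nonneg)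
qed

text \<open>With k about n/8, take s in (7k, 8k] and t in (5k, 6k]. Then s, t and the lag, which
  lies between k and 3k, are all proportional to n, so each of the k^2 terms is at least a constant
  times a_n^2 \<rho>(n)^m. Karamata's upper bounds turn n^2 a_n^2 \<rho>(n)^m into
  \<open>D n\<close>. The set \<open>J\<close> is exposed so that the remaining pairs can be handled
  separately.\<close>

lemma V_lower_main:
  obtains c n0 N where "c > 0" "\<And>t. t \<ge> n0 \<Longrightarrow> a t > 0" "\<And>h. h \<ge> n0 \<Longrightarrow> \<rho> h > 0"
    "\<And>n. n \<ge> N \<Longrightarrow> \<exists>J \<subseteq> {n0<..n} \<times> {n0<..n}. (\<forall>(s, t)\<in>J. lag s t \<ge> n0) \<and>
      c * D n \<le> (\<Sum>(s, t)\<in>J. a s * a t * \<rho> (lag s t) ^ m)"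
proof -
  have "\<alpha> / 2 > 0" using \<alpha> by simp
  from regular_seqE[OF \<rho>_regular this] obtain C2 n2 where C2: "C2 > 0" "n2 \<ge> (1::nat)" "\<And>n. n \<ge> n2 \<Longrightarrow> \<rho> n > 0"
    "\<And>s n. n2 \<le> s \<Longrightarrow> s \<le> n \<Longrightarrow> (real s / real n) powr (- \<alpha> + \<alpha> / 2) * \<rho> n \<le> C2 * \<rho> s" by metis
  from regular_seqE[OF a_regular zero_less_one] obtain C1 n1 where C1: "C1 > 0" "n1 \<ge> (1::nat)" "\<And>n. n \<ge> n1 \<Longrightarrow> a n > 0"
    "\<And>s n. n1 \<le> s \<Longrightarrow> s \<le> n \<Longrightarrow> (real s / real n) powr (- d + 1) * a n \<le> C1 * a s" by metis
  obtain cB CB NB where kB: "CB > 0" "\<And>n. n \<ge> NB \<Longrightarrow> B n \<le> CB * real n * r n" using B.karamata by metis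
  obtain cA CA NA where kA: "CA > 0" "\<And>n. n \<ge> NA \<Longrightarrow> Al n \<le> CA * real n * a2 n" using Al.karamata by metis
  define n0 where "n0 = max n1 n2"
  define c1 where "c1 = (1 / 2) powr (1 - d) / C1"
  have c1: "c1 > 0" using C1 by (simp add: c1_def)
  \<comment> \<open>The factor 256 is 16 squared: the square \<open>J\<close> has side k, and k is
    at least n/16.\<close>
  define c where "c = c1\<^sup>2 / C2 ^ m / (256 * CA * CB)"
  have c: "c > 0" using c1 C2 kA kB by (simp add: c_def)
  define N where "N = max (max NA NB) (8 * (n0 + 4))"
  show ?thesis
  proof (rule that[OF c])
    show "a t > 0" if "t \<ge> n0" for t using C1(3) that by (simp add: n0_def)
    show "\<rho> h > 0" if "h \<ge> n0" for h using C2(3) that by (simp add: n0_def)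
    fix n assume n: "n \<ge> N"
    define k where "k = n div 8"
    have k: "k \<ge> n0" "k \<ge> 4" "8 * k \<le> n" "n \<le> 10 * k" "n \<le> 16 * k"
    proof -
      have n8: "8 * (n0 + 4) \<le> n" using n by (simp add: N_def)
      have "n = 8 * k + n mod 8" "n mod 8 < 8" unfolding k_def by simp_all
      then have "n \<le> 8 * k + 7" "8 * k \<le> n" by linarith+
      with n8 show "k \<ge> n0" "k \<ge> 4" "8 * k \<le> n" "n \<le> 10 * k" "n \<le> 16 * k"
        by simp_all
    qed
    define J where "J = {7 * k<..8 * k} \<times> {5 * k<..6 * k}"
    have as: "c1 * a n \<le> a s" if s: "5 * k \<le> s" "s \<le> n" for s
    proof -
      have "1 / 2 \<le> real s / real n" using s k by (simp add: field_simps)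
      then have "(1 / 2) powr (1 - d) \<le> (real s / real n) powr (1 - d)"
        using d by (intro powr_mono2) simp_all
      then have "(1 / 2) powr (1 - d) * a n \<le> (real s / real n) powr (- d + 1) * a n"
        using C1(3)[of n] k by (simp add: n0_def mult_right_mono)
      also have "\<dots> \<le> C1 * a s" using s k by (intro C1(4)) (auto simp: n0_def)
      finally show ?thesis using C1(1) by (simp add: c1_def field_simps)
    qed
    \<comment> \<open>With slack \<alpha>/2 the Potter exponent -\<alpha>/2 is still negative, so
      the power of h/n is at least 1 for every lag h <= n. This bounds \<rho>(h) below by a multiple
      of \<rho>(n).\<close>
    have rh: "\<rho> n / C2 \<le> \<rho> h" if h: "n0 \<le> h" "h \<le> n" for h
    proof -
      have pos: "real h > 0" "real n > 0" using h C2(2) by (auto simp: n0_def)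
      have "(real n / real h) powr 0 \<le> (real n / real h) powr (\<alpha> / 2)"
        using h pos \<alpha> by (intro powr_mono) auto
      moreover have "(real h / real n) powr (- \<alpha> + \<alpha> / 2) = (real n / real h) powr (\<alpha> / 2)"
        using pos by (simp add: powr_divide powr_minus field_simps)
      ultimately have "1 * \<rho> n \<le> (real h / real n) powr (- \<alpha> + \<alpha> / 2) * \<rho> n"
        using C2(3)[of n] h pos by (intro mult_right_mono) (auto simp: n0_def)
      also have "\<dots> \<le> C2 * \<rho> h" using h by (intro C2(4)) (auto simp: n0_def)
      finally show ?thesis using C2(1) by (simp add: field_simps)
    qed
    have pn: "a n > 0" "\<rho> n > 0" using C1(3)[of n] C2(3)[of n] k by (auto simp: n0_def)
    have trm: "(c1 * a n) * (c1 * a n) * (\<rho> n / C2) ^ m \<le> a s * a t * \<rho> (lag s t) ^ m" if st: "(s, t) \<in> J" for s t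
    proof -
      have st': "7 * k < s" "s \<le> 8 * k" "5 * k < t" "t \<le> 6 * k" using st by (auto simp: J_def)
      then have l: "n0 \<le> lag s t" "lag s t \<le> n" using k by (auto simp: lag_def)
      have A: "c1 * a n \<le> a s" "c1 * a n \<le> a t" using st' k by (auto intro!: as)
      have "0 \<le> c1 * a n" "0 \<le> \<rho> n / C2" using c1 pn C2(1) by auto
      then show ?thesis using A rh[OF l] by (intro mult_mono power_mono) auto
    qed
    have "c * D n \<le> c * ((CA * real n * a2 n) * (CB * real n * r n))"
      unfolding D_def
    proof (intro mult_left_mono mult_mono B.F_nonneg)
      show "Al n \<le> CA * real n * a2 n" by (rule kA(2)) (use n in \<open>simp add: N_def\<close>)
      show "B n \<le> CB * real n * r n" by (rule kB(2)) (use n in \<open>simp add: N_def\<close>)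
      show "0 \<le> CA * real n * a2 n" using kA(1) Al.nonneg by simp
      show "0 \<le> c" using c by simp
    qed
    also have "a2 n = (a n)\<^sup>2" using k by (simp add: a2_def)
    also have "r n = \<rho> n ^ m" using pn by (simp add: r_def)
    also have "c * ((CA * real n * (a n)\<^sup>2) * (CB * real n * \<rho> n ^ m)) =
        (real n / 16) * (real n / 16) * ((c1 * a n) * (c1 * a n) * (\<rho> n / C2) ^ m)"
    proof -
      have cc: "c * CA * CB * 256 = c1\<^sup>2 / C2 ^ m" using kA(1) kB(1) by (simp add: c_def)
      have "c * ((CA * real n * (a n)\<^sup>2) * (CB * real n * \<rho> n ^ m)) =
        (c * CA * CB * 256) * ((real n / 16) * (real n / 16) * (a n * a n * \<rho> n ^ m))"
        by (simp add: power2_eq_square)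
      also have "\<dots> = (real n / 16) * (real n / 16) * ((c1 * a n) * (c1 * a n) * (\<rho> n / C2) ^ m)"
        unfolding cc by (simp add: power_divide power2_eq_square mult_ac)
      finally show ?thesis .
    qed
    also have "\<dots> \<le> (real k * real k) * ((c1 * a n) * (c1 * a n) * (\<rho> n / C2) ^ m)"
      using k c1 pn C2(1) by (intro mult_right_mono mult_mono) auto
    also have "\<dots> = real (card J) * ((c1 * a n) * (c1 * a n) * (\<rho> n / C2) ^ m)"
      by (simp add: J_def card_cartesian_product)
    also have "\<dots> \<le> (\<Sum>p\<in>J. a (fst p) * a (snd p) * \<rho> (lag (fst p) (snd p)) ^ m)"
    proof (rule sum_bounded_below)
      fix p assume "p \<in> J"
      then have "(fst p, snd p) \<in> J" by simp
      then show "(c1 * a n) * (c1 * a n) * (\<rho> n / C2) ^ m \<le> a (fst p) * a (snd p) * \<rho> (lag (fst p) (snd p)) ^ m"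
        by (rule trm)
    qed
    also have "\<dots> = (\<Sum>(s, t)\<in>J. a s * a t * \<rho> (lag s t) ^ m)" by (simp add: case_prod_beta)
    finally have "c * D n \<le> (\<Sum>(s, t)\<in>J. a s * a t * \<rho> (lag s t) ^ m)" .
    moreover have "J \<subseteq> {n0<..n} \<times> {n0<..n}" using k by (auto simp: J_def)
    moreover have "\<forall>(s, t)\<in>J. lag s t \<ge> n0" using k by (auto simp: J_def lag_def)
    ultimately show "\<exists>J \<subseteq> {n0<..n} \<times> {n0<..n}. (\<forall>(s, t)\<in>J. lag s t \<ge> n0) \<and>
      c * D n \<le> (\<Sum>(s, t)\<in>J. a s * a t * \<rho> (lag s t) ^ m)" by blast
  qed
qed

text \<open>Past \<open>n0\<close> the weights are positive, and so are the correlations at lags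
  beyond \<open>n0\<close>; hence pairs outside \<open>J\<close> can hurt only if their lag is at
  most \<open>n0\<close>. By Schur's test those pairs contribute at most a constant times
  \<open>Al n\<close>, which is negligible against \<open>D n\<close> because \<open>B n\<close>
  tends to infinity.\<close>

lemma V_lower:
  obtains c n0 N where "c > 0" "\<And>n. n \<ge> N \<Longrightarrow> c * D n \<le> V m {n0<..n}"
proof -
  obtain c n0 N where c: "c > 0" "\<And>t. t \<ge> n0 \<Longrightarrow> a t > 0" "\<And>h. h \<ge> n0 \<Longrightarrow> \<rho> h > 0"
    and J: "\<And>n. n \<ge> N \<Longrightarrow> \<exists>J \<subseteq> {n0<..n} \<times> {n0<..n}. (\<forall>(s, t)\<in>J. lag s t \<ge> n0) \<and>
      c * D n \<le> (\<Sum>(s, t)\<in>J. a s * a t * \<rho> (lag s t) ^ m)" by (rule V_lower_main) (rule that; assumption)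
  have "eventually (\<lambda>n. 2 / c * (2 * (real n0 + 1)) \<le> B n) sequentially"
    using B.F_at_top[OF r0_pos] unfolding filterlim_at_top by blast
  then obtain N1 where N1: "\<And>n. n \<ge> N1 \<Longrightarrow> 2 / c * (2 * (real n0 + 1)) \<le> B n"
    unfolding eventually_sequentially by blast
  have main: "c / 2 * D n \<le> V m {n0<..n}" if n: "n \<ge> max N N1" for n
  proof -
    let ?I = "{n0<..n}"
    define g where "g s t = a s * a t * \<rho> (lag s t) ^ m" for s t
    define near where "near s t = (if lag s t \<le> n0 then 1 else 0 :: real)" for s t
    have nN: "n \<ge> N" using n by simp
    obtain J where J0: "J \<subseteq> ?I \<times> ?I" "\<forall>(s, t)\<in>J. lag s t \<ge> n0"
      "c * D n \<le> (\<Sum>(s, t)\<in>J. a s * a t * \<rho> (lag s t) ^ m)" using J[OF nN] by blast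
    have J': "J \<subseteq> ?I \<times> ?I" "\<And>s t. (s, t) \<in> J \<Longrightarrow> lag s t \<ge> n0" "c * D n \<le> (\<Sum>(s, t)\<in>J. g s t)"
      using J0 unfolding g_def by auto
    have near: "(\<Sum>t\<in>?I. near s t) \<le> 2 * (real n0 + 1)" for s
    proof -
      have "(\<Sum>t\<in>?I. near s t) = (\<Sum>t\<in>{t\<in>?I. lag s t \<le> n0}. 1)"
        unfolding near_def using sum.inter_filter[of ?I "\<lambda>_. 1::real" "\<lambda>t. lag s t \<le> n0"] by simp
      also have "\<dots> \<le> 2 * (\<Sum>h\<le>n0. 1)"
        by (rule sum_lag_le[where g = "\<lambda>_. 1"]) auto
      finally show ?thesis by simp
    qed
    \<comment> \<open>A termwise lower bound: far pairs outside \<open>J\<close> are dropped because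
      they are nonnegative, near pairs are replaced by their worst case.\<close>
    have split: "g s t \<ge> (if (s, t) \<in> J then g s t else 0) - \<bar>a s\<bar> * \<bar>a t\<bar> * near s t" if st: "s \<in> ?I" "t \<in> ?I" for s t
    proof (cases "lag s t \<le> n0")
      case True
      have "\<bar>g s t\<bar> \<le> \<bar>a s\<bar> * \<bar>a t\<bar> * 1"
        unfolding g_def abs_mult power_abs using \<rho>_le_1 by (intro mult_left_mono power_le_one) auto
      then have "- (\<bar>a s\<bar> * \<bar>a t\<bar>) \<le> g s t" by linarith
      moreover have "near s t = 1" using True by (simp add: near_def)
      moreover have "0 \<le> \<bar>a s\<bar> * \<bar>a t\<bar>" by simp
      ultimately show ?thesis by simp
    next
      case False
      then have "0 \<le> g s t"
        using c(2)[of s] c(2)[of t] c(3)[of "lag s t"] st unfolding g_def by simp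
      then show ?thesis using False by (simp add: near_def)
    qed
    have "(\<Sum>s\<in>?I. \<Sum>t\<in>?I. \<bar>a s\<bar> * \<bar>a t\<bar> * near s t) \<le> (\<Sum>s\<in>?I. (a s)\<^sup>2) * (2 * (real n0 + 1))"
    proof (rule sum_product_le_sum_squares)
      show "near s t = near t s" for s t unfolding near_def lag_sym[of s t] ..
      show "near s t \<ge> 0" for s t by (simp add: near_def)
      show "(\<Sum>t\<in>?I. near s t) \<le> 2 * (real n0 + 1)" for s by (rule near)
    qed simp
    also have "\<dots> \<le> Al n * (2 * (real n0 + 1))"
      by (intro mult_right_mono sum_a2_le_Al) auto
    also have "\<dots> \<le> Al n * (c / 2 * B n)"
    proof (intro mult_left_mono Al.F_nonneg)
      have "2 / c * (2 * (real n0 + 1)) \<le> B n" using n by (intro N1) simp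
      from mult_left_mono[OF this, of "c / 2"] show "2 * (real n0 + 1) \<le> c / 2 * B n" using c(1) by simp
    qed
    finally have err: "(\<Sum>s\<in>?I. \<Sum>t\<in>?I. \<bar>a s\<bar> * \<bar>a t\<bar> * near s t) \<le> c / 2 * D n"
      by (simp add: D_def mult_ac)
    have "(\<Sum>s\<in>?I. \<Sum>t\<in>?I. if (s, t) \<in> J then g s t else 0) = (\<Sum>p\<in>?I \<times> ?I. if p \<in> J then case_prod g p else 0)"
      unfolding sum.cartesian_product by (intro sum.cong refl) auto
    also have "\<dots> = (\<Sum>p\<in>(?I \<times> ?I) \<inter> J. case_prod g p)"
      by (rule sum.inter_restrict[symmetric]) simp
    also have "(?I \<times> ?I) \<inter> J = J" using J'(1) by blast
    finally have "c * D n \<le> (\<Sum>s\<in>?I. \<Sum>t\<in>?I. if (s, t) \<in> J then g s t else 0)" using J'(3) by simp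
    then have "c * D n - c / 2 * D n \<le> (\<Sum>s\<in>?I. \<Sum>t\<in>?I. (if (s, t) \<in> J then g s t else 0) - \<bar>a s\<bar> * \<bar>a t\<bar> * near s t)"
      using err by (simp add: sum_subtractf)
    also have "\<dots> \<le> V m ?I"
      unfolding V_def g_def[symmetric] by (intro sum_mono split)
    finally show ?thesis by simp
  qed
  show ?thesis by (rule that[of "c / 2" "max N N1" n0]) (use main c in auto)
qed

end

section \<open>Gaussian integration by parts\<close>

text \<open>A class closed under sums, products and powers on a probability space, so that
  integrability of any polynomial expression follows from its shape. The codomain is a general
  normed field in order to serve real and complex variables alike.\<close>

definition all_moments :: "'a measure \<Rightarrow> ('a \<Rightarrow> 'b::{real_normed_field,second_countable_topology,banach}) \<Rightarrow> bool" where
  "all_moments M f \<longleftrightarrow> f \<in> borel_measurable M \<and> (\<forall>k. integrable M (\<lambda>x. norm (f x) ^ k))"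

lemma all_moments_measurable: "all_moments M f \<Longrightarrow> f \<in> borel_measurable M"
  by (simp add: all_moments_def)

lemma all_moments_integrable:
  assumes "all_moments M f" shows "integrable M f"
proof -
  have f: "f \<in> borel_measurable M" and I: "integrable M (\<lambda>x. norm (f x) ^ 1)"
    using assms unfolding all_moments_def by blast+
  show ?thesis by (rule integrable_norm_cancel[OF I[unfolded power_one_right] f])
qed

lemma all_moments_dominated:
  assumes "f \<in> borel_measurable M"
    and "\<And>k. integrable M (h k)" and "\<And>k x. norm (f x) ^ k \<le> h k x"
  shows "all_moments M f"
  unfolding all_moments_def
proof (intro conjI allI)
  show "integrable M (\<lambda>x. norm (f x) ^ k)" for k
  proof (rule Bochner_Integration.integrable_bound[OF assms(2)])
    show "(\<lambda>x. norm (f x) ^ k) \<in> borel_measurable M" using assms(1) by measurable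
    show "AE x in M. norm (norm (f x) ^ k) \<le> norm (h k x)"
      unfolding real_norm_def abs_of_nonneg[OF zero_le_power[OF norm_ge_zero]]
      by (intro AE_I2 order_trans[OF assms(3) abs_ge_self])
  qed
qed fact

lemma all_moments_add:
  assumes "all_moments M f" "all_moments M g"
  shows "all_moments M (\<lambda>x. f x + g x)"
proof (rule all_moments_dominated)
  show "(\<lambda>x. f x + g x) \<in> borel_measurable M"
    using assms by (intro borel_measurable_add all_moments_measurable)
  show "integrable M (\<lambda>x. 2 ^ k * (norm (f x) ^ k + norm (g x) ^ k))" for k
    using assms unfolding all_moments_def
    by (intro integrable_mult_right Bochner_Integration.integrable_add) blast+
  show "norm (f x + g x) ^ k \<le> 2 ^ k * (norm (f x) ^ k + norm (g x) ^ k)" for k x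
  proof -
    let ?a = "norm (f x)" and ?b = "norm (g x)"
    have "norm (f x + g x) \<le> 2 * max ?a ?b"
      by (rule order_trans[OF norm_triangle_ineq]) linarith
    then have "norm (f x + g x) ^ k \<le> 2 ^ k * max ?a ?b ^ k"
      unfolding power_mult_distrib[symmetric] by (intro power_mono norm_ge_zero)
    also have "max ?a ?b ^ k \<le> ?a ^ k + ?b ^ k"
      by (cases "?a \<le> ?b") (simp_all add: max_absorb1 max_absorb2)
    finally show ?thesis by simp
  qed
qed

lemma all_moments_mult:
  assumes "all_moments M f" "all_moments M g"
  shows "all_moments M (\<lambda>x. f x * g x)"
proof (rule all_moments_dominated)
  show "(\<lambda>x. f x * g x) \<in> borel_measurable M"
    using assms by (intro borel_measurable_times all_moments_measurable)
  show "integrable M (\<lambda>x. norm (f x) ^ (2 * k) + norm (g x) ^ (2 * k))" for k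
    using assms unfolding all_moments_def
    by (intro Bochner_Integration.integrable_add) blast+
  show "norm (f x * g x) ^ k \<le> norm (f x) ^ (2 * k) + norm (g x) ^ (2 * k)" for k x
  proof -
    let ?a = "norm (f x) ^ k" and ?b = "norm (g x) ^ k"
    have "0 \<le> (?a - ?b)\<^sup>2" "0 \<le> ?a * ?b" by auto
    then have "?a * ?b \<le> ?a\<^sup>2 + ?b\<^sup>2"
      unfolding power2_diff by linarith
    then show ?thesis
      by (simp add: norm_mult power_mult_distrib power_even_eq)
  qed
qed

lemma (in prob_space) all_moments_const [simp]: "all_moments M (\<lambda>_. c)"
  by (simp add: all_moments_def)

lemma all_moments_cmult: "all_moments M f \<Longrightarrow> all_moments M (\<lambda>x. c * f x)"
  unfolding all_moments_def by (auto simp: norm_mult power_mult_distrib)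

lemma (in prob_space) all_moments_power:
  "all_moments M f \<Longrightarrow> all_moments M (\<lambda>x. f x ^ k)"
  by (induction k) (simp_all add: all_moments_mult)

lemma (in prob_space) all_moments_prod:
  assumes "\<And>i. i \<in> I \<Longrightarrow> all_moments M (f i)"
  shows "all_moments M (\<lambda>x. \<Prod>i\<in>I. f i x)"
  using assms
proof (induction I rule: infinite_finite_induct)
  case (insert i I)
  have "all_moments M (f i)" "all_moments M (\<lambda>x. \<Prod>i\<in>I. f i x)"
    using insert.prems by (simp_all add: insert.IH)
  then show ?case
    unfolding prod.insert[OF insert.hyps] by (rule all_moments_mult)
qed simp_all

lemma (in prob_space) all_moments_sum:
  assumes "\<And>i. i \<in> I \<Longrightarrow> all_moments M (f i)"
  shows "all_moments M (\<lambda>x. \<Sum>i\<in>I. f i x)"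
  using assms
proof (induction I rule: infinite_finite_induct)
  case (insert i I)
  have "all_moments M (f i)" "all_moments M (\<lambda>x. \<Sum>i\<in>I. f i x)"
    using insert.prems by (simp_all add: insert.IH)
  then show ?case
    unfolding sum.insert[OF insert.hyps] by (rule all_moments_add)
qed simp_all

lemma all_moments_of_real:
  "all_moments M f \<Longrightarrow> all_moments M (\<lambda>x. complex_of_real (f x))"
  unfolding all_moments_def by auto

lemma all_moments_cnj:
  assumes "all_moments M f" shows "all_moments M (\<lambda>x. cnj (f x))"
proof -
  have "cnj \<in> borel_measurable borel"
    by (intro borel_measurable_continuous_onI continuous_on_cnj continuous_on_id)
  from measurable_compose[OF all_moments_measurable[OF assms] this] assms
  show ?thesis unfolding all_moments_def by simp
qed

lemma has_real_derivative_polynomial_0: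
  fixes c :: "nat \<Rightarrow> real"
  shows "((\<lambda>h. \<Sum>i\<le>n. c i * h ^ i) has_real_derivative (if n = 0 then 0 else c 1)) (at 0)"
proof -
  have "((\<lambda>h. \<Sum>i\<le>n. c i * h ^ i) has_real_derivative (\<Sum>i\<le>n. c i * (real i * 0 ^ (i - 1)))) (at 0)"
    by (auto intro!: derivative_eq_intros sum.cong)
  also have "(\<Sum>i\<le>n. c i * (real i * 0 ^ (i - 1))) = (\<Sum>i\<le>n. if i = 1 then c 1 else 0)"
    by (intro sum.cong) (auto simp: power_0_left)
  also have "\<dots> = (if n = 0 then 0 else c 1)" by auto
  finally show ?thesis .
qed

text \<open>By the binomial theorem the expectation is a polynomial in h, and its derivative at 0 is
  the linear coefficient. This is the tool for polarization: differentiating in h moves one factor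
  \<open>w\<close> out of a power.\<close>

lemma (in prob_space) has_real_derivative_expectation_power:
  fixes F W w :: "'a \<Rightarrow> real"
  assumes "all_moments M F" "all_moments M W" "all_moments M w"
  shows "((\<lambda>h. expectation (\<lambda>x. F x * (W x + h * w x) ^ n)) has_real_derivative
    real n * expectation (\<lambda>x. F x * w x * W x ^ (n - 1))) (at 0)"
proof -
  define c where "c i = real (n choose i) * expectation (\<lambda>x. F x * w x ^ i * W x ^ (n - i))" for i
  have "expectation (\<lambda>x. F x * (W x + h * w x) ^ n) = (\<Sum>i\<le>n. c i * h ^ i)" for h
  proof -
    have I: "integrable M (\<lambda>x. F x * w x ^ i * W x ^ (n - i))" for i
      by (intro all_moments_integrable all_moments_mult all_moments_power assms)
    have "F x * (W x + h * w x) ^ n =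
      (\<Sum>i\<le>n. real (n choose i) * h ^ i * (F x * w x ^ i * W x ^ (n - i)))" for x
      by (subst add.commute, subst binomial_ring, subst sum_distrib_left, intro sum.cong refl)
        (simp add: power_mult_distrib)
    then have "expectation (\<lambda>x. F x * (W x + h * w x) ^ n) =
      expectation (\<lambda>x. \<Sum>i\<le>n. real (n choose i) * h ^ i * (F x * w x ^ i * W x ^ (n - i)))"
      by (intro Bochner_Integration.integral_cong refl)
    also have "\<dots> = (\<Sum>i\<le>n. real (n choose i) * h ^ i * expectation (\<lambda>x. F x * w x ^ i * W x ^ (n - i)))"
      using I by (subst Bochner_Integration.integral_sum) auto
    finally show ?thesis unfolding c_def by (simp only: mult_ac)
  qed
  moreover have "(if n = 0 then 0 else c 1) = real n * expectation (\<lambda>x. F x * w x * W x ^ (n - 1))"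
    by (auto simp: c_def)
  ultimately show ?thesis
    using has_real_derivative_polynomial_0[of c n] by simp
qed

text \<open>A linear space of centered Gaussian variables enters only through its one-dimensional
  moments; all joint moments are recovered by polarization.\<close>

locale gaussian_space = prob_space M for M :: "'a measure" +
  fixes L :: "('a \<Rightarrow> real) set"
  assumes L_add: "V \<in> L \<Longrightarrow> W \<in> L \<Longrightarrow> (\<lambda>x. V x + W x) \<in> L"
    and L_scale: "W \<in> L \<Longrightarrow> (\<lambda>x. c * W x) \<in> L"
    and L_moments: "W \<in> L \<Longrightarrow> all_moments M W"
    and L_mean: "W \<in> L \<Longrightarrow> expectation W = 0"
    and L_rec: "W \<in> L \<Longrightarrow> expectation (\<lambda>x. W x ^ Suc (Suc n)) =
      real (Suc n) * expectation (\<lambda>x. (W x)\<^sup>2) * expectation (\<lambda>x. W x ^ n)"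
begin

text \<open>The moment recursion holds for W + hV for every h; comparing derivatives at h = 0 gives
  a linear relation between the mixed moments of exponents n + 1 and n - 1. The induction hypothesis
  eliminates the latter.\<close>

lemma gaussian_ibp_power:
  assumes V: "V \<in> L" and W: "W \<in> L"
  shows "expectation (\<lambda>x. V x * W x ^ k) =
    real k * expectation (\<lambda>x. V x * W x) * expectation (\<lambda>x. W x ^ (k - 1))"
proof (induction k rule: less_induct)
  case (less k)
  note mV = L_moments[OF V] and mW = L_moments[OF W]
  consider "k = 0" | "k = 1" | "k \<ge> 2" by linarith
  then show ?case
  proof cases
    case 1 then show ?thesis using L_mean[OF V] by simp
  next
    case 2 then show ?thesis by (simp add: prob_space)
  next
    case 3
    define n where "n = k - 1"
    have k: "k = Suc n" "n \<ge> 1" using 3 by (auto simp: n_def)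
    have D: "((\<lambda>h. expectation (\<lambda>x. (W x + h * V x) ^ j)) has_real_derivative
        real j * expectation (\<lambda>x. V x * W x ^ (j - 1))) (at 0)" for j
      using has_real_derivative_expectation_power[OF all_moments_const[of 1] mW mV] by simp
    have eq: "(\<lambda>h. expectation (\<lambda>x. (W x + h * V x) ^ Suc (Suc n))) =
       (\<lambda>h. real (Suc n) * (expectation (\<lambda>x. (W x + h * V x)\<^sup>2) * expectation (\<lambda>x. (W x + h * V x) ^ n)))"
      using L_rec[OF L_add[OF W L_scale[OF V]]] by (intro ext) simp
    have "((\<lambda>h. expectation (\<lambda>x. (W x + h * V x) ^ Suc (Suc n))) has_real_derivative
       real (Suc n) * ((real 2 * expectation (\<lambda>x. V x * W x ^ (2 - 1))) * expectation (\<lambda>x. (W x + 0 * V x) ^ n)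
         + (real n * expectation (\<lambda>x. V x * W x ^ (n - 1))) * expectation (\<lambda>x. (W x + 0 * V x)\<^sup>2))) (at 0)"
      unfolding eq by (intro DERIV_cmult DERIV_mult'[THEN DERIV_cong, OF D D]) (simp add: algebra_simps)
    from DERIV_unique[OF this D]
    have A: "real (Suc (Suc n)) * expectation (\<lambda>x. V x * W x ^ Suc n) =
      real (Suc n) * (2 * expectation (\<lambda>x. V x * W x) * expectation (\<lambda>x. W x ^ n) +
        real n * expectation (\<lambda>x. V x * W x ^ (n - 1)) * expectation (\<lambda>x. (W x)\<^sup>2))"
      by simp
    \<comment> \<open>The induction hypothesis reduces the lower mixed moment to E[VW] times a pure
      moment, and the recursion for W reassembles the pure moment of order n. This lets the two
      terms of \<open>A\<close> combine to the factor n + 2.\<close>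
    have B: "real n * expectation (\<lambda>x. V x * W x ^ (n - 1)) * expectation (\<lambda>x. (W x)\<^sup>2) =
      real n * expectation (\<lambda>x. V x * W x) * expectation (\<lambda>x. W x ^ n)"
    proof (cases "n = 1")
      case True then show ?thesis using L_mean[OF V] L_mean[OF W] by simp
    next
      case False
      define j where "j = n - 2"
      have j: "n = Suc (Suc j)" using False k by (auto simp: j_def)
      have "expectation (\<lambda>x. V x * W x ^ (n - 1)) = 
        real (n - 1) * expectation (\<lambda>x. V x * W x) * expectation (\<lambda>x. W x ^ (n - 1 - 1))"
        by (rule less.IH) (use k in auto)
      moreover have "expectation (\<lambda>x. W x ^ n) = real (n - 1) * expectation (\<lambda>x. (W x)\<^sup>2) * expectation (\<lambda>x. W x ^ (n - 1 - 1))"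
        using L_rec[OF W, of j] unfolding j by simp
      ultimately show ?thesis by (simp add: mult_ac)
    qed
    have "real (Suc (Suc n)) * expectation (\<lambda>x. V x * W x ^ Suc n) =
       real (Suc (Suc n)) * (real (Suc n) * expectation (\<lambda>x. V x * W x) * expectation (\<lambda>x. W x ^ n))"
      unfolding A B by (simp add: algebra_simps)
    then show ?thesis unfolding k by simp
  qed
qed

text \<open>Leibniz rule along a list of factors: the derivation that sends each \<open>w\<close> to
  the constant \<open>\<kappa> w\<close>, evaluated at x. The target is a general algebra since both
  real and complex values of \<kappa> occur.\<close>

primrec monom_deriv :: "(('a \<Rightarrow> real) \<Rightarrow> 'c) \<Rightarrow> ('a \<Rightarrow> real) list \<Rightarrow> 'a \<Rightarrow> 'c::real_algebra_1" where
  "monom_deriv \<kappa> [] x = 0"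
| "monom_deriv \<kappa> (w # ws) x = \<kappa> w * of_real (\<Prod>v\<leftarrow>ws. v x) + of_real (w x) * monom_deriv \<kappa> ws x"

lemma all_moments_monom:
  "set ws \<subseteq> L \<Longrightarrow> all_moments M (\<lambda>x. \<Prod>v\<leftarrow>ws. v x)"
  by (induction ws) (auto intro!: all_moments_mult intro: L_moments)

lemma all_moments_monom_deriv:
  "set ws \<subseteq> L \<Longrightarrow> all_moments M (monom_deriv (\<kappa> :: _ \<Rightarrow> real) ws)"
proof (induction ws)
  case Nil
  then show ?case by simp
next
  case (Cons w ws)
  then show ?case
    by (auto intro!: all_moments_mult all_moments_add all_moments_cmult all_moments_monom intro: L_moments)
qed

text \<open>The auxiliary power of W makes the induction possible: replacing W by W + hw in the
  statement for exponent k + 1 and differentiating at h = 0 moves one factor \<open>w\<close> from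
  the power into the monomial. Hence both W and k have to be arbitrary in the induction.\<close>

lemma gaussian_ibp_monom_power:
  assumes V: "V \<in> L" and "W \<in> L" "set ws \<subseteq> L"
  defines "\<kappa> \<equiv> (\<lambda>w. expectation (\<lambda>x. V x * w x))"
  shows "expectation (\<lambda>x. V x * (\<Prod>v\<leftarrow>ws. v x) * W x ^ k) =
    expectation (\<lambda>x. monom_deriv \<kappa> ws x * W x ^ k) +
    real k * \<kappa> W * expectation (\<lambda>x. (\<Prod>v\<leftarrow>ws. v x) * W x ^ (k - 1))"
  using assms(2,3)
proof (induction ws arbitrary: k W)
  case Nil
  then show ?case using gaussian_ibp_power[OF V Nil(1)] by (simp add: \<kappa>_def)
next
  case (Cons w ws)
  let ?m = "\<lambda>x. \<Prod>v\<leftarrow>ws. v x"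
  let ?d = "monom_deriv \<kappa> ws"
  have w: "w \<in> L" and ws: "set ws \<subseteq> L" using Cons by auto
  note mV = L_moments[OF V] and mW = L_moments[OF Cons(2)] and mw = L_moments[OF w]
    and mm = all_moments_monom[OF ws] and md = all_moments_monom_deriv[OF ws, of \<kappa>]
  note am = all_moments_mult all_moments_power all_moments_add all_moments_cmult mV mW mw mm md
  have \<kappa>lin: "\<kappa> (\<lambda>x. W x + h * w x) = \<kappa> W + h * \<kappa> w" for h
  proof -
    have "integrable M (\<lambda>x. V x * W x)" "integrable M (\<lambda>x. V x * w x)"
      by (intro all_moments_integrable am)+
    then show ?thesis unfolding \<kappa>_def
      by (simp add: distrib_left mult.left_commute[of _ h])
  qed
  have eq: "(\<lambda>h. expectation (\<lambda>x. (V x * ?m x) * (W x + h * w x) ^ Suc k)) =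
     (\<lambda>h. expectation (\<lambda>x. ?d x * (W x + h * w x) ^ Suc k) +
       real (Suc k) * ((\<kappa> W + h * \<kappa> w) * expectation (\<lambda>x. ?m x * (W x + h * w x) ^ k)))"
    using Cons.IH[OF L_add[OF Cons(2) L_scale[OF w]] ws, of _ "Suc k"]
    by (intro ext) (simp add: \<kappa>lin mult.assoc)
  have d1: "((\<lambda>h. expectation (\<lambda>x. (V x * ?m x) * (W x + h * w x) ^ Suc k)) has_real_derivative
      real (Suc k) * expectation (\<lambda>x. V x * ?m x * w x * W x ^ (Suc k - 1))) (at 0)"
    by (intro has_real_derivative_expectation_power am)
  have d2: "((\<lambda>h. expectation (\<lambda>x. ?d x * (W x + h * w x) ^ Suc k)) has_real_derivative
      real (Suc k) * expectation (\<lambda>x. ?d x * w x * W x ^ (Suc k - 1))) (at 0)"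
    by (intro has_real_derivative_expectation_power am)
  have d3: "((\<lambda>h. expectation (\<lambda>x. ?m x * (W x + h * w x) ^ k)) has_real_derivative
      real k * expectation (\<lambda>x. ?m x * w x * W x ^ (k - 1))) (at 0)"
    by (intro has_real_derivative_expectation_power am)
  have d4: "((\<lambda>h. \<kappa> W + h * \<kappa> w) has_real_derivative \<kappa> w) (at 0)"
    by (auto intro!: derivative_eq_intros)
  have d5: "((\<lambda>h. expectation (\<lambda>x. (V x * ?m x) * (W x + h * w x) ^ Suc k)) has_real_derivative
      (real (Suc k) * expectation (\<lambda>x. ?d x * w x * W x ^ (Suc k - 1)) +
       real (Suc k) * (\<kappa> w * expectation (\<lambda>x. ?m x * (W x + 0 * w x) ^ k) +
          (\<kappa> W + 0 * \<kappa> w) * (real k * expectation (\<lambda>x. ?m x * w x * W x ^ (k - 1)))))) (at 0)"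
    unfolding eq
    by (intro DERIV_add d2 DERIV_cmult DERIV_mult'[THEN DERIV_cong, OF d4 d3]) simp
  have "real (Suc k) * expectation (\<lambda>x. V x * ?m x * w x * W x ^ k) =
    real (Suc k) * (expectation (\<lambda>x. ?d x * w x * W x ^ k) + \<kappa> w * expectation (\<lambda>x. ?m x * W x ^ k)
      + real k * \<kappa> W * expectation (\<lambda>x. ?m x * w x * W x ^ (k - 1)))"
    using DERIV_unique[OF d1 d5] by (simp add: distrib_left mult.assoc)
  then have main: "expectation (\<lambda>x. V x * ?m x * w x * W x ^ k) =
    (expectation (\<lambda>x. ?d x * w x * W x ^ k) + \<kappa> w * expectation (\<lambda>x. ?m x * W x ^ k)
      + real k * \<kappa> W * expectation (\<lambda>x. ?m x * w x * W x ^ (k - 1)))"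
    by simp
  have "expectation (\<lambda>x. monom_deriv \<kappa> (w # ws) x * W x ^ k) =
    expectation (\<lambda>x. \<kappa> w * (?m x * W x ^ k) + ?d x * w x * W x ^ k)"
    by (simp add: algebra_simps)
  also have "\<dots> = \<kappa> w * expectation (\<lambda>x. ?m x * W x ^ k) + expectation (\<lambda>x. ?d x * w x * W x ^ k)"
    by (subst Bochner_Integration.integral_add)
      (intro all_moments_integrable am | rule refl | simp add: integral_mult_right_zero)+
  finally show ?case using main by (simp add: mult_ac)
qed

lemma gaussian_ibp_monom:
  assumes V: "V \<in> L" and "set ws \<subseteq> L"
  shows "expectation (\<lambda>x. V x * (\<Prod>v\<leftarrow>ws. v x)) =
    expectation (monom_deriv (\<lambda>w. expectation (\<lambda>x. V x * w x)) ws)"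
  using gaussian_ibp_monom_power[OF V V assms(2), of 0] by simp


text \<open>\<open>F\<close> is a polynomial in elements of \<open>L\<close>, and \<open>DF\<close> its image under the derivation that maps
  \<open>w \<in> L\<close> to the constant \<open>\<kappa> w\<close>.\<close>

inductive wick :: "(('a \<Rightarrow> real) \<Rightarrow> complex) \<Rightarrow> ('a \<Rightarrow> complex) \<Rightarrow> ('a \<Rightarrow> complex) \<Rightarrow> bool" for \<kappa> where
  wick_const: "wick \<kappa> (\<lambda>_. c) (\<lambda>_. 0)"
| wick_lin: "w \<in> L \<Longrightarrow> wick \<kappa> (\<lambda>x. of_real (w x)) (\<lambda>_. \<kappa> w)"
| wick_add: "wick \<kappa> F DF \<Longrightarrow> wick \<kappa> G DG \<Longrightarrow> wick \<kappa> (\<lambda>x. F x + G x) (\<lambda>x. DF x + DG x)"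
| wick_mult: "wick \<kappa> F DF \<Longrightarrow> wick \<kappa> G DG \<Longrightarrow> wick \<kappa> (\<lambda>x. F x * G x) (\<lambda>x. DF x * G x + F x * DG x)"

text \<open>Integration by parts is known for monomials only; products are expanded into sums of them.\<close>

inductive wick_span :: "(('a \<Rightarrow> real) \<Rightarrow> complex) \<Rightarrow> ('a \<Rightarrow> complex) \<Rightarrow> ('a \<Rightarrow> complex) \<Rightarrow> bool" for \<kappa> where
  wick_span_monom: "set ws \<subseteq> L \<Longrightarrow>
    wick_span \<kappa> (\<lambda>x. c * of_real (\<Prod>w\<leftarrow>ws. w x)) (\<lambda>x. c * monom_deriv \<kappa> ws x)"
| wick_span_add: "wick_span \<kappa> F DF \<Longrightarrow> wick_span \<kappa> G DG \<Longrightarrow>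
    wick_span \<kappa> (\<lambda>x. F x + G x) (\<lambda>x. DF x + DG x)"

lemma wick_cong:
  assumes "wick \<kappa> F DF" "\<And>x. F x = F' x" "\<And>x. DF x = DF' x"
  shows "wick \<kappa> F' DF'"
proof -
  have "F = F'" "DF = DF'" using assms(2,3) by (intro ext; simp)+
  then show ?thesis using assms(1) by simp
qed

lemma wick_span_cong:
  assumes "wick_span \<kappa> F DF" "\<And>x. F x = F' x" "\<And>x. DF x = DF' x"
  shows "wick_span \<kappa> F' DF'"
proof -
  have "F = F'" "DF = DF'" using assms(2,3) by (intro ext; simp)+
  then show ?thesis using assms(1) by simp
qed

lemma wick_span_cmult:
  "wick_span \<kappa> F DF \<Longrightarrow> wick_span \<kappa> (\<lambda>x. c * F x) (\<lambda>x. c * DF x)"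
proof (induction rule: wick_span.induct)
  case (wick_span_monom ws d)
  then show ?case
    by (rule wick_span_cong[OF wick_span.wick_span_monom[of ws \<kappa> "c * d"]]) simp_all
next
  case (wick_span_add F DF G DG)
  show ?case
    by (rule wick_span_cong[OF wick_span.wick_span_add[OF wick_span_add.IH]]) (simp_all add: distrib_left)
qed

lemma wick_span_lin:
  "wick_span \<kappa> F DF \<Longrightarrow> w \<in> L \<Longrightarrow>
    wick_span \<kappa> (\<lambda>x. of_real (w x) * F x) (\<lambda>x. \<kappa> w * F x + of_real (w x) * DF x)"
proof (induction rule: wick_span.induct)
  case (wick_span_monom ws c)
  then show ?case
    by (intro wick_span_cong[OF wick_span.wick_span_monom[of "w # ws" \<kappa> c]]) (simp_all add: algebra_simps)
next
  case (wick_span_add F DF G DG)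
  show ?case
    by (rule wick_span_cong[OF wick_span.wick_span_add[OF wick_span_add.IH]])
      (simp_all add: distrib_left wick_span_add.prems algebra_simps)
qed

text \<open>Only the left factor is taken apart, while the right one remains an arbitrary element of
  the span. A product on the left is then handled by applying the induction hypotheses in
  succession, first to the inner factor and then to the outer one.\<close>

lemma wick_span_mult:
  "wick \<kappa> F DF \<Longrightarrow> wick_span \<kappa> G DG \<Longrightarrow>
    wick_span \<kappa> (\<lambda>x. F x * G x) (\<lambda>x. DF x * G x + F x * DG x)"
proof (induction arbitrary: G DG rule: wick.induct)
  case (wick_const c)
  show ?case by (rule wick_span_cong[OF wick_span_cmult[OF wick_const, of c]]) simp_all
next
  case (wick_lin w)
  then show ?case by (rule wick_span_lin[rotated])
next
  case (wick_add F1 DF1 F2 DF2)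
  show ?case
    by (rule wick_span_cong[OF wick_span_add[OF wick_add.IH[OF wick_add.prems]]])
      (simp_all add: algebra_simps)
next
  case (wick_mult F1 DF1 F2 DF2)
  show ?case
    by (rule wick_span_cong[OF wick_mult.IH(1)[OF wick_mult.IH(2)[OF wick_mult.prems]]])
      (simp_all add: algebra_simps)
qed

lemma wick_imp_wick_span: "wick \<kappa> F DF \<Longrightarrow> wick_span \<kappa> F DF"
  using wick_span_mult[of \<kappa> F DF "\<lambda>_. 1" "\<lambda>_. 0"] wick_span_monom[of "[]" \<kappa> 1] by simp

lemma wick_all_moments: "wick \<kappa> F DF \<Longrightarrow> all_moments M F \<and> all_moments M DF"
proof (induction rule: wick.induct)
  case (wick_lin w)
  then show ?case by (simp add: all_moments_of_real L_moments)
qed (simp_all add: all_moments_add all_moments_mult)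

text \<open>Integration by parts against a complex Gaussian variable. Here \<kappa> is the bilinear
  covariance with V_1 + iV_2, without conjugation, which is why it can vanish on a whole circular
  family.\<close>

lemma wick_expectation:
  assumes V: "V\<^sub>1 \<in> L" "V\<^sub>2 \<in> L" and F: "wick \<kappa> F DF"
    and \<kappa>: "\<And>w. w \<in> L \<Longrightarrow> \<kappa> w = of_real (expectation (\<lambda>x. V\<^sub>1 x * w x)) + \<i> * of_real (expectation (\<lambda>x. V\<^sub>2 x * w x))"
  shows "(\<integral>x. (of_real (V\<^sub>1 x) + \<i> * of_real (V\<^sub>2 x)) * F x \<partial>M) = (\<integral>x. DF x \<partial>M)"
proof -
  let ?V = "\<lambda>x. complex_of_real (V\<^sub>1 x) + \<i> * of_real (V\<^sub>2 x)"
  have mV: "all_moments M ?V"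
    by (intro all_moments_add all_moments_cmult all_moments_of_real L_moments V)
  let ?\<kappa>1 = "\<lambda>w. expectation (\<lambda>x. V\<^sub>1 x * w x)" and ?\<kappa>2 = "\<lambda>w. expectation (\<lambda>x. V\<^sub>2 x * w x)"
  have md: "monom_deriv \<kappa> ws x = of_real (monom_deriv ?\<kappa>1 ws x) + \<i> * of_real (monom_deriv ?\<kappa>2 ws x)"
    if "set ws \<subseteq> L" for ws x
    using that by (induction ws) (simp_all add: \<kappa> algebra_simps)
  have "all_moments M F \<and> all_moments M DF \<and> (\<integral>x. ?V x * F x \<partial>M) = (\<integral>x. DF x \<partial>M)"
    using wick_imp_wick_span[OF F]
  proof (induction rule: wick_span.induct)
    case (wick_span_monom ws c)
    let ?P = "\<lambda>x. \<Prod>w\<leftarrow>ws. w x"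
    note mP = all_moments_monom[OF wick_span_monom]
    note m1 = all_moments_monom_deriv[OF wick_span_monom, of ?\<kappa>1]
      and m2 = all_moments_monom_deriv[OF wick_span_monom, of ?\<kappa>2]
    have meq: "monom_deriv \<kappa> ws = (\<lambda>x. of_real (monom_deriv ?\<kappa>1 ws x) + \<i> * of_real (monom_deriv ?\<kappa>2 ws x))"
      using md[OF wick_span_monom] by blast
    have m3: "all_moments M (monom_deriv \<kappa> ws)"
      unfolding meq by (intro all_moments_add all_moments_cmult all_moments_of_real m1 m2)
    have I: "integrable M (\<lambda>x. V\<^sub>1 x * ?P x)" "integrable M (\<lambda>x. V\<^sub>2 x * ?P x)"
      by (intro all_moments_integrable all_moments_mult L_moments V mP)+
    have "(\<integral>x. ?V x * (c * of_real (?P x)) \<partial>M) =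
      (\<integral>x. c * (complex_of_real (V\<^sub>1 x * ?P x) + \<i> * complex_of_real (V\<^sub>2 x * ?P x)) \<partial>M)"
      by (intro Bochner_Integration.integral_cong refl) (simp add: algebra_simps)
    also have "\<dots> = c * (of_real (expectation (\<lambda>x. V\<^sub>1 x * ?P x)) + \<i> * of_real (expectation (\<lambda>x. V\<^sub>2 x * ?P x)))"
      using I by (simp del: of_real_mult add: integral_complex_of_real)
    also have "\<dots> = c * (of_real (expectation (monom_deriv ?\<kappa>1 ws)) + \<i> * of_real (expectation (monom_deriv ?\<kappa>2 ws)))"
      unfolding gaussian_ibp_monom[OF V(1) wick_span_monom] gaussian_ibp_monom[OF V(2) wick_span_monom] ..
    also have "\<dots> = (\<integral>x. c * monom_deriv \<kappa> ws x \<partial>M)"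
      using all_moments_integrable[OF m1] all_moments_integrable[OF m2]
      unfolding meq by (simp add: integral_complex_of_real)
    finally show ?case
      using all_moments_cmult[OF all_moments_of_real[OF mP]] all_moments_cmult[OF m3] by blast
  next
    case (wick_span_add F DF G DG)
    then have "integrable M (\<lambda>x. ?V x * F x)" "integrable M (\<lambda>x. ?V x * G x)" "integrable M DF" "integrable M DG"
      by (auto intro!: all_moments_integrable all_moments_mult mV)
    then show ?case using wick_span_add.IH
      by (simp add: distrib_left all_moments_add)
  qed
  then show ?thesis by blast
qed

lemma wick_power:
  assumes "wick \<kappa> F DF"
  shows "wick \<kappa> (\<lambda>x. F x ^ n) (\<lambda>x. of_nat n * F x ^ (n - 1) * DF x)"
proof (induction n)
  case 0
  show ?case using wick_const[of \<kappa> 1] by simp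
next
  case (Suc n)
  show ?case
    by (rule wick_cong[OF wick_mult[OF assms Suc]]) (cases n; simp add: algebra_simps)+
qed

lemma wick_cmult: "wick \<kappa> F DF \<Longrightarrow> wick \<kappa> (\<lambda>x. c * F x) (\<lambda>x. c * DF x)"
  using wick_cong[OF wick_mult[OF wick_const[of \<kappa> c]]] by simp

lemma zero_in_L: "W \<in> L \<Longrightarrow> (\<lambda>_. 0) \<in> L"
  using L_scale[of W 0] by simp

end

section \<open>Hermite polynomials: recurrence, covariances and complex representation\<close>

fun hermite_rec :: "nat \<Rightarrow> real \<Rightarrow> real" where
  "hermite_rec 0 x = 1"
| "hermite_rec (Suc 0) x = x"
| "hermite_rec (Suc (Suc q)) x = x * hermite_rec (Suc q) x - real (Suc q) * hermite_rec q x"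

text \<open>The recurrence alone implies that the derivative of the q-th polynomial is q times its
  predecessor; with this rule, one more differentiation of the Gaussian weight reproduces the
  recurrence. At q = 0 the truncated index q - 1 is harmless because its coefficient is 0.\<close>

lemma hermite_eq_hermite_rec: "hermite q x = hermite_rec q x"
  and hermite_rec_Suc: "hermite_rec (Suc q) x = x * hermite_rec q x - real q * hermite_rec (q - 1) x"
proof -
  let ?h = hermite_rec
  have hS: "?h (Suc q) x = x * ?h q x - real q * ?h (q - 1) x" for q x
    by (cases q) simp_all
  show "?h (Suc q) x = x * ?h q x - real q * ?h (q - 1) x" by (rule hS)
  have hD: "(?h q has_real_derivative real q * ?h (q - 1) x) (at x)" for q x
  proof (induction q arbitrary: x rule: less_induct)
    case (less q)
    show ?case
    proof (cases q)
      case 0 then show ?thesis by (simp add: hermite_rec.simps(1))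
    next
      case (Suc p)
      have e: "?h q = (\<lambda>x. x * ?h p x - real p * ?h (p - 1) x)" using hS[of p] Suc by (intro ext) simp
      have p1: "(?h p has_real_derivative real p * ?h (p - 1) x) (at x)" using less.IH[of p] Suc by simp
      have p2: "(?h (p - 1) has_real_derivative real (p - 1) * ?h (p - 1 - 1) x) (at x)" using less.IH[of "p - 1"] Suc by simp
      have "(?h q has_real_derivative (?h p x + x * (real p * ?h (p - 1) x) - real p * (real (p - 1) * ?h (p - 1 - 1) x))) (at x)"
        unfolding e using DERIV_diff[OF DERIV_mult'[OF DERIV_ident p1] DERIV_cmult[OF p2, of "real p"]]
        by (rule DERIV_cong) simp
      moreover have "?h p x + x * (real p * ?h (p - 1) x) - real p * (real (p - 1) * ?h (p - 1 - 1) x) = real q * ?h p x"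
      proof (cases p)
        case (Suc r)
        then have "?h p x + x * (real p * ?h (p - 1) x) - real p * (real (p - 1) * ?h (p - 1 - 1) x) =
          ?h p x + real p * (x * ?h r x - real r * ?h (r - 1) x)"
          by (simp add: algebra_simps)
        also have "\<dots> = ?h p x + real p * ?h p x"
          unfolding hS[of r x, symmetric] Suc ..
        finally show ?thesis using \<open>q = Suc p\<close> by (simp add: algebra_simps)
      qed (simp add: \<open>q = Suc p\<close>)
      ultimately show ?thesis using Suc by simp
    qed
  qed
  have "(deriv ^^ q) (\<lambda>y. exp (- (y\<^sup>2 / 2))) = (\<lambda>x::real. (-1) ^ q * ?h q x * exp (- (x\<^sup>2 / 2)))" for q
  proof (induction q)
    case (Suc q)
    have "deriv (\<lambda>x::real. (-1) ^ q * ?h q x * exp (- (x\<^sup>2 / 2))) x = (-1) ^ Suc q * ?h (Suc q) x * exp (- (x\<^sup>2 / 2))" for x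
    proof (rule DERIV_imp_deriv)
      have "((\<lambda>x::real. exp (- (x\<^sup>2 / 2))) has_real_derivative - x * exp (- (x\<^sup>2 / 2))) (at x)"
        by (auto intro!: derivative_eq_intros)
      from DERIV_mult'[OF DERIV_cmult[OF hD[of q x], of "(-1) ^ q"] this]
      show "((\<lambda>x. (-1) ^ q * ?h q x * exp (- (x\<^sup>2 / 2))) has_real_derivative
          (-1) ^ Suc q * ?h (Suc q) x * exp (- (x\<^sup>2 / 2))) (at x)"
        by (rule DERIV_cong) (simp add: hS algebra_simps)
    qed
    then show ?case using Suc by simp
  qed (simp add: hermite_rec.simps(1))
  then have "hermite q x = ((-1) ^ q * (-1) ^ q) * ?h q x * (exp (x\<^sup>2 / 2) * exp (- (x\<^sup>2 / 2)))" for q x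
    unfolding hermite_def by (simp only: mult_ac)
  then have "hermite q x = ?h q x" for q x
    by (simp flip: exp_add power_mult_distrib)
  then show "hermite q x = ?h q x" .
qed

lemma hermite_0 [simp]: "hermite 0 x = 1"
  by (simp add: hermite_eq_hermite_rec)

lemma hermite_Suc: "hermite (Suc q) x = x * hermite q x - real q * hermite (q - 1) x"
  by (simp only: hermite_eq_hermite_rec hermite_rec_Suc)

context gaussian_space
begin

text \<open>The chain rule, since H_q' = q H_(q-1). The identity \<open>D\<close> is the
  differentiated recurrence; it collapses the Leibniz terms into a single one.\<close>

lemma wick_hermite:
  assumes w: "w \<in> L"
  shows "wick \<kappa> (\<lambda>x. of_real (hermite q (w x))) (\<lambda>x. of_real (real q * hermite (q - 1) (w x)) * \<kappa> w)"
proof (induction q rule: less_induct)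
  case (less q)
  show ?case
  proof (cases q)
    case 0
    then show ?thesis using wick_const[of \<kappa> 1] by simp
  next
    case (Suc p)
    have 1: "wick \<kappa> (\<lambda>x. of_real (hermite p (w x))) (\<lambda>x. of_real (real p * hermite (p - 1) (w x)) * \<kappa> w)"
      using less.IH[of p] Suc by simp
    have 2: "wick \<kappa> (\<lambda>x. of_real (hermite (p - 1) (w x))) (\<lambda>x. of_real (real (p - 1) * hermite (p - 1 - 1) (w x)) * \<kappa> w)"
      using less.IH[of "p - 1"] Suc by simp
    have D: "hermite p y + y * (real p * hermite (p - 1) y) - real p * (real (p - 1) * hermite (p - 1 - 1) y) = real q * hermite p y" for y
    proof (cases p)
      case (Suc r)
      then have "hermite p y + y * (real p * hermite (p - 1) y) - real p * (real (p - 1) * hermite (p - 1 - 1) y) =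
          hermite p y + real p * (y * hermite r y - real r * hermite (r - 1) y)"
        by (simp add: algebra_simps)
      also have "\<dots> = hermite p y + real p * hermite p y"
        unfolding hermite_Suc[of r, symmetric] Suc ..
      finally show ?thesis using \<open>q = Suc p\<close> by (simp add: algebra_simps)
    qed (simp add: \<open>q = Suc p\<close>)
    show ?thesis
    proof (rule wick_cong[OF wick_add[OF wick_mult[OF wick_lin[OF w] 1] wick_cmult[OF 2, of "- of_nat p"]]])
      fix x
      show "of_real (w x) * of_real (hermite p (w x)) + - of_nat p * of_real (hermite (p - 1) (w x)) =
        complex_of_real (hermite q (w x))"
        unfolding Suc hermite_Suc by simp
      have "complex_of_real (real q * hermite p (w x)) * \<kappa> w =
        complex_of_real (hermite p (w x) + w x * (real p * hermite (p - 1) (w x)) - real p * (real (p - 1) * hermite (p - 1 - 1) (w x))) * \<kappa> w"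
        unfolding D ..
      then show "\<kappa> w * of_real (hermite p (w x)) + of_real (w x) * (of_real (real p * hermite (p - 1) (w x)) * \<kappa> w) +
          - of_nat p * (of_real (real (p - 1) * hermite (p - 1 - 1) (w x)) * \<kappa> w) =
        complex_of_real (real q * hermite (q - 1) (w x)) * \<kappa> w"
        using Suc by (simp add: algebra_simps)
    qed
  qed
qed

lemma all_moments_hermite:
  assumes "w \<in> L" shows "all_moments M (\<lambda>x. hermite q (w x))"
proof -
  have *: "all_moments M (\<lambda>x. complex_of_real (hermite q (w x)))"
    using wick_all_moments[OF wick_hermite[OF assms, of "\<lambda>_. 0" q]] by blast
  have "(\<lambda>x. Re (complex_of_real (hermite q (w x)))) \<in> borel_measurable M"
    using all_moments_measurable[OF *] by measurable
  with * show ?thesis unfolding all_moments_def by simp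
qed

lemma wick_expectation_real:
  assumes V: "V \<in> L" and F: "wick (\<lambda>w. of_real (expectation (\<lambda>x. V x * w x))) F DF"
  shows "(\<integral>x. of_real (V x) * F x \<partial>M) = (\<integral>x. DF x \<partial>M)"
  using wick_expectation[OF V zero_in_L[OF V] F] by simp

text \<open>Integrating the factor U by parts produces one term from each Hermite polynomial. The
  term from the first one cancels against the subtracted term of the recurrence, because U has unit
  variance; what remains lowers both indices by one.\<close>

lemma hermite_covariance_Suc:
  assumes U: "U \<in> L" and W: "W \<in> L" and U1: "expectation (\<lambda>x. (U x)\<^sup>2) = 1"
  shows "expectation (\<lambda>x. hermite (Suc p) (U x) * hermite q (W x)) =
    real q * expectation (\<lambda>x. U x * W x) * expectation (\<lambda>x. hermite p (U x) * hermite (q - 1) (W x))"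
proof -
  let ?\<kappa> = "\<lambda>w. complex_of_real (expectation (\<lambda>x. U x * w x))"
  define e where "e p q = expectation (\<lambda>x. hermite p (U x) * hermite q (W x))" for p q
  have I: "integrable M (\<lambda>x. hermite p (U x) * hermite q (W x))" for p q
    by (intro all_moments_integrable all_moments_mult all_moments_hermite U W)
  have I2: "integrable M (\<lambda>x. U x * (hermite p (U x) * hermite q (W x)))" for p q
    by (intro all_moments_integrable all_moments_mult all_moments_hermite L_moments U W)
  have \<kappa>U: "?\<kappa> U = 1" using U1 by (simp add: power2_eq_square)
  have "complex_of_real (expectation (\<lambda>x. U x * (hermite p (U x) * hermite q (W x)))) =
    (\<integral>x. of_real (U x) * (of_real (hermite p (U x)) * of_real (hermite q (W x))) \<partial>M)"
    by (simp flip: integral_complex_of_real)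
  also have "\<dots> = (\<integral>x. of_real (real p * hermite (p - 1) (U x)) * ?\<kappa> U * of_real (hermite q (W x)) +
      of_real (hermite p (U x)) * (of_real (real q * hermite (q - 1) (W x)) * ?\<kappa> W) \<partial>M)"
    by (rule wick_expectation_real[OF U wick_mult[OF wick_hermite[OF U] wick_hermite[OF W]]])
  also have "\<dots> = (\<integral>x. complex_of_real (real p * (hermite (p - 1) (U x) * hermite q (W x)) +
      real q * expectation (\<lambda>x. U x * W x) * (hermite p (U x) * hermite (q - 1) (W x))) \<partial>M)"
    unfolding \<kappa>U by (intro Bochner_Integration.integral_cong refl) (simp add: algebra_simps)
  also have "\<dots> = of_real (real p * e (p - 1) q + real q * expectation (\<lambda>x. U x * W x) * e p (q - 1))"
    unfolding integral_complex_of_real e_def using I by simp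
  finally have *: "expectation (\<lambda>x. U x * (hermite p (U x) * hermite q (W x))) =
    real p * e (p - 1) q + real q * expectation (\<lambda>x. U x * W x) * e p (q - 1)"
    using of_real_eq_iff by blast
  have "e (Suc p) q = expectation (\<lambda>x. U x * (hermite p (U x) * hermite q (W x)) - real p * (hermite (p - 1) (U x) * hermite q (W x)))"
    unfolding e_def hermite_Suc by (intro Bochner_Integration.integral_cong refl) (simp add: algebra_simps)
  also have "\<dots> = expectation (\<lambda>x. U x * (hermite p (U x) * hermite q (W x))) - real p * e (p - 1) q"
    unfolding e_def using I I2 by simp
  finally show ?thesis using * by (simp add: e_def)
qed

lemma hermite_covariance:
  assumes U: "U \<in> L" and W: "W \<in> L" and "expectation (\<lambda>x. (U x)\<^sup>2) = 1" "expectation (\<lambda>x. (W x)\<^sup>2) = 1"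
  shows "expectation (\<lambda>x. hermite p (U x) * hermite q (W x)) =
    (if p = q then fact p * expectation (\<lambda>x. U x * W x) ^ p else 0)"
proof (induction p arbitrary: q)
  case 0
  show ?case
  proof (cases q)
    case 0 then show ?thesis by (simp add: prob_space)
  next
    case (Suc r)
    then show ?thesis using hermite_covariance_Suc[OF W U assms(4), of r 0] by simp
  qed
next
  case (Suc p)
  then show ?case
    unfolding hermite_covariance_Suc[OF U W assms(3)] by (cases q) auto
qed

text \<open>Integrating one factor iW by parts lowers the exponent by one and yields i^2 = -1, so
  both sides satisfy the same three-term recurrence.\<close>

lemma hermite_complex_expectation:
  assumes W: "W \<in> L" and W1: "expectation (\<lambda>x. (W x)\<^sup>2) = 1"
  shows "(\<integral>x. (of_real y + \<i> * of_real (W x)) ^ q \<partial>M) = of_real (hermite q y)"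
proof (induction q rule: less_induct)
  case (less q)
  show ?case
  proof (cases q)
    case 0 then show ?thesis by (simp add: prob_space)
  next
    case (Suc p)
    let ?F = "\<lambda>x. of_real y + \<i> * complex_of_real (W x)"
    let ?\<kappa> = "\<lambda>w. complex_of_real (expectation (\<lambda>x. W x * w x))"
    have \<kappa>W: "?\<kappa> W = 1" using W1 by (simp add: power2_eq_square)
    have wF: "wick ?\<kappa> ?F (\<lambda>_. \<i>)"
      by (rule wick_cong[OF wick_add[OF wick_const wick_cmult[OF wick_lin[OF W]]]]) (simp_all add: \<kappa>W del: of_real_eq_1_iff)
    have mF: "all_moments M ?F" using wick_all_moments[OF wF] by blast
    have I: "integrable M (\<lambda>x. ?F x ^ k)" "integrable M (\<lambda>x. of_real (W x) * ?F x ^ k)" for k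
      by (intro all_moments_integrable all_moments_mult all_moments_power all_moments_of_real L_moments W mF)+
    have E: "(\<integral>x. of_real (W x) * ?F x ^ p \<partial>M) = of_nat p * \<i> * (\<integral>x. ?F x ^ (p - 1) \<partial>M)"
      using wick_expectation_real[OF W wick_power[OF wF, of p]] by (simp add: mult_ac)
    have "(\<integral>x. ?F x ^ q \<partial>M) = (\<integral>x. of_real y * ?F x ^ p + \<i> * (of_real (W x) * ?F x ^ p) \<partial>M)"
      unfolding Suc by (intro Bochner_Integration.integral_cong refl) (simp add: algebra_simps)
    also have "\<dots> = of_real y * (\<integral>x. ?F x ^ p \<partial>M) + \<i> * (\<integral>x. of_real (W x) * ?F x ^ p \<partial>M)"
      using I by simp
    also have "\<dots> = of_real y * (\<integral>x. ?F x ^ p \<partial>M) - of_nat p * (\<integral>x. ?F x ^ (p - 1) \<partial>M)"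
      unfolding E by (simp add: algebra_simps)
    also have "\<dots> = of_real (hermite q y)"
      using less.IH[of p] less.IH[of "p - 1"] Suc by (simp add: hermite_Suc)
    finally show ?thesis .
  qed
qed

lemma wick_prod_list_vanish:
  assumes "\<And>f. f \<in> set fs \<Longrightarrow> wick \<kappa> f (\<lambda>_. 0)"
  shows "wick \<kappa> (\<lambda>x. \<Prod>f\<leftarrow>fs. f x) (\<lambda>_. 0)"
  using assms
proof (induction fs)
  case Nil
  show ?case using wick_const[of \<kappa> 1] by simp
next
  case (Cons f fs)
  have "wick \<kappa> f (\<lambda>_. 0)" "wick \<kappa> (\<lambda>x. \<Prod>f\<leftarrow>fs. f x) (\<lambda>_. 0)"
    using Cons by auto
  from wick_mult[OF this] show ?case by simp
qed

lemma wick_prod: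
  assumes "finite J" "\<And>j. j \<in> J \<Longrightarrow> wick \<kappa> (f j) (\<lambda>_. d j)"
  shows "wick \<kappa> (\<lambda>x. \<Prod>j\<in>J. f j x) (\<lambda>x. \<Sum>j\<in>J. d j * (\<Prod>i\<in>J - {j}. f i x))"
  using assms
proof (induction J rule: finite_induct)
  case empty
  show ?case using wick_const[of \<kappa> 1] by simp
next
  case (insert k J)
  have 1: "wick \<kappa> (f k) (\<lambda>_. d k)" by (rule insert.prems) simp
  have 2: "wick \<kappa> (\<lambda>x. \<Prod>j\<in>J. f j x) (\<lambda>x. \<Sum>j\<in>J. d j * (\<Prod>i\<in>J - {j}. f i x))"
    by (rule insert.IH) (simp add: insert.prems)
  show ?case
  proof (rule wick_cong[OF wick_mult[OF 1 2]])
    fix x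
    show "f k x * (\<Prod>j\<in>J. f j x) = (\<Prod>j\<in>insert k J. f j x)"
      using insert.hyps by simp
    have "insert k J - {j} = insert k (J - {j})" if "j \<in> J" for j using insert.hyps that by auto
    then have "(\<Sum>j\<in>J. d j * (\<Prod>i\<in>insert k J - {j}. f i x)) = f k x * (\<Sum>j\<in>J. d j * (\<Prod>i\<in>J - {j}. f i x))"
      unfolding sum_distrib_left using insert.hyps by (intro sum.cong refl) simp
    moreover have "insert k J - {k} = J" using insert.hyps by auto
    ultimately show "d k * (\<Prod>j\<in>J. f j x) + f k x * (\<Sum>j\<in>J. d j * (\<Prod>i\<in>J - {j}. f i x)) =
      (\<Sum>j\<in>insert k J. d j * (\<Prod>i\<in>insert k J - {j}. f i x))"
      using insert.hyps by simp
  qed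
qed

end

section \<open>Wick's formula for circular complex Gaussian families\<close>

lemma sum_permutations_of_set_Cons:
  assumes "finite J" "J \<noteq> {}"
  shows "(\<Sum>\<pi>\<in>permutations_of_set J. f \<pi>) = (\<Sum>j\<in>J. \<Sum>\<pi>\<in>permutations_of_set (J - {j}). f (j # \<pi>))"
proof -
  have "(\<Sum>\<pi>\<in>permutations_of_set J. f \<pi>) =
    (\<Sum>j\<in>J. sum f ((\<lambda>xs. j # xs) ` permutations_of_set (J - {j})))"
    unfolding permutations_of_set_nonempty[OF assms(2)]
    by (rule sum.UNION_disjoint) (use assms in auto)
  also have "\<dots> = (\<Sum>j\<in>J. \<Sum>\<pi>\<in>permutations_of_set (J - {j}). f (j # \<pi>))"
    by (rule sum.cong[OF refl], subst sum.reindex) (auto simp: inj_on_def)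
  finally show ?thesis .
qed

text \<open>Real and imaginary parts have the same covariance and are mutually uncorrelated.
  Consequently E[Z_i Z_j] = 0, while E[Z_i cnj Z_j] = 2 R_ij.\<close>

locale circular_gaussian = gaussian_space +
  fixes A B :: "'i \<Rightarrow> 'a \<Rightarrow> real" and R :: "'i \<Rightarrow> 'i \<Rightarrow> real"
  assumes A_in: "A i \<in> L" and B_in: "B i \<in> L"
    and AA: "expectation (\<lambda>x. A i x * A j x) = R i j"
    and BB: "expectation (\<lambda>x. B i x * B j x) = R i j"
    and AB: "expectation (\<lambda>x. A i x * B j x) = 0"
begin

definition Z :: "'i \<Rightarrow> 'a \<Rightarrow> complex" where
  "Z i x = of_real (A i x) + \<i> * of_real (B i x)"

lemma all_moments_Z: "all_moments M (Z i)"
  unfolding Z_def[abs_def]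
  by (intro all_moments_add all_moments_cmult all_moments_of_real L_moments A_in B_in)

text \<open>Up to the power of 2 this is the permanent of the covariances. Integrating the first
  \<open>Z\<close> by parts annihilates all other \<open>Z\<close> and pairs it with each conjugate
  in turn, which is the expansion of a permanent along a row. The unconjugated factors form a list
  because the head is removed, the conjugated ones a set because any of them may be the
  partner.\<close>

lemma Z_prod_expectation:
  assumes "finite J" "length us = card J"
  shows "(\<integral>x. (\<Prod>u\<leftarrow>us. Z u x) * (\<Prod>j\<in>J. cnj (Z (v j) x)) \<partial>M) =
    of_real (2 ^ card J * (\<Sum>\<pi>\<in>permutations_of_set J. \<Prod>(u, j)\<leftarrow>zip us \<pi>. R u (v j)))"
  using assms
proof (induction us arbitrary: J)
  case Nil
  then show ?case by (simp add: prob_space)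
next
  case (Cons u us)
  define \<kappa> where "\<kappa> w = complex_of_real (expectation (\<lambda>x. A u x * w x)) + \<i> * of_real (expectation (\<lambda>x. B u x * w x))" for w
  have BA: "expectation (\<lambda>x. B i x * A j x) = 0" for i j
    using AB[of j i] by (simp add: mult.commute)
  have \<kappa>A: "\<kappa> (A i) = of_real (R u i)" and \<kappa>B: "\<kappa> (B i) = \<i> * of_real (R u i)" for i
    by (simp_all add: \<kappa>_def AA BB AB BA)
  \<comment> \<open>These two identities are circularity itself: the bilinear covariance with Z_u
    vanishes on Z_i and equals 2 R_ui on its conjugate.\<close>
  have s1: "\<kappa> (A i) + \<i> * \<kappa> (B i) = 0" and s2: "\<kappa> (A i) + - \<i> * \<kappa> (B i) = of_real (2 * R u i)" for i
    unfolding \<kappa>A \<kappa>B by (simp_all add: complex_eq_iff)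
  have wZ: "wick \<kappa> (Z i) (\<lambda>_. 0)" for i
    unfolding Z_def[abs_def]
    by (rule wick_cong[OF wick_add[OF wick_lin[OF A_in[of i]] wick_cmult[OF wick_lin[OF B_in[of i]], where c = \<i>]]])
      (simp_all add: s1)
  have wcZ: "wick \<kappa> (\<lambda>x. cnj (Z i x)) (\<lambda>_. of_real (2 * R u i))" for i
    unfolding Z_def
    by (rule wick_cong[OF wick_add[OF wick_lin[OF A_in[of i]] wick_cmult[OF wick_lin[OF B_in[of i]], where c = "- \<i>"]]])
      (simp_all add: s2[simplified])
  have J: "J \<noteq> {}" using Cons.prems by auto
  have w1: "wick \<kappa> (\<lambda>x. \<Prod>u\<leftarrow>us. Z u x) (\<lambda>_. 0)"
    using wick_prod_list_vanish[of "map Z us" \<kappa>] wZ by (auto simp: comp_def)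
  have w2: "wick \<kappa> (\<lambda>x. \<Prod>j\<in>J. cnj (Z (v j) x))
    (\<lambda>x. \<Sum>j\<in>J. of_real (2 * R u (v j)) * (\<Prod>i\<in>J - {j}. cnj (Z (v i) x)))"
    by (intro wick_prod wcZ Cons.prems)
  have I: "integrable M (\<lambda>x. (\<Prod>u\<leftarrow>us. Z u x) * (\<Prod>i\<in>K. cnj (Z (v i) x)))" for K
  proof -
    have "all_moments M (\<lambda>x. \<Prod>u\<leftarrow>us. Z u x)" using wick_all_moments[OF w1] by blast
    then show ?thesis
      by (intro all_moments_integrable all_moments_mult all_moments_prod all_moments_cnj all_moments_Z)
  qed
  have "(\<integral>x. (\<Prod>u\<leftarrow>u # us. Z u x) * (\<Prod>j\<in>J. cnj (Z (v j) x)) \<partial>M) =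
    (\<integral>x. (of_real (A u x) + \<i> * of_real (B u x)) * ((\<Prod>u\<leftarrow>us. Z u x) * (\<Prod>j\<in>J. cnj (Z (v j) x))) \<partial>M)"
    by (simp add: Z_def mult.assoc)
  also have "\<dots> = (\<integral>x. 0 * (\<Prod>j\<in>J. cnj (Z (v j) x)) +
      (\<Prod>u\<leftarrow>us. Z u x) * (\<Sum>j\<in>J. of_real (2 * R u (v j)) * (\<Prod>i\<in>J - {j}. cnj (Z (v i) x))) \<partial>M)"
    by (rule wick_expectation[OF A_in B_in wick_mult[OF w1 w2]]) (simp add: \<kappa>_def)
  also have "\<dots> = (\<integral>x. (\<Sum>j\<in>J. of_real (2 * R u (v j)) * ((\<Prod>u\<leftarrow>us. Z u x) * (\<Prod>i\<in>J - {j}. cnj (Z (v i) x)))) \<partial>M)"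
    by (intro Bochner_Integration.integral_cong refl) (simp add: sum_distrib_left mult_ac)
  also have "\<dots> = (\<Sum>j\<in>J. of_real (2 * R u (v j)) * (\<integral>x. (\<Prod>u\<leftarrow>us. Z u x) * (\<Prod>i\<in>J - {j}. cnj (Z (v i) x)) \<partial>M))"
    using I by (subst Bochner_Integration.integral_sum) auto
  also have "\<dots> = (\<Sum>j\<in>J. of_real (2 * R u (v j)) *
      of_real (2 ^ (card J - 1) * (\<Sum>\<pi>\<in>permutations_of_set (J - {j}). \<Prod>(u, j)\<leftarrow>zip us \<pi>. R u (v j))))"
  proof (intro sum.cong refl)
    fix j assume j: "j \<in> J"
    have c: "card (J - {j}) = card J - 1" using j Cons.prems by (simp add: card_Diff_singleton)
    show "of_real (2 * R u (v j)) * (\<integral>x. (\<Prod>u\<leftarrow>us. Z u x) * (\<Prod>i\<in>J - {j}. cnj (Z (v i) x)) \<partial>M) =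
      of_real (2 * R u (v j)) *
      of_real (2 ^ (card J - 1) * (\<Sum>\<pi>\<in>permutations_of_set (J - {j}). \<Prod>(u, j)\<leftarrow>zip us \<pi>. R u (v j)))"
      using Cons.IH[of "J - {j}"] Cons.prems unfolding c by simp
  qed
  also have "\<dots> = of_real (\<Sum>j\<in>J. 2 * 2 ^ (card J - 1) *
      (\<Sum>\<pi>\<in>permutations_of_set (J - {j}). R u (v j) * (\<Prod>(u, j)\<leftarrow>zip us \<pi>. R u (v j))))"
    by (simp add: sum_distrib_left mult_ac)
  also have "2 * 2 ^ (card J - 1) = (2::real) ^ card J"
    using J Cons.prems by (cases "card J") auto
  also have "(\<Sum>j\<in>J. 2 ^ card J *
      (\<Sum>\<pi>\<in>permutations_of_set (J - {j}). R u (v j) * (\<Prod>(u, j)\<leftarrow>zip us \<pi>. R u (v j)))) =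
    2 ^ card J * (\<Sum>\<pi>\<in>permutations_of_set J. \<Prod>(u, j)\<leftarrow>zip (u # us) \<pi>. R u (v j))"
    unfolding sum_permutations_of_set_Cons[OF Cons.prems(1) J] by (simp add: sum_distrib_left)
  finally show ?case .
qed

end

section \<open>Moments in a fixed Wiener chaos\<close>

lemma prod_nat_div_group:
  "(\<Prod>k<q * m. f (k div m)) = (\<Prod>j<q. f j ^ m)" for f :: "nat \<Rightarrow> 'b::comm_monoid_mult"
proof -
  have "(\<Prod>k<q * m. f (k div m)) = (\<Prod>j<q. \<Prod>k\<in>{j * m..<j * m + m}. f (k div m))"
    by (rule prod.nat_group[symmetric])
  also have "\<dots> = (\<Prod>j<q. \<Prod>k\<in>{j * m..<j * m + m}. f j)"
    by (intro prod.cong refl) (auto intro!: arg_cong[of _ _ f] div_nat_eqI simp: mult.commute)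
  finally show ?thesis by simp
qed

lemma prod_list_map_upt: "(\<Prod>x\<leftarrow>map f [0..<n]. g x) = (\<Prod>k<n. g (f k))"
  by (induction n) (simp_all add: mult.commute lessThan_Suc)

lemma prod_list_zip_map_upt:
  assumes "length \<pi> = n"
  shows "(\<Prod>(u, j)\<leftarrow>zip (map f [0..<n]) \<pi>. g u j) = (\<Prod>k<n. g (f k) (\<pi> ! k))"
proof -
  have "zip (map f [0..<n]) \<pi> = map (\<lambda>k. (f k, \<pi> ! k)) [0..<n]"
    using assms by (intro nth_equalityI) auto
  then show ?thesis using prod_list_map_upt[of "\<lambda>k. g (f k) (\<pi> ! k)" "\<lambda>k. k" n]
    by (simp add: comp_def)
qed

context circular_gaussian
begin

lemma R_sym: "R i j = R j i"
  using AA[of i j] AA[of j i] by (simp add: mult.commute)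

text \<open>The Schur product theorem for an indexed product of covariance kernels. One factor at a
  time is written as an expectation of A A, and the values of A are absorbed into the coefficients
  g; this is why g is arbitrary in the induction.\<close>

lemma R_prod_psd:
  assumes "finite I" "finite J"
  shows "0 \<le> (\<Sum>x\<in>I. \<Sum>y\<in>I. g x * g y * (\<Prod>k\<in>J. R (u x k) (u y k)))"
  using assms(2)
proof (induction J arbitrary: g rule: finite_induct)
  case empty
  have "(\<Sum>x\<in>I. \<Sum>y\<in>I. g x * g y) = (\<Sum>x\<in>I. g x) * (\<Sum>x\<in>I. g x)"
    by (simp add: sum_product)
  then show ?case by simp
next
  case (insert k J)
  let ?P = "\<lambda>x y. \<Prod>k\<in>J. R (u x k) (u y k)"
  have I: "integrable M (\<lambda>\<omega>. A i \<omega> * A j \<omega>)" for i j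
    by (intro all_moments_integrable all_moments_mult L_moments A_in)
  have "(\<Sum>x\<in>I. \<Sum>y\<in>I. g x * g y * (\<Prod>k\<in>insert k J. R (u x k) (u y k))) =
    (\<Sum>x\<in>I. \<Sum>y\<in>I. g x * g y * ?P x y * expectation (\<lambda>\<omega>. A (u x k) \<omega> * A (u y k) \<omega>))"
    using insert.hyps by (simp add: AA mult_ac)
  also have "\<dots> = expectation (\<lambda>\<omega>. \<Sum>x\<in>I. \<Sum>y\<in>I. g x * g y * ?P x y * (A (u x k) \<omega> * A (u y k) \<omega>))"
    using I by (simp add: Bochner_Integration.integral_sum)
  also have "0 \<le> \<dots>"
  proof (rule Bochner_Integration.integral_nonneg)
    fix \<omega>
    have "0 \<le> (\<Sum>x\<in>I. \<Sum>y\<in>I. (g x * A (u x k) \<omega>) * (g y * A (u y k) \<omega>) * ?P x y)"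
      by (rule insert.IH)
    then show "0 \<le> (\<Sum>x\<in>I. \<Sum>y\<in>I. g x * g y * ?P x y * (A (u x k) \<omega> * A (u y k) \<omega>))"
      by (simp add: mult_ac)
  qed
  finally show ?case .
qed

text \<open>Cauchy--Schwarz for the positive semidefinite product kernel, applied to \<open>u\<close> and its
  rearrangement \<open>u \<circ> \<sigma>\<close>, which have the same energy.\<close>

lemma R_prod_rearrange_le:
  assumes "finite I" and \<sigma>: "bij_betw \<sigma> J J" and "finite J"
  shows "(\<Sum>x\<in>I. \<Sum>y\<in>I. g x * g y * (\<Prod>k\<in>J. R (u x k) (u y (\<sigma> k)))) \<le>
    (\<Sum>x\<in>I. \<Sum>y\<in>I. g x * g y * (\<Prod>k\<in>J. R (u x k) (u y k)))"
proof -
  define T where "T v w = (\<Sum>x\<in>I. \<Sum>y\<in>I. g x * g y * (\<Prod>k\<in>J. R (v x k) (w y k)))" for v w :: "'b \<Rightarrow> 'c \<Rightarrow> 'i"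
  define u' where "u' x k = u x (\<sigma> k)" for x k
  have same: "T u' u' = T u u"
    unfolding T_def u'_def
  proof (intro sum.cong refl arg_cong2[where f = "(*)"])
    fix x y
    show "(\<Prod>k\<in>J. R (u x (\<sigma> k)) (u y (\<sigma> k))) = (\<Prod>k\<in>J. R (u x k) (u y k))"
      using prod.reindex_bij_betw[OF \<sigma>, of "\<lambda>k. R (u x k) (u y k)"] .
  qed
  have sym: "T u' u = T u u'"
    unfolding T_def by (subst sum.swap) (simp add: R_sym mult_ac)
  \<comment> \<open>The index set is doubled: one copy carries u with sign +, the other the
    rearranged u' with sign -. Positivity of the doubled form reads T u u - T u u' - T u' u + T u'
    u' >= 0.\<close>
  define G where "G p = (if snd p then - g (fst p) else g (fst p))" for p :: "'b \<times> bool"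
  define U where "U p = (if snd p then u' (fst p) else u (fst p))" for p :: "'b \<times> bool"
  have "0 \<le> (\<Sum>p\<in>I \<times> UNIV. \<Sum>r\<in>I \<times> UNIV. G p * G r * (\<Prod>k\<in>J. R (U p k) (U r k)))"
    by (rule R_prod_psd) (use assms in auto)
  also have "\<dots> = (\<Sum>x\<in>I. \<Sum>b\<in>UNIV. \<Sum>y\<in>I. \<Sum>c\<in>UNIV. G (x, b) * G (y, c) * (\<Prod>k\<in>J. R (U (x, b) k) (U (y, c) k)))"
    by (simp add: sum.cartesian_product')
  also have "\<dots> = T u u - T u u' - T u' u + T u' u'"
    unfolding T_def G_def U_def UNIV_bool
    by (simp add: sum.distrib sum_negf sum_subtractf)
  finally have "T u u' \<le> T u u" using same sym by simp
  then show ?thesis unfolding T_def u'_def .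
qed

text \<open>Writing the even power of the modulus as P^q times its conjugate and expanding both
  gives a sum over pairs of index functions and over permutations of the qm slots. Each permutation
  is dominated by the identity, for which the sum over index functions is a product of q equal
  double sums.\<close>

lemma Z_chaos_moment_le:
  assumes T: "finite T"
  shows "expectation (\<lambda>x. norm (\<Sum>t\<in>T. of_real (b t) * Z t x ^ m) ^ (2 * q)) \<le>
    2 ^ (q * m) * fact (q * m) * (\<Sum>s\<in>T. \<Sum>t\<in>T. b s * b t * R s t ^ m) ^ q"
proof -
  let ?K = "q * m"
  define I where "I = PiE {..<q} (\<lambda>_. T)"
  have I: "finite I" unfolding I_def using T by (intro finite_PiE) auto
  \<comment> \<open>There are qm slots, m for each of the q factors: slot k carries the variable of
    factor \<open>k div m\<close>.\<close>
  define w where "w g k = (g (k div m) :: 'i)" for g k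
  define b' where "b' g = (\<Prod>j<q. b (g j))" for g
  define P where "P x = (\<Sum>t\<in>T. of_real (b t) * Z t x ^ m)" for x
  have Pq: "P x ^ q = (\<Sum>g\<in>I. of_real (b' g) * (\<Prod>k<?K. Z (w g k) x))" for x
  proof -
    have "P x ^ q = (\<Prod>j<q. \<Sum>t\<in>T. of_real (b t) * Z t x ^ m)" by (simp add: P_def)
    also have "\<dots> = (\<Sum>g\<in>I. \<Prod>j<q. of_real (b (g j)) * Z (g j) x ^ m)"
      unfolding I_def by (rule prod_sum_PiE) (use T in auto)
    also have "\<dots> = (\<Sum>g\<in>I. of_real (b' g) * (\<Prod>k<?K. Z (w g k) x))"
    proof (rule sum.cong[OF refl])
      fix g
      have "(\<Prod>k<?K. Z (w g k) x) = (\<Prod>j<q. Z (g j) x ^ m)"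
        unfolding w_def by (rule prod_nat_div_group)
      then show "(\<Prod>j<q. of_real (b (g j)) * Z (g j) x ^ m) = of_real (b' g) * (\<Prod>k<?K. Z (w g k) x)"
        by (simp add: prod.distrib b'_def)
    qed
    finally show ?thesis .
  qed
  have n2: "complex_of_real (norm (P x) ^ (2 * q)) =
    (\<Sum>g\<in>I. \<Sum>h\<in>I. of_real (b' g * b' h) * ((\<Prod>k<?K. Z (w g k) x) * (\<Prod>k<?K. cnj (Z (w h k) x))))" for x
  proof -
    have "complex_of_real (norm (P x) ^ (2 * q)) = complex_of_real ((norm (P x))\<^sup>2) ^ q"
      by (simp add: power_mult)
    also have "\<dots> = P x ^ q * cnj (P x ^ q)"
      unfolding complex_norm_square power_mult_distrib by simp
    also have "\<dots> = (\<Sum>g\<in>I. of_real (b' g) * (\<Prod>k<?K. Z (w g k) x)) * (\<Sum>h\<in>I. of_real (b' h) * (\<Prod>k<?K. cnj (Z (w h k) x)))"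
      unfolding Pq by simp
    finally show ?thesis by (simp add: sum_product mult_ac)
  qed
  have int: "integrable M (\<lambda>x. (\<Prod>k<?K. Z (w g k) x) * (\<Prod>k<?K. cnj (Z (w h k) x)))" for g h
    by (intro all_moments_integrable all_moments_mult all_moments_prod all_moments_cnj all_moments_Z)
  define e where "e g h = 2 ^ ?K * (\<Sum>\<pi>\<in>permutations_of_set {..<?K}. \<Prod>k<?K. R (w g k) (w h (\<pi> ! k)))" for g h
  have E: "(\<integral>x. (\<Prod>k<?K. Z (w g k) x) * (\<Prod>k<?K. cnj (Z (w h k) x)) \<partial>M) = of_real (e g h)" for g h
  proof -
    have "(\<integral>x. (\<Prod>k<?K. Z (w g k) x) * (\<Prod>k<?K. cnj (Z (w h k) x)) \<partial>M) =
      of_real (2 ^ ?K * (\<Sum>\<pi>\<in>permutations_of_set {..<?K}. \<Prod>(u, j)\<leftarrow>zip (map (w g) [0..<?K]) \<pi>. R u (w h j)))"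
      using Z_prod_expectation[of "{..<?K}" "map (w g) [0..<?K]" "w h"]
      by (simp only: prod_list_map_upt) simp
    also have "(\<Sum>\<pi>\<in>permutations_of_set {..<?K}. \<Prod>(u, j)\<leftarrow>zip (map (w g) [0..<?K]) \<pi>. R u (w h j)) =
      (\<Sum>\<pi>\<in>permutations_of_set {..<?K}. \<Prod>k<?K. R (w g k) (w h (\<pi> ! k)))"
      by (intro sum.cong refl prod_list_zip_map_upt)
        (simp add: length_finite_permutations_of_set)
    finally show ?thesis by (simp add: e_def)
  qed
  have "complex_of_real (expectation (\<lambda>x. norm (P x) ^ (2 * q))) =
    (\<integral>x. (\<Sum>g\<in>I. \<Sum>h\<in>I. of_real (b' g * b' h) * ((\<Prod>k<?K. Z (w g k) x) * (\<Prod>k<?K. cnj (Z (w h k) x)))) \<partial>M)"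
    unfolding n2[symmetric] integral_complex_of_real ..
  also have "\<dots> = (\<Sum>g\<in>I. \<Sum>h\<in>I. of_real (b' g * b' h) * of_real (e g h))"
    using int by (simp add: Bochner_Integration.integral_sum E)
  also have "\<dots> = of_real (\<Sum>g\<in>I. \<Sum>h\<in>I. b' g * b' h * e g h)" by simp
  finally have "expectation (\<lambda>x. norm (P x) ^ (2 * q)) = (\<Sum>g\<in>I. \<Sum>h\<in>I. b' g * b' h * e g h)"
    using of_real_eq_iff by blast
  also have "\<dots> = 2 ^ ?K * (\<Sum>g\<in>I. \<Sum>h\<in>I. \<Sum>\<pi>\<in>permutations_of_set {..<?K}. b' g * b' h * (\<Prod>k<?K. R (w g k) (w h (\<pi> ! k))))"
    unfolding e_def by (simp add: sum_distrib_left mult_ac)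
  also have "(\<Sum>g\<in>I. \<Sum>h\<in>I. \<Sum>\<pi>\<in>permutations_of_set {..<?K}. b' g * b' h * (\<Prod>k<?K. R (w g k) (w h (\<pi> ! k)))) =
    (\<Sum>\<pi>\<in>permutations_of_set {..<?K}. \<Sum>g\<in>I. \<Sum>h\<in>I. b' g * b' h * (\<Prod>k<?K. R (w g k) (w h (\<pi> ! k))))"
    by (rule trans[OF sum.cong[OF refl sum.swap] sum.swap])
  also have "2 ^ ?K * \<dots> \<le> 2 ^ ?K * (\<Sum>\<pi>\<in>permutations_of_set {..<?K}. \<Sum>g\<in>I. \<Sum>h\<in>I. b' g * b' h * (\<Prod>k<?K. R (w g k) (w h k)))"
  proof (rule mult_left_mono, rule sum_mono, rule R_prod_rearrange_le[OF I])
    fix \<pi> assume "\<pi> \<in> permutations_of_set {..<?K}"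
    note \<pi> = permutations_of_setD[OF this] length_finite_permutations_of_set[OF this]
    show "bij_betw ((!) \<pi>) {..<?K} {..<?K}"
      by (rule bij_betw_nth) (simp_all add: \<pi>)
  qed simp_all
  also have "\<dots> = 2 ^ ?K * fact ?K * (\<Sum>g\<in>I. \<Sum>h\<in>I. b' g * b' h * (\<Prod>k<?K. R (w g k) (w h k)))"
    by simp
  also have "(\<Sum>g\<in>I. \<Sum>h\<in>I. b' g * b' h * (\<Prod>k<?K. R (w g k) (w h k))) =
    (\<Sum>g\<in>I. \<Sum>h\<in>I. \<Prod>j<q. b (g j) * b (h j) * R (g j) (h j) ^ m)"
  proof (rule sum.cong[OF refl], rule sum.cong[OF refl])
    fix g h
    have "(\<Prod>k<?K. R (w g k) (w h k)) = (\<Prod>j<q. R (g j) (h j) ^ m)"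
      unfolding w_def by (rule prod_nat_div_group)
    then show "b' g * b' h * (\<Prod>k<?K. R (w g k) (w h k)) = (\<Prod>j<q. b (g j) * b (h j) * R (g j) (h j) ^ m)"
      by (simp add: prod.distrib b'_def)
  qed
  also have "\<dots> = (\<Sum>g\<in>I. \<Prod>j<q. \<Sum>t\<in>T. b (g j) * b t * R (g j) t ^ m)"
    unfolding I_def by (intro sum.cong refl prod_sum_PiE[symmetric]) (use T in auto)
  also have "\<dots> = (\<Prod>j<q. \<Sum>s\<in>T. \<Sum>t\<in>T. b s * b t * R s t ^ m)"
    unfolding I_def by (intro prod_sum_PiE[symmetric]) (use T in auto)
  finally show ?thesis unfolding P_def by simp
qed

end

section \<open>Independent copies on the product space\<close>

lemma (in prob_space) all_moments_fst:
  fixes f :: "'a \<Rightarrow> 'c::{real_normed_field,second_countable_topology,banach}"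
  assumes "all_moments M f" shows "all_moments (M \<Otimes>\<^sub>M M) (\<lambda>p. f (fst p))"
proof -
  have [measurable]: "f \<in> borel_measurable M" using assms by (rule all_moments_measurable)
  have "integrable (distr (M \<Otimes>\<^sub>M M) M fst) (\<lambda>x. norm (f x) ^ k)" for k
    using assms unfolding distr_pair_fst all_moments_def by blast
  then have "integrable (M \<Otimes>\<^sub>M M) (\<lambda>p. norm (f (fst p)) ^ k)" for k
    by (subst (asm) integrable_distr_eq) simp_all
  then show ?thesis unfolding all_moments_def by simp
qed

lemma (in prob_space) all_moments_snd:
  fixes f :: "'a \<Rightarrow> 'c::{real_normed_field,second_countable_topology,banach}"
  assumes "all_moments M f" shows "all_moments (M \<Otimes>\<^sub>M M) (\<lambda>p. f (snd p))"
proof -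
  interpret P: pair_sigma_finite M M ..
  have [measurable]: "f \<in> borel_measurable M" using assms by (rule all_moments_measurable)
  have "integrable (M \<Otimes>\<^sub>M M) (\<lambda>p. norm (f (fst p)) ^ k)" for k
    using all_moments_fst[OF assms] unfolding all_moments_def by blast
  from P.integrable_product_swap[OF this]
  have "integrable (M \<Otimes>\<^sub>M M) (\<lambda>p. norm (f (snd p)) ^ k)" for k
    by (simp add: case_prod_beta')
  then show ?thesis unfolding all_moments_def by simp
qed

context gaussian_space
begin

text \<open>Meant for Fubini on the product space: the constant c stands for the other coordinate,
  frozen.\<close>

lemma gaussian_shift_moment:
  assumes U: "U \<in> L"
  shows "expectation (\<lambda>x. U x * (U x + c) ^ Suc n) =
    real (Suc n) * expectation (\<lambda>x. (U x)\<^sup>2) * expectation (\<lambda>x. (U x + c) ^ n)"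
proof -
  let ?\<kappa> = "\<lambda>w. complex_of_real (expectation (\<lambda>x. U x * w x))"
  let ?F = "\<lambda>x. complex_of_real (U x) + of_real c"
  have w: "wick ?\<kappa> ?F (\<lambda>_. ?\<kappa> U + 0)"
    by (rule wick_add[OF wick_lin[OF U] wick_const])
  have "complex_of_real (expectation (\<lambda>x. U x * (U x + c) ^ Suc n)) = (\<integral>x. of_real (U x) * ?F x ^ Suc n \<partial>M)"
    by (simp flip: integral_complex_of_real)
  also have "\<dots> = (\<integral>x. of_nat (Suc n) * ?F x ^ (Suc n - 1) * (?\<kappa> U + 0) \<partial>M)"
    by (rule wick_expectation_real[OF U wick_power[OF w]])
  also have "\<dots> = (\<integral>x. complex_of_real (real (Suc n) * expectation (\<lambda>x. (U x)\<^sup>2) * (U x + c) ^ n) \<partial>M)"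
    by (intro Bochner_Integration.integral_cong refl) (simp add: power2_eq_square)
  also have "\<dots> = of_real (real (Suc n) * expectation (\<lambda>x. (U x)\<^sup>2) * expectation (\<lambda>x. (U x + c) ^ n))"
    unfolding integral_complex_of_real by simp
  finally show ?thesis using of_real_eq_iff by blast
qed

definition L_pair :: "('a \<times> 'a \<Rightarrow> real) set" where
  "L_pair = {\<lambda>p. U (fst p) + V (snd p) |U V. U \<in> L \<and> V \<in> L}"

lemma L_pairI: "U \<in> L \<Longrightarrow> V \<in> L \<Longrightarrow> W = (\<lambda>p. U (fst p) + V (snd p)) \<Longrightarrow> W \<in> L_pair"
  unfolding L_pair_def by blast

text \<open>For the moment recursion one factor of W is split into its two coordinates. Each part is
  integrated in its own variable with the other one fixed, which yields the two variances
  separately, and these add up to the variance of W.\<close>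

lemma gaussian_space_pair: "gaussian_space (M \<Otimes>\<^sub>M M) L_pair"
proof -
  interpret PS: pair_sigma_finite M M ..
  interpret P: prob_space "M \<Otimes>\<^sub>M M" by (intro prob_space_pair prob_space_axioms)
  show ?thesis
  proof
    fix V W assume "V \<in> L_pair" "W \<in> L_pair"
    then obtain V1 V2 W1 W2 where "V1 \<in> L" "V2 \<in> L" "W1 \<in> L" "W2 \<in> L"
      and e: "V = (\<lambda>p. V1 (fst p) + V2 (snd p))" "W = (\<lambda>p. W1 (fst p) + W2 (snd p))"
      unfolding L_pair_def by blast
    then have "(\<lambda>x. V1 x + W1 x) \<in> L" "(\<lambda>x. V2 x + W2 x) \<in> L" using L_add by blast+
    moreover have "(\<lambda>x. V x + W x) = (\<lambda>p. (\<lambda>x. V1 x + W1 x) (fst p) + (\<lambda>x. V2 x + W2 x) (snd p))"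
      by (simp add: e algebra_simps)
    ultimately show "(\<lambda>x. V x + W x) \<in> L_pair" by (rule L_pairI)
  next
    fix W and c :: real assume "W \<in> L_pair"
    then obtain W1 W2 where "W1 \<in> L" "W2 \<in> L" and e: "W = (\<lambda>p. W1 (fst p) + W2 (snd p))"
      unfolding L_pair_def by blast
    then have "(\<lambda>x. c * W1 x) \<in> L" "(\<lambda>x. c * W2 x) \<in> L" using L_scale by blast+
    moreover have "(\<lambda>x. c * W x) = (\<lambda>p. (\<lambda>x. c * W1 x) (fst p) + (\<lambda>x. c * W2 x) (snd p))"
      by (simp add: e distrib_left)
    ultimately show "(\<lambda>x. c * W x) \<in> L_pair" by (rule L_pairI)
  next
    fix W assume "W \<in> L_pair"
    then obtain U V where U: "U \<in> L" and V: "V \<in> L" and W: "W = (\<lambda>p. U (fst p) + V (snd p))"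
      unfolding L_pair_def by blast
    have mU: "all_moments (M \<Otimes>\<^sub>M M) (\<lambda>p. U (fst p))" and mV: "all_moments (M \<Otimes>\<^sub>M M) (\<lambda>p. V (snd p))"
      by (intro all_moments_fst all_moments_snd L_moments U V)+
    show mW: "all_moments (M \<Otimes>\<^sub>M M) W" unfolding W by (intro all_moments_add mU mV)
    note am = all_moments_mult P.all_moments_power mU mV mW
    have F: "P.expectation f = (\<integral>y. \<integral>x. f (x, y) \<partial>M \<partial>M)" "P.expectation f = (\<integral>x. \<integral>y. f (x, y) \<partial>M \<partial>M)"
      if "all_moments (M \<Otimes>\<^sub>M M) f" for f :: "'a \<times> 'a \<Rightarrow> real"
      using PS.integral_fst'[OF all_moments_integrable[OF that]]
        PS.integral_snd[of "\<lambda>x y. f (x, y)"] all_moments_integrable[OF that] by simp_all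
    have "P.expectation (\<lambda>p. U (fst p)) = 0" "P.expectation (\<lambda>p. V (snd p)) = 0"
      unfolding F(2)[OF mU] F(2)[OF mV] using L_mean[OF U] L_mean[OF V] by (simp_all add: prob_space)
    then show "P.expectation W = 0"
      unfolding W using all_moments_integrable[OF mU] all_moments_integrable[OF mV] by simp
    have EU: "P.expectation (\<lambda>p. U (fst p) * W p ^ Suc n) = real (Suc n) * expectation (\<lambda>x. (U x)\<^sup>2) * P.expectation (\<lambda>p. W p ^ n)" for n
    proof -
      have "P.expectation (\<lambda>p. U (fst p) * W p ^ Suc n) = (\<integral>y. \<integral>x. U x * (U x + V y) ^ Suc n \<partial>M \<partial>M)"
        by (subst F(1)) (intro am, simp add: W)
      also have "\<dots> = real (Suc n) * expectation (\<lambda>x. (U x)\<^sup>2) * (\<integral>y. \<integral>x. (U x + V y) ^ n \<partial>M \<partial>M)"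
        unfolding gaussian_shift_moment[OF U] by simp
      also have "(\<integral>y. \<integral>x. (U x + V y) ^ n \<partial>M \<partial>M) = P.expectation (\<lambda>p. W p ^ n)"
        by (subst F(1)) (intro am, simp add: W)
      finally show ?thesis .
    qed
    have EV: "P.expectation (\<lambda>p. V (snd p) * W p ^ Suc n) = real (Suc n) * expectation (\<lambda>x. (V x)\<^sup>2) * P.expectation (\<lambda>p. W p ^ n)" for n
    proof -
      have "P.expectation (\<lambda>p. V (snd p) * W p ^ Suc n) = (\<integral>x. \<integral>y. V y * (V y + U x) ^ Suc n \<partial>M \<partial>M)"
        by (subst F(2)) (intro am, simp add: W add.commute)
      also have "\<dots> = real (Suc n) * expectation (\<lambda>x. (V x)\<^sup>2) * (\<integral>x. \<integral>y. (V y + U x) ^ n \<partial>M \<partial>M)"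
        unfolding gaussian_shift_moment[OF V] by simp
      also have "(\<integral>x. \<integral>y. (V y + U x) ^ n \<partial>M \<partial>M) = P.expectation (\<lambda>p. W p ^ n)"
        by (subst F(2)) (intro am, simp add: W add.commute)
      finally show ?thesis .
    qed
    have S: "P.expectation (\<lambda>p. W p ^ Suc (Suc n)) =
      real (Suc n) * (expectation (\<lambda>x. (U x)\<^sup>2) + expectation (\<lambda>x. (V x)\<^sup>2)) * P.expectation (\<lambda>p. W p ^ n)" for n
    proof -
      have "integrable (M \<Otimes>\<^sub>M M) (\<lambda>p. U (fst p) * W p ^ Suc n)" "integrable (M \<Otimes>\<^sub>M M) (\<lambda>p. V (snd p) * W p ^ Suc n)"
        by (intro all_moments_integrable am)+
      then have "P.expectation (\<lambda>p. U (fst p) * W p ^ Suc n + V (snd p) * W p ^ Suc n) =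
        P.expectation (\<lambda>p. U (fst p) * W p ^ Suc n) + P.expectation (\<lambda>p. V (snd p) * W p ^ Suc n)"
        by simp
      moreover have "(\<lambda>p. U (fst p) * W p ^ Suc n + V (snd p) * W p ^ Suc n) = (\<lambda>p. W p ^ Suc (Suc n))"
        unfolding distrib_right[symmetric] by (simp add: W)
      ultimately show ?thesis unfolding EU EV by (simp add: algebra_simps)
    qed
    have "P.expectation (\<lambda>p. (W p)\<^sup>2) = expectation (\<lambda>x. (U x)\<^sup>2) + expectation (\<lambda>x. (V x)\<^sup>2)"
      using S[of 0] by (simp add: numeral_2_eq_2 P.prob_space)
    with S show "P.expectation (\<lambda>p. W p ^ Suc (Suc n)) =
      real (Suc n) * P.expectation (\<lambda>p. (W p)\<^sup>2) * P.expectation (\<lambda>p. W p ^ n)" for n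
      by simp
  qed
qed

text \<open>Hypercontractivity for even moments: \<open>hermite m (X t)\<close> is the conditional mean of
  \<open>(X t + \<i> X' t) ^ m\<close> for an independent copy \<open>X'\<close>, so by Jensen's inequality it suffices to
  bound the moments of a polynomial in a circular complex Gaussian family.\<close>

lemma hermite_chaos_moment_le:
  fixes X :: "'i \<Rightarrow> 'a \<Rightarrow> real"
  assumes X: "\<And>i. X i \<in> L" and X1: "\<And>i. expectation (\<lambda>x. (X i x)\<^sup>2) = 1" and T: "finite T"
  shows "expectation (\<lambda>x. (\<Sum>t\<in>T. b t * hermite m (X t x)) ^ (2 * q)) \<le>
    2 ^ (q * m) * fact (q * m) * (\<Sum>s\<in>T. \<Sum>t\<in>T. b s * b t * expectation (\<lambda>x. X s x * X t x) ^ m) ^ q"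
proof -
  interpret PS: pair_sigma_finite M M ..
  interpret P: gaussian_space "M \<Otimes>\<^sub>M M" L_pair by (rule gaussian_space_pair)
  define A B where "A i p = X i (fst p)" and "B i p = X i (snd p)" for i and p :: "'a \<times> 'a"
  define R where "R i j = expectation (\<lambda>x. X i x * X j x)" for i j
  have z: "(\<lambda>_. 0) \<in> L" using zero_in_L[OF X] .
  have F: "P.expectation f = (\<integral>x. \<integral>y. f (x, y) \<partial>M \<partial>M)"
    if "all_moments (M \<Otimes>\<^sub>M M) f" for f :: "'a \<times> 'a \<Rightarrow> real"
    using PS.integral_fst'[OF all_moments_integrable[OF that]] by simp
  have mA: "all_moments (M \<Otimes>\<^sub>M M) (A i)" and mB: "all_moments (M \<Otimes>\<^sub>M M) (B i)" for i
    unfolding A_def[abs_def] B_def[abs_def] by (intro all_moments_fst all_moments_snd L_moments X)+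
  interpret C: circular_gaussian "M \<Otimes>\<^sub>M M" L_pair A B R
  proof
    show "A i \<in> L_pair" for i
      by (rule L_pairI[OF X[of i] z]) (simp add: A_def fun_eq_iff)
    show "B i \<in> L_pair" for i
      by (rule L_pairI[OF z X[of i]]) (simp add: B_def fun_eq_iff)
    show "P.expectation (\<lambda>x. A i x * A j x) = R i j" for i j
      by (subst F, intro all_moments_mult mA) (simp add: A_def R_def prob_space)
    show "P.expectation (\<lambda>x. B i x * B j x) = R i j" for i j
      by (subst F, intro all_moments_mult mB) (simp add: B_def R_def prob_space)
    show "P.expectation (\<lambda>x. A i x * B j x) = 0" for i j
      by (subst F, intro all_moments_mult mA mB) (simp add: A_def B_def L_mean[OF X])
  qed
  define Q where "Q p = (\<Sum>t\<in>T. of_real (b t) * C.Z t p ^ m)" for p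
  define y where "y x = (\<Sum>t\<in>T. b t * hermite m (X t x))" for x
  have my: "all_moments M y"
    unfolding y_def[abs_def] by (intro all_moments_sum all_moments_cmult all_moments_hermite X)
  have mQ: "all_moments (M \<Otimes>\<^sub>M M) Q"
    unfolding Q_def[abs_def] by (intro P.all_moments_sum all_moments_cmult P.all_moments_power C.all_moments_Z)
  have ZQ: "C.Z t (x, x') = of_real (X t x) + \<i> * of_real (X t x')" for t x x'
    by (simp add: C.Z_def A_def B_def)
  have mZ: "all_moments M (\<lambda>x'. C.Z t (x, x'))" for t x
    unfolding ZQ by (intro all_moments_add all_moments_cmult all_moments_of_real L_moments X all_moments_const)
  have mQx: "all_moments M (\<lambda>x'. Q (x, x'))" for x
    unfolding Q_def by (intro all_moments_sum all_moments_cmult all_moments_power mZ)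
  have yQ: "complex_of_real (y x) = (\<integral>x'. Q (x, x') \<partial>M)" for x
  proof -
    have "integrable M (\<lambda>x'. C.Z t (x, x') ^ m)" for t
      by (intro all_moments_integrable all_moments_power mZ)
    then have "(\<integral>x'. Q (x, x') \<partial>M) = (\<Sum>t\<in>T. of_real (b t) * (\<integral>x'. C.Z t (x, x') ^ m \<partial>M))"
      unfolding Q_def by (simp add: Bochner_Integration.integral_sum)
    also have "\<dots> = of_real (y x)"
      unfolding ZQ hermite_complex_expectation[OF X X1] y_def by simp
    finally show ?thesis by simp
  qed
  have jensen: "y x ^ (2 * q) \<le> (\<integral>x'. norm (Q (x, x')) ^ (2 * q) \<partial>M)" for x
  proof -
    have I: "integrable M (\<lambda>x'. norm (Q (x, x')) ^ k)" for k using mQx unfolding all_moments_def by blast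
    have "\<bar>y x\<bar> = norm (\<integral>x'. Q (x, x') \<partial>M)" unfolding yQ[symmetric] by simp
    also have "\<dots> \<le> expectation (\<lambda>x'. norm (Q (x, x')))" by (rule integral_norm_bound)
    finally have "\<bar>y x\<bar> ^ (2 * q) \<le> expectation (\<lambda>x'. norm (Q (x, x'))) ^ (2 * q)"
      by (intro power_mono) auto
    also have "\<dots> \<le> expectation (\<lambda>x'. norm (Q (x, x')) ^ (2 * q))"
      using I[of 1] by (intro jensens_inequality[where I = UNIV and q = "\<lambda>x. x ^ (2 * q)"] I convex_power_even) auto
    finally show ?thesis by (simp add: power_even_abs)
  qed
  have IQ: "integrable (M \<Otimes>\<^sub>M M) (\<lambda>p. norm (Q p) ^ (2 * q))" using mQ unfolding all_moments_def by blast
  have "expectation (\<lambda>x. y x ^ (2 * q)) \<le> (\<integral>x. \<integral>x'. norm (Q (x, x')) ^ (2 * q) \<partial>M \<partial>M)"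
    by (intro integral_mono jensen PS.integrable_fst'[OF IQ] all_moments_integrable all_moments_power my)
  also have "\<dots> = P.expectation (\<lambda>p. norm (Q p) ^ (2 * q))"
    by (rule PS.integral_fst'[OF IQ])
  also have "\<dots> \<le> 2 ^ (q * m) * fact (q * m) * (\<Sum>s\<in>T. \<Sum>t\<in>T. b s * b t * R s t ^ m) ^ q"
    unfolding Q_def by (rule C.Z_chaos_moment_le[OF T])
  finally show ?thesis unfolding y_def R_def .
qed

end

section \<open>Reduction to the leading chaos\<close>

lemma square_integrable_add:
  assumes "square_integrable M f" "square_integrable M g"
  shows "square_integrable M (\<lambda>x. f x + g x)"
  unfolding square_integrable_def
proof
  have fg[measurable]: "f \<in> borel_measurable M" "g \<in> borel_measurable M"
    using assms by (auto simp: square_integrable_def)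
  show "(\<lambda>x. f x + g x) \<in> borel_measurable M" by measurable
  show "integrable M (\<lambda>x. (f x + g x)\<^sup>2)"
  proof (rule Bochner_Integration.integrable_bound)
    show "integrable M (\<lambda>x. 2 * (f x)\<^sup>2 + 2 * (g x)\<^sup>2)"
      using assms by (auto simp: square_integrable_def)
    have "(f x + g x)\<^sup>2 \<le> 2 * (f x)\<^sup>2 + 2 * (g x)\<^sup>2" for x
      using sum_squares_bound[of "f x" "g x"] by (simp add: power2_sum)
    then show "AE x in M. norm ((f x + g x)\<^sup>2) \<le> norm (2 * (f x)\<^sup>2 + 2 * (g x)\<^sup>2)" by simp
  qed measurable
qed

lemma square_integrable_cmult:
  "square_integrable M f \<Longrightarrow> square_integrable M (\<lambda>x. c * f x)"
  by (auto simp: square_integrable_def power_mult_distrib)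

lemma square_integrable_diff:
  assumes "square_integrable M f" "square_integrable M g"
  shows "square_integrable M (\<lambda>x. f x - g x)"
  using square_integrable_add[OF assms(1) square_integrable_cmult[OF assms(2), of "-1"]] by simp

lemma square_integrable_sum:
  assumes "\<And>i. i \<in> I \<Longrightarrow> square_integrable M (f i)"
  shows "square_integrable M (\<lambda>x. \<Sum>i\<in>I. f i x)"
  using assms
proof (induction I rule: infinite_finite_induct)
  case (insert i I)
  then show ?case using square_integrable_add[of M "f i" "\<lambda>x. \<Sum>i\<in>I. f i x"] by simp
qed (simp_all add: square_integrable_def)

lemma all_moments_square_integrable:
  fixes f :: "'a \<Rightarrow> real"
  assumes "all_moments M f" shows "square_integrable M f"
proof -
  have "f \<in> borel_measurable M" "integrable M (\<lambda>x. norm (f x) ^ 2)"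
    using assms unfolding all_moments_def by blast+
  then show ?thesis by (simp add: square_integrable_def)
qed

lemma expectation_square_add_le:
  assumes "square_integrable M f" "square_integrable M g" "square_integrable M h"
    and "\<And>x. h x = f x + g x"
  shows "(\<integral>x. (h x)\<^sup>2 \<partial>M) \<le> 2 * (\<integral>x. (f x)\<^sup>2 \<partial>M) + 2 * (\<integral>x. (g x)\<^sup>2 \<partial>M)"
proof -
  have "(\<integral>x. (h x)\<^sup>2 \<partial>M) \<le> (\<integral>x. 2 * (f x)\<^sup>2 + 2 * (g x)\<^sup>2 \<partial>M)"
  proof (rule integral_mono)
    show "(h x)\<^sup>2 \<le> 2 * (f x)\<^sup>2 + 2 * (g x)\<^sup>2" for x
      unfolding assms(4) using sum_squares_bound[of "f x" "g x"] by (simp add: power2_sum)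
  qed (use assms(1-3) in \<open>auto simp: square_integrable_def\<close>)
  also have "\<dots> = 2 * (\<integral>x. (f x)\<^sup>2 \<partial>M) + 2 * (\<integral>x. (g x)\<^sup>2 \<partial>M)"
    using assms(1,2) by (simp add: square_integrable_def)
  finally show ?thesis .
qed

lemma (in prob_space) square_integrable_integrable:
  assumes "square_integrable M f" shows "integrable M f"
  using assms unfolding square_integrable_def by (blast intro: square_integrable_imp_integrable)

lemma (in prob_space) expectation_square_le:
  assumes "square_integrable M f"
  shows "(expectation f)\<^sup>2 \<le> expectation (\<lambda>x. (f x)\<^sup>2)"
proof -
  have "0 \<le> variance f" by simp
  also have "\<dots> = expectation (\<lambda>x. (f x)\<^sup>2) - (expectation f)\<^sup>2"
    using assms square_integrable_integrable[OF assms]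
    by (intro variance_eq) (auto simp: square_integrable_def)
  finally show ?thesis by simp
qed

text \<open>The numbers \<open>c q\<close> stand for J_q / q!. The expansion of G enters only
  through \<open>err\<close>, which bounds the truncation error at every time because all variables
  have the same law. Index 0 is included in the assumptions on single variables but not in the
  covariance formula.\<close>

locale hermite_sum = gaussian_space M L + long_memory a \<rho> \<alpha> d m
  for M :: "'a measure" and L a \<rho> \<alpha> d m +
  fixes X :: "nat \<Rightarrow> 'a \<Rightarrow> real" and G :: "real \<Rightarrow> real" and c err :: "nat \<Rightarrow> real"
  assumes X_in: "\<And>t. X t \<in> L" and X_var: "\<And>t. expectation (\<lambda>\<omega>. (X t \<omega>)\<^sup>2) = 1"
    and X_cov: "\<And>s t. s \<ge> 1 \<Longrightarrow> t \<ge> 1 \<Longrightarrow> expectation (\<lambda>\<omega>. X s \<omega> * X t \<omega>) = \<rho> (lag s t)"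
    and G_sq: "\<And>t. square_integrable M (\<lambda>\<omega>. G (X t \<omega>))"
    and err: "\<And>t N. expectation (\<lambda>\<omega>. (G (X t \<omega>) - (\<Sum>q=m..N. c q * hermite q (X t \<omega>)))\<^sup>2) \<le> err N"
    and err_lim: "err \<longlonglongrightarrow> 0" and c_m: "c m \<noteq> 0"
begin

definition Y where "Y q I \<omega> = (\<Sum>t\<in>I. a t * hermite q (X t \<omega>))"
definition S where "S I \<omega> = (\<Sum>t\<in>I. a t * G (X t \<omega>))"
definition P where "P Q I \<omega> = (\<Sum>q\<in>Q. c q * Y q I \<omega>)"

lemma Y_all_moments: "all_moments M (Y q I)"
  unfolding Y_def[abs_def] by (intro all_moments_sum all_moments_cmult all_moments_hermite X_in)

lemma Y_sq: "square_integrable M (Y q I)"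
  by (intro all_moments_square_integrable Y_all_moments)

lemma S_sq: "square_integrable M (S I)"
  unfolding S_def[abs_def] by (intro square_integrable_sum square_integrable_cmult G_sq)

lemma P_sq: "square_integrable M (P Q I)"
  unfolding P_def[abs_def] by (intro square_integrable_sum square_integrable_cmult Y_sq)

lemma Y_product:
  assumes I: "I \<subseteq> {1..}"
  shows "expectation (\<lambda>\<omega>. Y p I \<omega> * Y q I \<omega>) = (if p = q then fact p * V p I else 0)"
proof -
  have int: "integrable M (\<lambda>\<omega>. hermite p (X s \<omega>) * hermite q (X t \<omega>))" for s t
    by (intro all_moments_integrable all_moments_mult all_moments_hermite X_in)
  have "expectation (\<lambda>\<omega>. Y p I \<omega> * Y q I \<omega>) =
    expectation (\<lambda>\<omega>. \<Sum>s\<in>I. \<Sum>t\<in>I. a s * a t * (hermite p (X s \<omega>) * hermite q (X t \<omega>)))"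
    unfolding Y_def sum_product by (intro Bochner_Integration.integral_cong sum.cong refl) simp
  also have "\<dots> = (\<Sum>s\<in>I. \<Sum>t\<in>I. a s * a t * expectation (\<lambda>\<omega>. hermite p (X s \<omega>) * hermite q (X t \<omega>)))"
    using int by (simp add: Bochner_Integration.integral_sum)
  also have "\<dots> = (\<Sum>s\<in>I. \<Sum>t\<in>I. a s * a t * (if p = q then fact p * \<rho> (lag s t) ^ p else 0))"
  proof (intro sum.cong refl)
    fix s t assume "s \<in> I" "t \<in> I"
    then have "s \<ge> 1" "t \<ge> 1" using I by auto
    then show "a s * a t * expectation (\<lambda>\<omega>. hermite p (X s \<omega>) * hermite q (X t \<omega>)) =
      a s * a t * (if p = q then fact p * \<rho> (lag s t) ^ p else 0)"
      using hermite_covariance[OF X_in X_in X_var X_var, of p s q t] X_cov by simp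
  qed
  also have "\<dots> = (if p = q then fact p * V p I else 0)"
    by (simp add: V_def sum_distrib_left mult_ac)
  finally show ?thesis .
qed

text \<open>Not visible from the formula, whose terms may have either sign: up to p! it is a second
  moment.\<close>

lemma V_nonneg:
  assumes I: "I \<subseteq> {1..}" shows "0 \<le> V p I"
proof -
  have "0 \<le> expectation (\<lambda>\<omega>. Y p I \<omega> * Y p I \<omega>)" by simp
  then have *: "0 \<le> fact p * V p I" unfolding Y_product[OF I] by simp
  show ?thesis
  proof (rule ccontr)
    assume "\<not> ?thesis"
    then have "fact p * V p I < 0" by (intro mult_pos_neg) auto
    with * show False by simp
  qed
qed

lemma P_square:
  assumes I: "I \<subseteq> {1..}" and Q: "finite Q"
  shows "expectation (\<lambda>\<omega>. (P Q I \<omega>)\<^sup>2) = (\<Sum>q\<in>Q. (c q)\<^sup>2 * fact q * V q I)"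
proof -
  have int: "integrable M (\<lambda>\<omega>. Y p I \<omega> * Y q I \<omega>)" for p q
    by (intro all_moments_integrable all_moments_mult Y_all_moments)
  have "expectation (\<lambda>\<omega>. (P Q I \<omega>)\<^sup>2) = expectation (\<lambda>\<omega>. \<Sum>p\<in>Q. \<Sum>q\<in>Q. c p * c q * (Y p I \<omega> * Y q I \<omega>))"
    unfolding P_def power2_eq_square sum_product by (intro Bochner_Integration.integral_cong sum.cong refl) simp
  also have "\<dots> = (\<Sum>p\<in>Q. \<Sum>q\<in>Q. c p * c q * expectation (\<lambda>\<omega>. Y p I \<omega> * Y q I \<omega>))"
    using int by (simp add: Bochner_Integration.integral_sum)
  also have "\<dots> = (\<Sum>p\<in>Q. \<Sum>q\<in>Q. if p = q then c p * c p * (fact p * V p I) else 0)"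
    unfolding Y_product[OF I] by (intro sum.cong refl) auto
  also have "\<dots> = (\<Sum>q\<in>Q. (c q)\<^sup>2 * fact q * V q I)"
    using Q by (simp add: power2_eq_square mult_ac)
  finally show ?thesis .
qed

text \<open>The Cauchy-Schwarz factor \<open>card I\<close> is crude but sufficient: the index set
  stays fixed while N tends to infinity.\<close>

lemma P_error:
  assumes I: "finite I"
  shows "expectation (\<lambda>\<omega>. (S I \<omega> - P {m..N} I \<omega>)\<^sup>2) \<le> real (card I) * (\<Sum>t\<in>I. (a t)\<^sup>2) * err N"
proof -
  define e where "e t \<omega> = G (X t \<omega>) - (\<Sum>q=m..N. c q * hermite q (X t \<omega>))" for t \<omega>
  have e_sq: "square_integrable M (e t)" for t
    unfolding e_def[abs_def]
    by (intro square_integrable_diff square_integrable_sum square_integrable_cmult G_sq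
      all_moments_square_integrable all_moments_hermite X_in)
  have eq: "S I \<omega> - P {m..N} I \<omega> = (\<Sum>t\<in>I. a t * e t \<omega>)" for \<omega>
  proof -
    have "P {m..N} I \<omega> = (\<Sum>t\<in>I. a t * (\<Sum>q=m..N. c q * hermite q (X t \<omega>)))"
      unfolding P_def Y_def sum_distrib_left by (subst sum.swap) (simp add: mult_ac)
    then show ?thesis by (simp add: S_def e_def right_diff_distrib sum_subtractf)
  qed
  have "expectation (\<lambda>\<omega>. (S I \<omega> - P {m..N} I \<omega>)\<^sup>2) \<le> expectation (\<lambda>\<omega>. real (card I) * (\<Sum>t\<in>I. (a t)\<^sup>2 * (e t \<omega>)\<^sup>2))"
  proof (rule integral_mono)
    show "integrable M (\<lambda>\<omega>. (S I \<omega> - P {m..N} I \<omega>)\<^sup>2)"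
      using square_integrable_diff[OF S_sq P_sq] by (simp add: square_integrable_def)
    show "integrable M (\<lambda>\<omega>. real (card I) * (\<Sum>t\<in>I. (a t)\<^sup>2 * (e t \<omega>)\<^sup>2))"
      using e_sq by (auto simp: square_integrable_def)
    fix \<omega>
    have "(\<Sum>t\<in>I. a t * e t \<omega>)\<^sup>2 \<le> (\<Sum>t\<in>I. (a t * e t \<omega>)\<^sup>2) * (\<Sum>t\<in>I. 1\<^sup>2)"
      using Cauchy_Schwarz_ineq_sum[of "\<lambda>t. a t * e t \<omega>" "\<lambda>_. 1" I] by simp
    then show "(S I \<omega> - P {m..N} I \<omega>)\<^sup>2 \<le> real (card I) * (\<Sum>t\<in>I. (a t)\<^sup>2 * (e t \<omega>)\<^sup>2)"
      unfolding eq by (simp add: power_mult_distrib mult.commute)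
  qed
  also have "\<dots> = real (card I) * (\<Sum>t\<in>I. (a t)\<^sup>2 * expectation (\<lambda>\<omega>. (e t \<omega>)\<^sup>2))"
    using e_sq by (simp add: square_integrable_def Bochner_Integration.integral_sum)
  also have "\<dots> \<le> real (card I) * (\<Sum>t\<in>I. (a t)\<^sup>2 * err N)"
    unfolding e_def by (intro mult_left_mono sum_mono err) auto
  finally show ?thesis by (simp add: mult.assoc sum_distrib_right)
qed

lemma P_error_lim:
  "(\<lambda>N. real (card I) * (\<Sum>t\<in>I. (a t)\<^sup>2) * err N) \<longlonglongrightarrow> 0"
  using tendsto_mult_right_zero[OF err_lim] .

text \<open>Every chaos of order at least 1 is centered, and the mean is continuous in mean square.
  Hence the variance of the sum is its second moment.\<close>

lemma expectation_S:
  assumes I: "I \<subseteq> {1..}" "finite I"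
  shows "expectation (S I) = 0"
proof -
  have EP: "expectation (P {m..N} I) = 0" for N
  proof -
    have H: "expectation (\<lambda>\<omega>. hermite q (X t \<omega>)) = 0" if "q \<ge> 1" for q t
      using hermite_covariance[OF X_in X_in X_var X_var, of q t 0 t] that by simp
    have "integrable M (\<lambda>\<omega>. hermite q (X t \<omega>))" for q t
      by (intro all_moments_integrable all_moments_hermite X_in)
    then have "expectation (P {m..N} I) = (\<Sum>q\<in>{m..N}. c q * (\<Sum>t\<in>I. a t * expectation (\<lambda>\<omega>. hermite q (X t \<omega>))))"
      unfolding P_def[abs_def] Y_def[abs_def] by (simp add: Bochner_Integration.integral_sum)
    also have "\<dots> = 0" using H m by (intro sum.neutral) auto
    finally show ?thesis .
  qed
  have "(expectation (S I))\<^sup>2 \<le> real (card I) * (\<Sum>t\<in>I. (a t)\<^sup>2) * err N" for N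
  proof -
    have "expectation (S I) = expectation (\<lambda>\<omega>. S I \<omega> - P {m..N} I \<omega>)"
      using square_integrable_integrable[OF S_sq] square_integrable_integrable[OF P_sq] EP by simp
    then show ?thesis
      using order_trans[OF expectation_square_le[OF square_integrable_diff[OF S_sq P_sq]] P_error[OF I(2)]] by simp
  qed
  then have "(expectation (S I))\<^sup>2 \<le> 0"
    by (intro LIMSEQ_le_const[OF P_error_lim[of I]]) auto
  then show ?thesis by simp
qed

text \<open>By orthogonality the leading chaos contributes no more than the whole truncated
  expansion. The factor 2 is the price of comparing the truncation with the sum through (f + g)^2 <=
  2 f^2 + 2 g^2.\<close>

lemma S_square_ge:
  assumes I: "I \<subseteq> {1..}" "finite I"
  shows "(c m)\<^sup>2 * fact m * V m I \<le> 2 * expectation (\<lambda>\<omega>. (S I \<omega>)\<^sup>2)"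
proof -
  let ?e = "\<lambda>N. real (card I) * (\<Sum>t\<in>I. (a t)\<^sup>2) * err N"
  have "(c m)\<^sup>2 * fact m * V m I \<le> 2 * expectation (\<lambda>\<omega>. (S I \<omega>)\<^sup>2) + 2 * ?e N" if N: "N \<ge> m" for N
  proof -
    have "(c m)\<^sup>2 * fact m * V m I \<le> (\<Sum>q\<in>{m..N}. (c q)\<^sup>2 * fact q * V q I)"
      using N V_nonneg[OF I(1)] by (intro member_le_sum) auto
    also have "\<dots> = expectation (\<lambda>\<omega>. (P {m..N} I \<omega>)\<^sup>2)" using P_square[OF I(1)] by simp
    also have "\<dots> \<le> 2 * expectation (\<lambda>\<omega>. (S I \<omega>)\<^sup>2) + 2 * expectation (\<lambda>\<omega>. (-1 * (S I \<omega> - P {m..N} I \<omega>))\<^sup>2)"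
      by (rule expectation_square_add_le[OF S_sq square_integrable_cmult[OF square_integrable_diff[OF S_sq P_sq]] P_sq]) simp
    also have "\<dots> \<le> 2 * expectation (\<lambda>\<omega>. (S I \<omega>)\<^sup>2) + 2 * ?e N"
      using P_error[OF I(2), of N] by (simp add: power2_commute)
    finally show ?thesis .
  qed
  then have ex: "\<exists>N. \<forall>n\<ge>N. (c m)\<^sup>2 * fact m * V m I \<le> 2 * expectation (\<lambda>\<omega>. (S I \<omega>)\<^sup>2) + 2 * ?e n" by blast
  have "(\<lambda>N. 2 * expectation (\<lambda>\<omega>. (S I \<omega>)\<^sup>2) + 2 * ?e N) \<longlonglongrightarrow> 2 * expectation (\<lambda>\<omega>. (S I \<omega>)\<^sup>2) + 2 * 0"
    by (rule tendsto_add[OF tendsto_const tendsto_mult_left[OF P_error_lim]])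
  from LIMSEQ_le_const[OF this ex] show ?thesis by simp
qed

text \<open>Bessel's inequality up to a constant, read off from a sum with a single term: at one
  time \<open>t0\<close> of nonzero weight, V equals the squared weight for every order, so the
  second moment of the truncation is a multiple of the coefficient sum.\<close>

lemma coefficient_sum_bounded:
  obtains K where "K > 0" "\<And>N. (\<Sum>q=m..N. (c q)\<^sup>2 * fact q) \<le> K"
proof -
  obtain t0 :: nat where t0': "t0 \<ge> 1" "\<And>n. n \<ge> t0 \<Longrightarrow> a n > 0"
    by (rule regular_seq_posE[OF a_regular]) (rule that; assumption)
  have t0: "t0 \<ge> 1" "a t0 > 0" using t0'(1) t0'(2)[OF order_refl] by simp_all
  have V1: "V p {t0} = (a t0)\<^sup>2" for p by (simp add: V_def lag_def \<rho>0 power2_eq_square)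
  have I: "{t0} \<subseteq> {1..}" using t0 by simp
  obtain Ke where Ke: "Ke > 0" "\<And>N. \<bar>err N\<bar> \<le> Ke"
  proof -
    have "Bseq err" using err_lim by (intro convergent_imp_Bseq convergentI)
    then obtain K where "K > 0" "\<forall>n. norm (err n) \<le> K" unfolding Bseq_def by blast
    then show ?thesis using that[of K] by simp
  qed
  define E where "E = expectation (\<lambda>\<omega>. (S {t0} \<omega>)\<^sup>2)"
  have "(a t0)\<^sup>2 * (\<Sum>q=m..N. (c q)\<^sup>2 * fact q) \<le> 2 * E + 2 * ((a t0)\<^sup>2 * Ke)" for N
  proof -
    have "(a t0)\<^sup>2 * (\<Sum>q=m..N. (c q)\<^sup>2 * fact q) = expectation (\<lambda>\<omega>. (P {m..N} {t0} \<omega>)\<^sup>2)"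
      using P_square[OF I, of "{m..N}"] by (simp add: V1 sum_distrib_left mult_ac)
    also have "\<dots> \<le> 2 * E + 2 * expectation (\<lambda>\<omega>. (-1 * (S {t0} \<omega> - P {m..N} {t0} \<omega>))\<^sup>2)"
      unfolding E_def
      by (rule expectation_square_add_le[OF S_sq square_integrable_cmult[OF square_integrable_diff[OF S_sq P_sq]] P_sq]) simp
    also have "\<dots> \<le> 2 * E + 2 * ((a t0)\<^sup>2 * err N)"
      using P_error[of "{t0}" N] by (simp add: power2_commute)
    also have "\<dots> \<le> 2 * E + 2 * ((a t0)\<^sup>2 * Ke)"
      using Ke(2)[of N] by (simp add: mult_left_mono)
    finally show ?thesis .
  qed
  then have b: "(\<Sum>q=m..N. (c q)\<^sup>2 * fact q) * (a t0)\<^sup>2 \<le> 2 * E + 2 * ((a t0)\<^sup>2 * Ke)" for N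
    by (simp only: mult.commute)
  define Kb where "Kb = (2 * E + 2 * ((a t0)\<^sup>2 * Ke)) / (a t0)\<^sup>2"
  have pos: "0 < (a t0)\<^sup>2" using t0(2) by simp
  have b': "(\<Sum>q=m..N. (c q)\<^sup>2 * fact q) \<le> Kb" for N
    unfolding Kb_def pos_le_divide_eq[OF pos] by (rule b)
  show ?thesis
  proof (rule that[of "\<bar>Kb\<bar> + 1"])
    show "(\<Sum>q=m..N. (c q)\<^sup>2 * fact q) \<le> \<bar>Kb\<bar> + 1" for N
      by (rule order_trans[OF b']) simp
  qed simp
qed

lemma W_mono: "p \<le> q \<Longrightarrow> W q I \<le> W p I"
  unfolding W_def using \<rho>_le_1 by (intro sum_mono mult_left_mono power_decreasing) auto

definition R where "R I \<omega> = S I \<omega> - c m * Y m I \<omega>"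

lemma R_sq: "square_integrable M (R I)"
  unfolding R_def[abs_def] by (intro square_integrable_diff square_integrable_cmult S_sq Y_sq)

text \<open>After truncation the remainder is an orthogonal sum over orders q > m. Each V of order q
  is at most W of order m + 1, the coefficients are summable, and the truncation error vanishes in
  the limit.\<close>

lemma R_square_le:
  obtains K where "K > 0"
    "\<And>I. I \<subseteq> {1..} \<Longrightarrow> finite I \<Longrightarrow> expectation (\<lambda>\<omega>. (R I \<omega>)\<^sup>2) \<le> K * W (Suc m) I"
proof -
  obtain K where K: "K > 0" "\<And>N. (\<Sum>q=m..N. (c q)\<^sup>2 * fact q) \<le> K" using coefficient_sum_bounded by blast
  show ?thesis
  proof (rule that[of "2 * K"])
    fix I :: "nat set" assume I: "I \<subseteq> {1..}" "finite I"
    let ?e = "\<lambda>N. real (card I) * (\<Sum>t\<in>I. (a t)\<^sup>2) * err N"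
    have W0: "W (Suc m) I \<ge> 0" unfolding W_def by (intro sum_nonneg) auto
    have "expectation (\<lambda>\<omega>. (R I \<omega>)\<^sup>2) \<le> 2 * ?e N + 2 * K * W (Suc m) I" if N: "N \<ge> m" for N
    proof -
      have P: "P {m..N} I \<omega> = c m * Y m I \<omega> + P {Suc m..N} I \<omega>" for \<omega>
        unfolding P_def using N by (simp add: sum.atLeast_Suc_atMost)
      have "expectation (\<lambda>\<omega>. (R I \<omega>)\<^sup>2) \<le> 2 * expectation (\<lambda>\<omega>. (S I \<omega> - P {m..N} I \<omega>)\<^sup>2) + 2 * expectation (\<lambda>\<omega>. (P {Suc m..N} I \<omega>)\<^sup>2)"
        by (rule expectation_square_add_le[OF square_integrable_diff[OF S_sq P_sq] P_sq R_sq]) (simp add: R_def P)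
      also have "expectation (\<lambda>\<omega>. (P {Suc m..N} I \<omega>)\<^sup>2) = (\<Sum>q\<in>{Suc m..N}. (c q)\<^sup>2 * fact q * V q I)"
        by (rule P_square[OF I(1)]) simp
      also have "\<dots> \<le> (\<Sum>q\<in>{Suc m..N}. (c q)\<^sup>2 * fact q * W (Suc m) I)"
      proof (intro sum_mono mult_left_mono)
        fix q assume "q \<in> {Suc m..N}"
        then show "V q I \<le> W (Suc m) I" using order_trans[OF V_le_W W_mono, of "Suc m" q I] by simp
      qed auto
      also have "\<dots> \<le> (\<Sum>q\<in>{m..N}. (c q)\<^sup>2 * fact q * W (Suc m) I)"
        using W0 by (intro sum_mono2) auto
      also have "\<dots> \<le> K * W (Suc m) I"
        unfolding sum_distrib_right[symmetric] by (intro mult_right_mono K(2) W0)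
      finally show ?thesis using P_error[OF I(2), of N] by simp
    qed
    then have ex: "\<exists>N. \<forall>n\<ge>N. expectation (\<lambda>\<omega>. (R I \<omega>)\<^sup>2) \<le> 2 * ?e n + 2 * K * W (Suc m) I" by blast
    have "(\<lambda>N. 2 * ?e N + 2 * K * W (Suc m) I) \<longlonglongrightarrow> 2 * 0 + 2 * K * W (Suc m) I"
      by (rule tendsto_add[OF tendsto_mult_left[OF P_error_lim] tendsto_const])
    from LIMSEQ_le_const[OF this ex] show "expectation (\<lambda>\<omega>. (R I \<omega>)\<^sup>2) \<le> 2 * K * W (Suc m) I" by simp
  qed (use K in simp)
qed

text \<open>The lower bound for V concerns indices beyond \<open>n0\<close> only. The first
  \<open>n0\<close> terms have a fixed second moment, which is eventually negligible because D tends
  to infinity.\<close>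

lemma variance_lower:
  obtains k N where "k > 0" "\<And>n. n \<ge> N \<Longrightarrow> k * D n \<le> variance (S {0<..n})"
proof -
  obtain k0 n0 N0 where k0: "k0 > 0" "\<And>n. n \<ge> N0 \<Longrightarrow> k0 * D n \<le> V m {n0<..n}" by (rule V_lower) (rule that; assumption)
  \<comment> \<open>The factor 4 leaves at least k0 D / 4 for the full sum after two applications of
    (f + g)^2 <= 2 f^2 + 2 g^2; the bound \<open>S_square_ge\<close> then halves the constant once
    more, to k0 / 8.\<close>
  have "eventually (\<lambda>n. 4 / k0 * V m {0<..n0} \<le> D n) sequentially"
    using D_at_top unfolding filterlim_at_top by blast
  then obtain N1 where N1: "\<And>n. n \<ge> N1 \<Longrightarrow> 4 / k0 * V m {0<..n0} \<le> D n" unfolding eventually_sequentially by blast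
  have EY: "expectation (\<lambda>\<omega>. (Y m I \<omega>)\<^sup>2) = fact m * V m I" if "I \<subseteq> {1..}" for I
    using Y_product[OF that, of m m] by (simp add: power2_eq_square)
  show ?thesis
  proof (rule that[of "(c m)\<^sup>2 * fact m * k0 / 8" "max n0 (max N0 N1)"])
    show "0 < (c m)\<^sup>2 * fact m * k0 / 8" using c_m k0 by simp
    fix n assume n: "n \<ge> max n0 (max N0 N1)"
    have sub: "{0<..n} \<subseteq> {1..}" "{n0<..n} \<subseteq> {1..}" "{0<..n0} \<subseteq> {1..}" by auto
    have un: "{0<..n} = {0<..n0} \<union> {n0<..n}" using n by auto
    have "Y m {n0<..n} \<omega> = Y m {0<..n} \<omega> + (-1) * Y m {0<..n0} \<omega>" for \<omega>
      unfolding Y_def un by (subst sum.union_disjoint) auto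
    from expectation_square_add_le[OF Y_sq square_integrable_cmult[OF Y_sq] Y_sq this]
    have "fact m * V m {n0<..n} \<le> 2 * (fact m * V m {0<..n}) + 2 * (fact m * V m {0<..n0})"
      using EY[OF sub(1)] EY[OF sub(2)] EY[OF sub(3)] by simp
    then have "fact m * V m {n0<..n} \<le> fact m * (2 * V m {0<..n} + 2 * V m {0<..n0})"
      by (simp add: algebra_simps)
    then have "V m {n0<..n} \<le> 2 * V m {0<..n} + 2 * V m {0<..n0}"
      by (simp add: mult_le_cancel_left_pos)
    moreover have "4 * V m {0<..n0} \<le> k0 * D n"
    proof -
      have "4 / k0 * V m {0<..n0} \<le> D n" using n by (intro N1) simp
      from mult_left_mono[OF this, of k0] show ?thesis using k0(1) by simp
    qed
    moreover have "k0 * D n \<le> V m {n0<..n}" using n by (intro k0(2)) simp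
    ultimately have "k0 * D n / 4 \<le> V m {0<..n}" by linarith
    then have "(c m)\<^sup>2 * fact m * (k0 * D n / 4) \<le> (c m)\<^sup>2 * fact m * V m {0<..n}"
      by (intro mult_left_mono) auto
    also have "\<dots> \<le> 2 * expectation (\<lambda>\<omega>. (S {0<..n} \<omega>)\<^sup>2)" by (rule S_square_ge[OF sub(1)]) simp
    also have "expectation (\<lambda>\<omega>. (S {0<..n} \<omega>)\<^sup>2) = variance (S {0<..n})"
      using expectation_S[OF sub(1)] by simp
    finally show "(c m)\<^sup>2 * fact m * k0 / 8 * D n \<le> variance (S {0<..n})" by simp
  qed
qed

end

section \<open>Chaining over dyadic blocks\<close>

text \<open>The binary digits of l cut the interval into at most one dyadic block per scale. The
  offset p is arbitrary because the part left after removing a block starts at the next dyadic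
  point.\<close>

lemma dyadic_chain:
  fixes x lam :: "nat \<Rightarrow> real"
  assumes blk: "\<And>j i. j < K \<Longrightarrow> Suc i * 2 ^ j \<le> N \<Longrightarrow> \<bar>\<Sum>t\<in>{i * 2 ^ j<..i * 2 ^ j + 2 ^ j}. x t\<bar> \<le> lam j"
    and lam: "\<And>j. lam j \<ge> 0"
  shows "k \<le> K \<Longrightarrow> l < 2 ^ k \<Longrightarrow> p * 2 ^ k + l \<le> N \<Longrightarrow>
    \<bar>\<Sum>t\<in>{p * 2 ^ k<..p * 2 ^ k + l}. x t\<bar> \<le> (\<Sum>j<k. lam j)"
proof (induction k arbitrary: l p)
  case 0
  then show ?case by simp
next
  case (Suc k)
  show ?case
  proof (cases "l < 2 ^ k")
    case True
    have "\<bar>\<Sum>t\<in>{(2 * p) * 2 ^ k<..(2 * p) * 2 ^ k + l}. x t\<bar> \<le> (\<Sum>j<k. lam j)"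
      using Suc.prems True by (intro Suc.IH) (auto simp: mult_ac)
    also have "\<dots> \<le> (\<Sum>j<Suc k. lam j)" using lam[of k] by simp
    finally show ?thesis by (simp add: mult_ac)
  next
    case False
    define l' where "l' = l - 2 ^ k"
    have l': "l = 2 ^ k + l'" "l' < 2 ^ k" using False Suc.prems(2) by (auto simp: l'_def)
    have pk: "p * 2 ^ Suc k = (2 * p) * 2 ^ k" "Suc (2 * p) * 2 ^ k = (2 * p) * 2 ^ k + 2 ^ k" by simp_all
    have "{p * 2 ^ Suc k<..p * 2 ^ Suc k + l} =
      {(2 * p) * 2 ^ k<..(2 * p) * 2 ^ k + 2 ^ k} \<union> {Suc (2 * p) * 2 ^ k<..Suc (2 * p) * 2 ^ k + l'}"
      unfolding pk l'(1) by auto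
    then have "(\<Sum>t\<in>{p * 2 ^ Suc k<..p * 2 ^ Suc k + l}. x t) =
      (\<Sum>t\<in>{(2 * p) * 2 ^ k<..(2 * p) * 2 ^ k + 2 ^ k}. x t) + (\<Sum>t\<in>{Suc (2 * p) * 2 ^ k<..Suc (2 * p) * 2 ^ k + l'}. x t)"
      by (simp only:) (rule sum.union_disjoint, auto)
    moreover have "\<bar>\<Sum>t\<in>{(2 * p) * 2 ^ k<..(2 * p) * 2 ^ k + 2 ^ k}. x t\<bar> \<le> lam k"
      using Suc.prems l' by (intro blk) (auto simp: mult_ac)
    moreover have "\<bar>\<Sum>t\<in>{Suc (2 * p) * 2 ^ k<..Suc (2 * p) * 2 ^ k + l'}. x t\<bar> \<le> (\<Sum>j<k. lam j)"
      using Suc.prems l' by (intro Suc.IH) (auto simp: mult_ac)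
    ultimately show ?thesis by simp
  qed
qed

lemma (in prob_space) prob_gt_le_moment:
  fixes f :: "'a \<Rightarrow> real"
  assumes "integrable M (\<lambda>x. f x ^ (2 * q))" "lam > 0" "q \<ge> 1" "f \<in> borel_measurable M"
  shows "prob {x\<in>space M. lam < \<bar>f x\<bar>} \<le> expectation (\<lambda>x. f x ^ (2 * q)) / lam ^ (2 * q)"
proof -
  have [measurable]: "f \<in> borel_measurable M" by fact
  have "prob {x\<in>space M. lam < \<bar>f x\<bar>} \<le> prob {x\<in>space M. f x ^ (2 * q) \<ge> lam ^ (2 * q)}"
  proof (rule finite_measure_mono)
    show "{x\<in>space M. lam < \<bar>f x\<bar>} \<subseteq> {x\<in>space M. f x ^ (2 * q) \<ge> lam ^ (2 * q)}"
    proof safe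
      fix x assume "lam < \<bar>f x\<bar>"
      then have "lam ^ (2 * q) \<le> \<bar>f x\<bar> ^ (2 * q)" using assms(2) by (intro power_mono) auto
      then show "lam ^ (2 * q) \<le> f x ^ (2 * q)" by (simp add: power_even_abs)
    qed
  qed measurable
  also have "\<dots> \<le> expectation (\<lambda>x. f x ^ (2 * q)) / lam ^ (2 * q)"
    using assms by (intro integral_Markov_inequality_measure[where A = "{}"]) auto
  finally show ?thesis .
qed

lemma (in prob_space) block_maximal:
  fixes Z :: "nat \<Rightarrow> 'a \<Rightarrow> real" and lam :: "nat \<Rightarrow> nat \<Rightarrow> real"
  assumes Z[measurable]: "\<And>t. Z t \<in> borel_measurable M" and lam: "\<And>k j. lam k j \<ge> 0"
    and pr: "\<And>k. k \<ge> k0 \<Longrightarrow>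
      (\<Sum>j<k. \<Sum>i<2 ^ (k - j). prob {x\<in>space M. lam k j < \<bar>\<Sum>t\<in>{i * 2 ^ j<..i * 2 ^ j + 2 ^ j}. Z t x\<bar>}) \<le> pp k"
    and pp: "summable pp"
  shows "AE x in M. eventually (\<lambda>k. \<forall>l<2 ^ k. \<bar>\<Sum>t\<in>{0<..l}. Z t x\<bar> \<le> (\<Sum>j<k. lam k j)) sequentially"
proof -
  define b where "b k j i = {x\<in>space M. lam k j < \<bar>\<Sum>t\<in>{i * 2 ^ j<..i * 2 ^ j + 2 ^ j}. Z t x\<bar>}" for k j i :: nat
  have b[measurable]: "b k j i \<in> sets M" for k j i unfolding b_def by measurable
  \<comment> \<open>Empty below \<open>k0\<close>, where no probability bound is assumed; this does
    not affect the eventual statement.\<close>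
  define Bad where "Bad k = (if k < k0 then {} else \<Union>j<k. \<Union>i<2 ^ (k - j). b k j i)" for k
  have Bad: "Bad k \<in> sets M" for k unfolding Bad_def by auto
  have le: "measure M (Bad k) \<le> pp k" if "k \<ge> k0" for k
  proof -
    have "measure M (Bad k) \<le> (\<Sum>j<k. measure M (\<Union>i<2 ^ (k - j). b k j i))"
      using that unfolding Bad_def by (simp, intro measure_UNION_le) auto
    also have "\<dots> \<le> (\<Sum>j<k. \<Sum>i<2 ^ (k - j). measure M (b k j i))"
      by (intro sum_mono measure_UNION_le) auto
    also have "\<dots> \<le> pp k" using pr[OF that] unfolding b_def .
    finally show ?thesis .
  qed
  have "summable (\<lambda>k. measure M (Bad k))"
    by (rule summable_comparison_test'[OF pp, of k0]) (use le in auto)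
  then have "AE x in M. eventually (\<lambda>k. x \<in> space M - Bad k) sequentially"
    by (intro borel_cantelli_AE1 Bad) (auto simp: emeasure_eq_measure)
  then show ?thesis
  proof eventually_elim
    case (elim x)
    from elim eventually_ge_at_top[of k0] show ?case
    proof eventually_elim
      case (elim k)
      have blk: "\<bar>\<Sum>t\<in>{i * 2 ^ j<..i * 2 ^ j + 2 ^ j}. Z t x\<bar> \<le> lam k j" if ji: "j < k" "Suc i * 2 ^ j \<le> 2 ^ k" for j i
      proof -
        have "(2::nat) ^ k = 2 ^ (k - j) * 2 ^ j" using ji by (simp flip: power_add)
        with ji(2) have "Suc i * 2 ^ j \<le> 2 ^ (k - j) * 2 ^ j" by simp
        then have "Suc i \<le> 2 ^ (k - j)" by (rule mult_right_le_imp_le) simp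
        then have "i < 2 ^ (k - j)" by simp
        then have "x \<notin> b k j i" using elim ji unfolding Bad_def by auto
        then show ?thesis using elim unfolding b_def by auto
      qed
      show ?case
      proof (intro allI impI)
        fix l :: nat assume "l < 2 ^ k"
        then show "\<bar>\<Sum>t\<in>{0<..l}. Z t x\<bar> \<le> (\<Sum>j<k. lam k j)"
          using dyadic_chain[of k "2 ^ k" "\<lambda>t. Z t x" "lam k" k l 0, OF blk lam] by simp
      qed
    qed
  qed
qed

lemma sum_power_diff_le:
  fixes b :: real assumes "0 \<le> b" "b < 1"
  shows "(\<Sum>j<k. b ^ (k - j)) \<le> b / (1 - b)"
proof -
  have "(\<Sum>j<k. b ^ (k - j)) = (\<Sum>j<k. b ^ Suc j)"
    by (subst sum.nat_diff_reindex[symmetric]) (intro sum.cong refl, simp)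
  also have "\<dots> = b * (\<Sum>j<k. b ^ j)" by (simp add: sum_distrib_left)
  also have "\<dots> \<le> b * (1 / (1 - b))"
    using assms by (intro mult_left_mono) (auto simp: sum_gp_strict divide_right_mono)
  finally show ?thesis by simp
qed

section \<open>Maximal inequalities for the leading chaos and the remainder\<close>

context hermite_sum
begin

lemma D_pow_pos:
  obtains k0 where "\<And>k. k \<ge> k0 \<Longrightarrow> D (2 ^ k) > 0"
proof -
  obtain N where N: "\<And>n. n \<ge> N \<Longrightarrow> D n > 0" by (rule D_doubling) (rule that; assumption)
  show ?thesis
  proof (rule that[of N])
    fix k assume "k \<ge> N"
    then have "N \<le> 2 ^ k" using less_exp[of k] by linarith
    then show "D (2 ^ k) > 0" by (rule N)
  qed
qed

text \<open>The moment of order \<open>2 q\<close> with \<open>q \<approx> ln k\<close> balances the union bound over the scales \<open>2 ^ k\<close>.\<close>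

lemma Y_maximal:
  obtains C q0 where "q0 \<ge> (1::nat)" "C > 0"
    "AE \<omega> in M. eventually (\<lambda>k. \<forall>l<2 ^ k. \<bar>Y m {0<..l} \<omega>\<bar> \<le>
       C * sqrt (real (nat \<lceil>ln (real k)\<rceil> + q0) ^ m * D (2 ^ k))) sequentially"
proof -
  obtain K \<gamma> where K: "K > 0" "\<gamma> > 0"
    "\<And>i l n. 1 \<le> l \<Longrightarrow> i + l \<le> n \<Longrightarrow> V m {i<..i + l} \<le> K * (real l / real n) powr \<gamma> * D n"
    by (rule V_block_le) (rule that; assumption)
  obtain k0 where k0: "\<And>k. k \<ge> k0 \<Longrightarrow> D (2 ^ k) > 0" by (rule D_pow_pos) (rule that; assumption)
  \<comment> \<open>The variance of a block of relative length 2^(-u) carries the factor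
    2^(-\<gamma> u) = b^(4u). Half of the exponent goes into the squared threshold, making the
    chaining sum geometric; the other half remains for the probability.\<close>
  define b where "b = (2::real) powr (- (\<gamma> / 4))"
  have b: "0 < b" "b < 1" using K(2) by (auto simp: b_def powr_less_one)
  have "(\<lambda>n. b ^ n) \<longlonglongrightarrow> 0" using b by (intro LIMSEQ_power_zero) auto
  then have "eventually (\<lambda>n. b ^ n < 1 / 4) sequentially" by (rule order_tendstoD) simp
  then obtain n1 where n1: "\<And>n. n \<ge> n1 \<Longrightarrow> b ^ n < 1 / 4" unfolding eventually_sequentially by blast
  \<comment> \<open>Large enough that b^(2q) <= 1/4. At relative scale 2^(-u) the probability then
    carries 4^(-u), which beats the number 2^u of blocks.\<close>
  define q0 where "q0 = Suc n1"
  define q where "q k = nat \<lceil>ln (real k)\<rceil> + q0" for k :: nat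
  have q: "q k \<ge> 1" "b ^ (2 * q k) \<le> 1 / 4" for k
    using n1[of "2 * q k"] by (auto simp: q_def q0_def)
  define T where "T k = (2 * real (q k) * real m) ^ m * (K * D (2 ^ k))" for k
  have T0: "T k \<ge> 0" for k unfolding T_def using K D_nonneg by (intro mult_nonneg_nonneg) auto
  have Tpos: "T k > 0" if "k \<ge> k0" for k
    unfolding T_def using K k0[OF that] q(1)[of k] m by (intro mult_pos_pos zero_less_power) auto
  \<comment> \<open>The factor e in the threshold produces exp(-2q) in the moment bound. Since q is
    at least ln k, this is at most k^(-2), which is summable.\<close>
  define lam where "lam k j = exp 1 * sqrt (T k) * b ^ (k - j)" for k j
  have lam0: "lam k j \<ge> 0" for k j unfolding lam_def using T0 b by simp
  have blk: "prob {x\<in>space M. lam k j < \<bar>Y m {i * 2 ^ j<..i * 2 ^ j + 2 ^ j} x\<bar>} \<le> exp (- 2 * real (q k)) * (1 / 4) ^ (k - j)"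
    if k: "k \<ge> k0" and ji: "j < k" "i < 2 ^ (k - j)" for k j i
  proof -
    let ?I = "{i * 2 ^ j<..i * 2 ^ j + 2 ^ j}"
    let ?q = "q k" and ?u = "k - j"
    have kj: "(2::nat) ^ k = 2 ^ ?u * 2 ^ j" using ji by (simp flip: power_add)
    have "Suc i * 2 ^ j \<le> 2 ^ ?u * 2 ^ j" using ji(2) by (intro mult_right_mono) auto
    then have sub: "i * 2 ^ j + 2 ^ j \<le> 2 ^ k" unfolding kj by simp
    have bu: "(real (2 ^ j) / real (2 ^ k)) powr \<gamma> = b ^ (4 * ?u)"
    proof -
      have "real (2 ^ j) / real (2 ^ k) = 2 powr (- real ?u)"
        unfolding kj by (simp add: powr_minus powr_realpow field_simps)
      then have "(real (2 ^ j) / real (2 ^ k)) powr \<gamma> = 2 powr (- real ?u * \<gamma>)" by (simp add: powr_powr)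
      also have "\<dots> = b ^ (4 * ?u)"
        unfolding b_def by (simp add: powr_power mult_ac)
      finally show ?thesis .
    qed
    have V: "V m ?I \<le> K * b ^ (4 * ?u) * D (2 ^ k)"
      using K(3)[of "2 ^ j" "i * 2 ^ j" "2 ^ k"] sub unfolding bu by simp
    have V0: "0 \<le> V m ?I" by (rule V_nonneg) auto
    have Vs: "(\<Sum>s\<in>?I. \<Sum>t\<in>?I. a s * a t * expectation (\<lambda>x. X s x * X t x) ^ m) = V m ?I"
      unfolding V_def by (intro sum.cong refl) (simp add: X_cov)
    have "expectation (\<lambda>x. Y m ?I x ^ (2 * ?q)) \<le> 2 ^ (?q * m) * fact (?q * m) * V m ?I ^ ?q"
      using hermite_chaos_moment_le[of X ?I a m ?q, OF X_in X_var] unfolding Vs Y_def by simp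
    also have "\<dots> \<le> 2 ^ (?q * m) * real ((?q * m) ^ (?q * m)) * (K * b ^ (4 * ?u) * D (2 ^ k)) ^ ?q"
      using V V0 by (intro mult_mono power_mono fact_le_power) auto
    also have "\<dots> = T k ^ ?q * b ^ (4 * ?u * ?q)"
    proof -
      have e4: "b ^ (4 * ?u * ?q) = (b ^ (4 * ?u)) ^ ?q" by (rule power_mult)
      have e5: "(K * b ^ (4 * ?u) * D (2 ^ k)) ^ ?q = (K * D (2 ^ k)) ^ ?q * (b ^ (4 * ?u)) ^ ?q"
        by (simp only: power_mult_distrib mult_ac)
      have e6: "2 ^ (?q * m) * real ((?q * m) ^ (?q * m)) = ((2 * real ?q * real m) ^ m) ^ ?q"
        by (simp add: power_mult_distrib power_mult[symmetric] mult_ac)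
      show ?thesis unfolding T_def e5 e4 power_mult_distrib[of "(2 * real ?q * real m) ^ m"] e6[symmetric] by (simp only: mult.assoc)
    qed
    finally have E: "expectation (\<lambda>x. Y m ?I x ^ (2 * ?q)) \<le> T k ^ ?q * b ^ (4 * ?u * ?q)" .
    have l2: "lam k j ^ (2 * ?q) = exp (2 * real ?q) * T k ^ ?q * b ^ (2 * ?u * ?q)"
    proof -
      have "sqrt (T k) ^ (2 * ?q) = T k ^ ?q" using T0[of k] by (simp add: power_mult)
      moreover have "exp 1 ^ (2 * ?q) = exp (2 * real ?q)" by (simp flip: exp_of_nat_mult)
      ultimately show ?thesis unfolding lam_def by (simp add: power_mult_distrib power_mult[symmetric] mult_ac)
    qed
    have "prob {x\<in>space M. lam k j < \<bar>Y m ?I x\<bar>} \<le> expectation (\<lambda>x. Y m ?I x ^ (2 * ?q)) / lam k j ^ (2 * ?q)"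
    proof (rule prob_gt_le_moment)
      show "integrable M (\<lambda>x. Y m ?I x ^ (2 * ?q))"
        by (intro all_moments_integrable all_moments_power Y_all_moments)
      show "Y m ?I \<in> borel_measurable M" by (intro all_moments_measurable Y_all_moments)
      show "lam k j > 0" unfolding lam_def using Tpos[OF k] b by simp
    qed (rule q)
    also have "\<dots> \<le> (T k ^ ?q * b ^ (4 * ?u * ?q)) / lam k j ^ (2 * ?q)"
      using lam0 by (intro divide_right_mono E) auto
    also have "\<dots> = exp (- 2 * real ?q) * (b ^ (2 * ?q)) ^ ?u"
    proof -
      have "4 * ?u * ?q = 2 * ?u * ?q + 2 * ?u * ?q" by simp
      then have "b ^ (4 * ?u * ?q) = b ^ (2 * ?u * ?q) * b ^ (2 * ?u * ?q)" by (simp only: power_add)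
      moreover have "(b ^ (2 * ?q)) ^ ?u = b ^ (2 * ?u * ?q)" by (simp add: power_mult[symmetric] mult_ac)
      moreover have "exp (- 2 * real ?q) = 1 / exp (2 * real ?q)" by (simp add: exp_minus field_simps)
      ultimately show ?thesis unfolding l2 using Tpos[OF k] b by simp
    qed
    also have "\<dots> \<le> exp (- 2 * real ?q) * (1 / 4) ^ ?u"
      using q(2)[of k] b by (intro mult_left_mono power_mono) auto
    finally show ?thesis .
  qed
  have "AE x in M. eventually (\<lambda>k. \<forall>l<2 ^ k. \<bar>\<Sum>t\<in>{0<..l}. a t * hermite m (X t x)\<bar> \<le> (\<Sum>j<k. lam k j)) sequentially"
  proof (rule block_maximal[of _ lam "max 1 k0" "\<lambda>k. 1 / real k ^ 2"])
    show "(\<lambda>x. a t * hermite m (X t x)) \<in> borel_measurable M" for t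
      by (intro all_moments_measurable all_moments_cmult all_moments_hermite X_in)
    show "summable (\<lambda>k. 1 / real k ^ 2)"
      using inverse_power_summable[of 2, where ?'a = real] by (simp add: inverse_eq_divide)
    fix k assume k: "max 1 k0 \<le> k"
    have "(\<Sum>j<k. \<Sum>i<2 ^ (k - j). prob {x\<in>space M. lam k j < \<bar>\<Sum>t\<in>{i * 2 ^ j<..i * 2 ^ j + 2 ^ j}. a t * hermite m (X t x)\<bar>})
      \<le> (\<Sum>j<k. \<Sum>i<(2::nat) ^ (k - j). exp (- 2 * real (q k)) * (1 / 4) ^ (k - j))"
      using blk[unfolded Y_def] k by (intro sum_mono) auto
    also have "\<dots> = (\<Sum>j<k. exp (- 2 * real (q k)) * (1 / 2) ^ (k - j))"
    proof (intro sum.cong refl)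
      fix j
      have "(2::real) ^ (k - j) * (1 / 4) ^ (k - j) = (1 / 2) ^ (k - j)" by (simp flip: power_mult_distrib)
      then show "(\<Sum>i<(2::nat) ^ (k - j). exp (- 2 * real (q k)) * (1 / 4) ^ (k - j)) = exp (- 2 * real (q k)) * (1 / 2) ^ (k - j)"
        by simp
    qed
    also have "\<dots> = exp (- 2 * real (q k)) * (\<Sum>j<k. (1 / 2) ^ (k - j))" by (simp add: sum_distrib_left)
    also have "\<dots> \<le> exp (- 2 * real (q k)) * 1"
      using sum_power_diff_le[of "1 / 2" k] by (intro mult_left_mono) auto
    also have "\<dots> \<le> exp (- 2 * ln (real k))"
    proof -
      have "ln (real k) \<le> real (q k)" unfolding q_def by linarith
      then show ?thesis by simp
    qed
    also have "\<dots> = 1 / real k ^ 2"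
    proof -
      have "exp (- 2 * ln (real k)) = 1 / (exp (ln (real k)) * exp (ln (real k)))"
        by (simp flip: exp_add add: exp_minus field_simps)
      then show ?thesis using k by (simp add: power2_eq_square)
    qed
    finally show "(\<Sum>j<k. \<Sum>i<2 ^ (k - j). prob {x\<in>space M. lam k j < \<bar>\<Sum>t\<in>{i * 2 ^ j<..i * 2 ^ j + 2 ^ j}. a t * hermite m (X t x)\<bar>})
      \<le> 1 / real k ^ 2" .
  qed (rule lam0)
  then have ae: "AE x in M. eventually (\<lambda>k. \<forall>l<2 ^ k. \<bar>Y m {0<..l} x\<bar> \<le> (\<Sum>j<k. lam k j)) sequentially"
    unfolding Y_def .
  define C where "C = exp 1 * sqrt ((2 * real m) ^ m * K) * (b / (1 - b))"
  have sl: "(\<Sum>j<k. lam k j) \<le> C * sqrt (real (q k) ^ m * D (2 ^ k))" for k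
  proof -
    have "(\<Sum>j<k. lam k j) = exp 1 * sqrt (T k) * (\<Sum>j<k. b ^ (k - j))" by (simp add: lam_def sum_distrib_left)
    also have "\<dots> \<le> exp 1 * sqrt (T k) * (b / (1 - b))"
      using b T0 by (intro mult_left_mono sum_power_diff_le) auto
    also have "T k = ((2 * real m) ^ m * K) * (real (q k) ^ m * D (2 ^ k))"
      by (simp add: T_def power_mult_distrib mult_ac)
    finally show ?thesis by (simp add: C_def real_sqrt_mult mult_ac)
  qed
  show ?thesis
  proof (rule that[of q0 C])
    show "C > 0" unfolding C_def using K b m by (intro mult_pos_pos) auto
    show "AE \<omega> in M. eventually (\<lambda>k. \<forall>l<2 ^ k. \<bar>Y m {0<..l} \<omega>\<bar> \<le>
       C * sqrt (real (nat \<lceil>ln (real k)\<rceil> + q0) ^ m * D (2 ^ k))) sequentially"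
      using ae
    proof eventually_elim
      case (elim \<omega>)
      then show ?case
      proof eventually_elim
        case (elim k)
        then show ?case using sl[of k] unfolding q_def by (meson order_trans)
      qed
    qed
  qed (simp add: q0_def)
qed

lemma sum_blocks:
  fixes g :: "nat \<Rightarrow> real"
  shows "(\<Sum>i<n. \<Sum>t\<in>{i * l<..i * l + l}. g t) = (\<Sum>t\<in>{0<..n * l}. g t)"
proof -
  have shift: "(\<Sum>t\<in>{u<..v}. g t) = (\<Sum>t\<in>{u..<v}. g (Suc t))" for u v
    using sum.reindex[of Suc "{u..<v}" g] by (simp add: atLeastSucLessThan_greaterThanLessThan image_Suc_atLeastLessThan comp_def atLeastLessThanSuc_atLeastAtMost atLeastSucAtMost_greaterThanAtMost)
  have "(\<Sum>i<n. \<Sum>t\<in>{i * l<..i * l + l}. g t) = (\<Sum>t<n * l. g (Suc t))"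
    unfolding shift by (rule sum.nat_group)
  also have "\<dots> = (\<Sum>t\<in>{0<..n * l}. g t)" unfolding shift by (simp add: atLeast0LessThan)
  finally show ?thesis .
qed

text \<open>Second moments suffice here, since the remainder has a factor n^(-\<delta>) to spare.
  Equal thresholds at all k scales lose only factors k, and adding the blocks of one scale
  reproduces \<open>Al\<close> once, so that the number of blocks does not enter.\<close>

lemma R_maximal:
  obtains C where "C > 0"
    "AE \<omega> in M. eventually (\<lambda>k. \<forall>l<2 ^ k. \<bar>R {0<..l} \<omega>\<bar> \<le> C * sqrt (D (2 ^ k))) sequentially"
proof -
  obtain K1 where K1: "K1 > 0" "\<And>I. I \<subseteq> {1..} \<Longrightarrow> finite I \<Longrightarrow> expectation (\<lambda>\<omega>. (R I \<omega>)\<^sup>2) \<le> K1 * W (Suc m) I"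
    by (rule R_square_le) (rule that; assumption)
  obtain K2 \<delta> where K2: "K2 > 0" "\<delta> > 0" "\<And>i l n. i + l \<le> n \<Longrightarrow> 1 \<le> n \<Longrightarrow>
      W (Suc m) {i<..i + l} \<le> (\<Sum>s\<in>{i<..i + l}. (a s)\<^sup>2) * (K2 * real n powr (- \<delta>) * B n)"
    by (rule W_block_le) (rule that; assumption)
  obtain k0 where k0: "\<And>k. k \<ge> k0 \<Longrightarrow> D (2 ^ k) > 0" by (rule D_pow_pos) (rule that; assumption)
  \<comment> \<open>For n = 2^k the gain n^(-\<delta>) is y^(4k). Two of the four powers pay for the
    squared threshold, one absorbs the number k of scales, and the last makes the probabilities
    summable.\<close>
  define y where "y = (2::real) powr (- (\<delta> / 4))"
  have y: "0 < y" "y < 1" using K2(2) by (auto simp: y_def powr_less_one)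
  have nd: "real (2 ^ k) powr (- \<delta>) = y ^ (4 * k)" for k :: nat
    unfolding y_def by (simp add: powr_power powr_powr mult_ac flip: powr_realpow)
  have "(\<lambda>k. of_nat k * y ^ k) \<longlonglongrightarrow> 0" using y by (intro powser_times_n_limit_0) auto
  then have "Bseq (\<lambda>k. real k * y ^ k)" by (intro convergent_imp_Bseq convergentI)
  then obtain Cy where Cy: "Cy > 0" "\<And>k. \<bar>real k * y ^ k\<bar> \<le> Cy" unfolding Bseq_def by auto
  have ky: "real k * y ^ k \<le> Cy" for k using Cy(2)[of k] y by simp
  define lam where "lam k (j::nat) = sqrt (D (2 ^ k)) * y ^ k" for k j
  have lam0: "lam k j \<ge> 0" for k j unfolding lam_def using D_nonneg y by simp
  have blk: "prob {x\<in>space M. lam k j < \<bar>R {i * 2 ^ j<..i * 2 ^ j + 2 ^ j} x\<bar>} \<le>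
      (\<Sum>s\<in>{i * 2 ^ j<..i * 2 ^ j + 2 ^ j}. (a s)\<^sup>2) * (K1 * K2 * y ^ (2 * k) * B (2 ^ k) / D (2 ^ k))"
    if k: "k \<ge> k0" and ji: "j < k" "i < 2 ^ (k - j)" for k j i
  proof -
    let ?I = "{i * 2 ^ j<..i * 2 ^ j + 2 ^ j}"
    have kj: "(2::nat) ^ k = 2 ^ (k - j) * 2 ^ j" using ji by (simp flip: power_add)
    have "Suc i * 2 ^ j \<le> 2 ^ (k - j) * 2 ^ j" using ji(2) by (intro mult_right_mono) auto
    then have sub: "i * 2 ^ j + 2 ^ j \<le> 2 ^ k" unfolding kj by simp
    have E: "expectation (\<lambda>\<omega>. (R ?I \<omega>)\<^sup>2) \<le> K1 * ((\<Sum>s\<in>?I. (a s)\<^sup>2) * (K2 * y ^ (4 * k) * B (2 ^ k)))"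
    proof (rule order_trans[OF K1(2)])
      have "W (Suc m) ?I \<le> (\<Sum>s\<in>?I. (a s)\<^sup>2) * (K2 * y ^ (4 * k) * B (2 ^ k))"
        using K2(3)[OF sub] unfolding nd by simp
      then show "K1 * W (Suc m) ?I \<le> K1 * ((\<Sum>s\<in>?I. (a s)\<^sup>2) * (K2 * y ^ (4 * k) * B (2 ^ k)))"
        using K1(1) by (intro mult_left_mono) auto
    qed auto
    have l2: "lam k j ^ (2 * 1) = D (2 ^ k) * y ^ (2 * k)"
      using D_nonneg unfolding lam_def by (simp add: power_mult_distrib power_mult[symmetric] mult.commute)
    have "prob {x\<in>space M. lam k j < \<bar>R ?I x\<bar>} \<le> expectation (\<lambda>x. R ?I x ^ (2 * 1)) / lam k j ^ (2 * 1)"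
    proof (rule prob_gt_le_moment)
      show "integrable M (\<lambda>x. R ?I x ^ (2 * 1))" "R ?I \<in> borel_measurable M"
        using R_sq by (auto simp: square_integrable_def)
      show "lam k j > 0" unfolding lam_def using k0[OF k] y by simp
    qed simp
    also have "\<dots> \<le> K1 * ((\<Sum>s\<in>?I. (a s)\<^sup>2) * (K2 * y ^ (4 * k) * B (2 ^ k))) / lam k j ^ (2 * 1)"
      using E lam0 by (intro divide_right_mono) auto
    also have "\<dots> = (\<Sum>s\<in>?I. (a s)\<^sup>2) * (K1 * K2 * y ^ (2 * k) * B (2 ^ k) / D (2 ^ k))"
    proof -
      have "y ^ (4 * k) = y ^ (2 * k) * y ^ (2 * k)" by (simp flip: power_add)
      then show ?thesis unfolding l2 using k0[OF k] y by simp
    qed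
    finally show ?thesis .
  qed
  have RZ: "R I x = (\<Sum>t\<in>I. a t * G (X t x) - c m * (a t * hermite m (X t x)))" for I x
    by (simp add: R_def S_def Y_def sum_subtractf sum_distrib_left)
  have "AE x in M. eventually (\<lambda>k. \<forall>l<2 ^ k. \<bar>\<Sum>t\<in>{0<..l}. a t * G (X t x) - c m * (a t * hermite m (X t x))\<bar> \<le> (\<Sum>j<k. lam k j)) sequentially"
  proof (rule block_maximal[of _ lam "k0" "\<lambda>k. K1 * K2 * Cy * y ^ k"])
    have 1: "(\<lambda>x. G (X t x)) \<in> borel_measurable M" for t using G_sq by (simp add: square_integrable_def)
    have 2: "(\<lambda>x. hermite m (X t x)) \<in> borel_measurable M" for t
      by (intro all_moments_measurable all_moments_hermite X_in)
    show "(\<lambda>x. a t * G (X t x) - c m * (a t * hermite m (X t x))) \<in> borel_measurable M" for t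
      using 1 2 by measurable
    show "summable (\<lambda>k. K1 * K2 * Cy * y ^ k)"
      using y by (intro summable_mult summable_geometric) auto
    fix k assume k: "k0 \<le> k"
    let ?c = "K1 * K2 * y ^ (2 * k) * B (2 ^ k) / D (2 ^ k)"
    have "(\<Sum>j<k. \<Sum>i<2 ^ (k - j). prob {x\<in>space M. lam k j < \<bar>\<Sum>t\<in>{i * 2 ^ j<..i * 2 ^ j + 2 ^ j}. a t * G (X t x) - c m * (a t * hermite m (X t x))\<bar>})
      \<le> (\<Sum>j<k. \<Sum>i<2 ^ (k - j). (\<Sum>s\<in>{i * 2 ^ j<..i * 2 ^ j + 2 ^ j}. (a s)\<^sup>2) * ?c)"
      using blk[unfolded RZ] k by (intro sum_mono) auto
    also have "\<dots> = (\<Sum>j<k. Al (2 ^ k) * ?c)"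
    proof (intro sum.cong refl)
      fix j assume "j \<in> {..<k}"
      then have kj: "(2::nat) ^ (k - j) * 2 ^ j = 2 ^ k" by (simp flip: power_add)
      have "(\<Sum>i<2 ^ (k - j). \<Sum>s\<in>{i * 2 ^ j<..i * 2 ^ j + 2 ^ j}. (a s)\<^sup>2) = Al (2 ^ k)"
        unfolding sum_blocks kj Al_eq by (rule sum.cong) auto
      then show "(\<Sum>i<2 ^ (k - j). (\<Sum>s\<in>{i * 2 ^ j<..i * 2 ^ j + 2 ^ j}. (a s)\<^sup>2) * ?c) = Al (2 ^ k) * ?c"
        unfolding sum_distrib_right[symmetric] by simp
    qed
    also have "\<dots> = real k * (Al (2 ^ k) * ?c)" by simp
    also have "Al (2 ^ k) * ?c = K1 * K2 * y ^ (2 * k)"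
    proof -
      have "Al (2 ^ k) * ?c = K1 * K2 * y ^ (2 * k) * (D (2 ^ k) / D (2 ^ k))" by (simp add: D_def)
      then show ?thesis using k0[OF k] by simp
    qed
    also have "real k * (K1 * K2 * y ^ (2 * k)) = K1 * K2 * (real k * y ^ k) * y ^ k"
      by (simp add: mult_2 power_add)
    also have "\<dots> \<le> K1 * K2 * Cy * y ^ k"
      using K1(1) K2(1) y ky by (intro mult_right_mono mult_left_mono) auto
    finally show "(\<Sum>j<k. \<Sum>i<2 ^ (k - j). prob {x\<in>space M. lam k j < \<bar>\<Sum>t\<in>{i * 2 ^ j<..i * 2 ^ j + 2 ^ j}. a t * G (X t x) - c m * (a t * hermite m (X t x))\<bar>})
      \<le> K1 * K2 * Cy * y ^ k" .
  qed (rule lam0)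
  then have ae: "AE x in M. eventually (\<lambda>k. \<forall>l<2 ^ k. \<bar>R {0<..l} x\<bar> \<le> (\<Sum>j<k. lam k j)) sequentially"
    unfolding RZ .
  have sl: "(\<Sum>j<k. lam k j) \<le> Cy * sqrt (D (2 ^ k))" for k
  proof -
    have "(\<Sum>j<k. lam k j) = (real k * y ^ k) * sqrt (D (2 ^ k))" by (simp add: lam_def mult_ac)
    also have "\<dots> \<le> Cy * sqrt (D (2 ^ k))" using D_nonneg by (intro mult_right_mono ky) auto
    finally show ?thesis .
  qed
  show ?thesis
  proof (rule that[OF Cy(1)])
    show "AE \<omega> in M. eventually (\<lambda>k. \<forall>l<2 ^ k. \<bar>R {0<..l} \<omega>\<bar> \<le> Cy * sqrt (D (2 ^ k))) sequentially"
      using ae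
    proof eventually_elim
      case (elim \<omega>)
      then show ?case
      proof eventually_elim
        case (elim k)
        then show ?case using sl[of k] by (meson order_trans)
      qed
    qed
  qed
qed

text \<open>For n in [2^j, 2^(j+1)) both maximal bounds are used at scale j + 1. Doubling replaces D
  at the scale by \<open>D n\<close>, the variance bound replaces that by the variance, and q at j +
  1 is at most a multiple of log log n.\<close>

lemma upper_lil:
  obtains C where "AE \<omega> in M. eventually (\<lambda>n. \<bar>S {0<..n} \<omega>\<bar> /
    (sqrt (variance (S {0<..n})) * (2 * ln (ln (real n))) powr (real m / 2)) \<le> C) sequentially"
proof -
  obtain C1 q0 where C1: "q0 \<ge> (1::nat)" "C1 > 0"
    "AE \<omega> in M. eventually (\<lambda>k. \<forall>l<2 ^ k. \<bar>Y m {0<..l} \<omega>\<bar> \<le>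
       C1 * sqrt (real (nat \<lceil>ln (real k)\<rceil> + q0) ^ m * D (2 ^ k))) sequentially"
    by (rule Y_maximal) (rule that; assumption)
  obtain C2 where C2: "C2 > 0"
    "AE \<omega> in M. eventually (\<lambda>k. \<forall>l<2 ^ k. \<bar>R {0<..l} \<omega>\<bar> \<le> C2 * sqrt (D (2 ^ k))) sequentially"
    by (rule R_maximal) (rule that; assumption)
  obtain v N1 where v: "v > 0" "\<And>n. n \<ge> N1 \<Longrightarrow> v * D n \<le> variance (S {0<..n})"
    by (rule variance_lower) (rule that; assumption)
  obtain K N2 where K: "K > 0" "N2 \<ge> (1::nat)" "\<And>n. n \<ge> N2 \<Longrightarrow> D n > 0"
    "\<And>k n. n \<ge> N2 \<Longrightarrow> k \<le> 2 * n \<Longrightarrow> D k \<le> K * D n"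
    by (rule D_doubling) (rule that; assumption)
  define q where "q k = nat \<lceil>ln (real k)\<rceil> + q0" for k :: nat
  have q1: "real (q k) \<ge> 1" for k using C1(1) by (simp add: q_def)
  define C3 where "C3 = \<bar>c m\<bar> * C1 + C2"
  have C3: "C3 > 0" using C1(2) C2(1) by (simp add: C3_def add_nonneg_pos)
  \<comment> \<open>K comes from doubling, v from the lower variance bound, and the power of 2 from
    bounding q by 2u with u = 2 log log n.\<close>
  define C where "C = C3 * sqrt (K / v) * 2 powr (real m / 2)"
  have C: "C > 0" using C3 K(1) v(1) by (simp add: C_def)
  have big: "eventually (\<lambda>k::nat. ln (real k) \<ge> 2 + real q0) sequentially"
    using filterlim_compose[OF ln_at_top filterlim_real_sequentially] by (simp add: filterlim_at_top)
  \<comment> \<open>Beyond \<open>k1\<close> the rounding and the offset \<open>q0\<close> are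
    absorbed: ln k + 1 + q0 is at most 2 ln k.\<close>
  then obtain k1 where k1: "\<And>k. k \<ge> k1 \<Longrightarrow> ln (real k) \<ge> 2 + real q0" unfolding eventually_sequentially by blast
  have det: "\<bar>S {0<..n} \<omega>\<bar> / (sqrt (variance (S {0<..n})) * (2 * ln (ln (real n))) powr (real m / 2)) \<le> C"
    if n: "n \<ge> N1" "n \<ge> N2" and k: "2 ^ j \<le> n" "n < 2 ^ Suc j" "j \<ge> 5" "Suc j \<ge> k1"
      and Yb: "\<bar>Y m {0<..n} \<omega>\<bar> \<le> C1 * sqrt (real (q (Suc j)) ^ m * D (2 ^ Suc j))"
      and Rb: "\<bar>R {0<..n} \<omega>\<bar> \<le> C2 * sqrt (D (2 ^ Suc j))" for n j \<omega>
  proof -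
    define u where "u = 2 * ln (ln (real n))"
    have nn: "real n \<ge> 2 ^ j" using k(1) by (metis of_nat_le_iff of_nat_numeral of_nat_power)
    have ln2: "ln (2::real) \<ge> 1 / 2" using ln2_ge_two_thirds by linarith
    have "real j / 2 \<le> real j * ln 2" using mult_left_mono[OF ln2, of "real j"] by simp
    also have "\<dots> = ln (2 ^ j)" by (simp add: ln_realpow)
    also have "\<dots> \<le> ln (real n)" using nn by (subst ln_le_cancel_iff) (auto intro: less_le_trans[of 0 "2 ^ j"])
    finally have lnn: "real j / 2 \<le> ln (real n)" .
    \<comment> \<open>Squaring absorbs the constant between j and ln n: from j + 1 <= (ln n)^2 it
      follows that ln (j + 1) is at most 2 ln (ln n), which is exactly u. The condition j >= 5
      serves this inequality.\<close>
    have "real (Suc j) \<le> (real j / 2)\<^sup>2"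
    proof -
      have "5 * real j \<le> real j * real j" using k(3) by (intro mult_right_mono) auto
      moreover have "real j \<ge> 5" using k(3) by simp
      moreover have "(real j / 2)\<^sup>2 = real j * real j / 4" by (simp add: power2_eq_square)
      ultimately show ?thesis unfolding of_nat_Suc by linarith
    qed
    also have "\<dots> \<le> (ln (real n))\<^sup>2" using lnn by (intro power_mono) auto
    finally have le: "real (Suc j) \<le> (ln (real n))\<^sup>2" .
    have lnpos: "ln (real n) > 0" using lnn k(3) by linarith
    have "ln (real (Suc j)) \<le> ln ((ln (real n))\<^sup>2)" using le by (subst ln_le_cancel_iff) (use lnpos in auto)
    also have "\<dots> = u" using lnpos by (simp add: u_def ln_realpow)
    finally have lu: "ln (real (Suc j)) \<le> u" .
    have "real (q (Suc j)) \<le> ln (real (Suc j)) + 1 + real q0"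
    proof -
      have "0 \<le> ln (real (Suc j))" by simp
      then have "real (nat \<lceil>ln (real (Suc j))\<rceil>) \<le> ln (real (Suc j)) + 1" by linarith
      then show ?thesis by (simp add: q_def)
    qed
    also have "\<dots> \<le> 2 * u" using k1[OF k(4)] lu by linarith
    finally have qu: "real (q (Suc j)) \<le> 2 * u" .
    have upos: "u > 0" using qu q1[of "Suc j"] by linarith
    have Dn: "D n > 0" by (rule K(3)[OF n(2)])
    have DD: "D (2 ^ Suc j) \<le> K * D n" using k(1) by (intro K(4) n) simp
    have sq: "sqrt (real (q (Suc j)) ^ m) \<le> 2 powr (real m / 2) * u powr (real m / 2)"
    proof -
      have "sqrt (real (q (Suc j)) ^ m) = (real (q (Suc j)) powr real m) powr (1 / 2)"
        using q1[of "Suc j"] by (simp add: powr_realpow powr_half_sqrt)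
      also have "\<dots> = real (q (Suc j)) powr (real m / 2)" by (simp add: powr_powr)
      also have "\<dots> \<le> (2 * u) powr (real m / 2)" using qu by (intro powr_mono2) auto
      also have "\<dots> = 2 powr (real m / 2) * u powr (real m / 2)" by (rule powr_mult)
      finally show ?thesis .
    qed
    have s1: "sqrt (real (q (Suc j)) ^ m) \<ge> 1" using q1[of "Suc j"] by (simp add: one_le_power)
    have "S {0<..n} \<omega> = c m * Y m {0<..n} \<omega> + R {0<..n} \<omega>" by (simp add: R_def)
    then have "\<bar>S {0<..n} \<omega>\<bar> \<le> \<bar>c m\<bar> * \<bar>Y m {0<..n} \<omega>\<bar> + \<bar>R {0<..n} \<omega>\<bar>"
      by (metis abs_mult abs_triangle_ineq)
    also have "\<dots> \<le> \<bar>c m\<bar> * (C1 * sqrt (real (q (Suc j)) ^ m * D (2 ^ Suc j))) + C2 * (1 * sqrt (D (2 ^ Suc j)))"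
      using Yb Rb by (intro add_mono mult_left_mono) auto
    also have "\<dots> \<le> \<bar>c m\<bar> * (C1 * sqrt (real (q (Suc j)) ^ m * D (2 ^ Suc j))) + C2 * (sqrt (real (q (Suc j)) ^ m) * sqrt (D (2 ^ Suc j)))"
      using s1 C2(1) D_nonneg by (intro add_left_mono mult_left_mono mult_right_mono) auto
    also have "\<dots> = C3 * (sqrt (real (q (Suc j)) ^ m) * sqrt (D (2 ^ Suc j)))"
      by (simp add: C3_def real_sqrt_mult algebra_simps)
    also have "\<dots> \<le> C3 * ((2 powr (real m / 2) * u powr (real m / 2)) * sqrt (K * D n))"
      using C3 sq DD D_nonneg by (intro mult_left_mono mult_mono) auto
    also have "\<dots> = C * (sqrt (v * D n) * u powr (real m / 2))"
      using v(1) by (simp add: C_def real_sqrt_mult real_sqrt_divide)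
    also have "\<dots> \<le> C * (sqrt (variance (S {0<..n})) * u powr (real m / 2))"
      using C v(2)[OF n(1)] by (intro mult_left_mono mult_right_mono) auto
    finally have main: "\<bar>S {0<..n} \<omega>\<bar> \<le> C * (sqrt (variance (S {0<..n})) * u powr (real m / 2))" .
    have "0 < v * D n" using v(1) Dn by simp
    then have "0 < variance (S {0<..n})" using v(2)[OF n(1)] by linarith
    then have "0 < sqrt (variance (S {0<..n})) * u powr (real m / 2)" using upos by simp
    with main show ?thesis unfolding u_def[symmetric] by (simp add: pos_divide_le_eq)
  qed
  have "AE \<omega> in M. eventually (\<lambda>n. \<bar>S {0<..n} \<omega>\<bar> /
    (sqrt (variance (S {0<..n})) * (2 * ln (ln (real n))) powr (real m / 2)) \<le> C) sequentially"
    using C1(3) C2(2)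
  proof eventually_elim
    case (elim \<omega>)
    then have "eventually (\<lambda>k. (\<forall>l<2 ^ k. \<bar>Y m {0<..l} \<omega>\<bar> \<le> C1 * sqrt (real (q k) ^ m * D (2 ^ k))) \<and>
      (\<forall>l<2 ^ k. \<bar>R {0<..l} \<omega>\<bar> \<le> C2 * sqrt (D (2 ^ k)))) sequentially"
      unfolding q_def by (rule eventually_conj)
    then obtain k2 where k2: "\<And>k l. k \<ge> k2 \<Longrightarrow> l < 2 ^ k \<Longrightarrow> \<bar>Y m {0<..l} \<omega>\<bar> \<le> C1 * sqrt (real (q k) ^ m * D (2 ^ k))"
      "\<And>k l. k \<ge> k2 \<Longrightarrow> l < 2 ^ k \<Longrightarrow> \<bar>R {0<..l} \<omega>\<bar> \<le> C2 * sqrt (D (2 ^ k))"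
      unfolding eventually_sequentially by blast
    define k3 where "k3 = max (max 5 k1) k2"
    show ?case unfolding eventually_sequentially
    proof (intro exI allI impI)
      fix n :: nat assume n: "max (max N1 N2) (2 ^ Suc k3) \<le> n"
      have "n \<ge> 1" using n by (metis max.bounded_iff one_le_numeral one_le_power order_trans)
      then obtain j where j: "2 ^ j \<le> n" "n < 2 ^ Suc j"
        using ex_power_ivl1[of 2 n] by auto
      have "(2::nat) ^ Suc k3 < 2 ^ Suc j" using n j by linarith
      then have "Suc k3 < Suc j" by (rule power_less_imp_less_exp[rotated]) simp
      then have jk: "j \<ge> 5" "Suc j \<ge> k1" "Suc j \<ge> k2" unfolding k3_def by simp_all
      show "\<bar>S {0<..n} \<omega>\<bar> / (sqrt (variance (S {0<..n})) * (2 * ln (ln (real n))) powr (real m / 2)) \<le> C"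
        by (rule det[OF _ _ j jk(1,2) k2(1)[OF jk(3) j(2)] k2(2)[OF jk(3) j(2)]]) (use n in simp_all)
    qed
  qed
  then show ?thesis by (rule that)
qed

end

section \<open>Gaussian sequences and the law of the iterated logarithm\<close>

text \<open>In the nondegenerate case the recursion is checked on the explicit even and odd moments.
  In the constant clause mean zero forces W = 0 almost everywhere, and both sides of the recursion
  vanish.\<close>

lemma (in prob_space) gaussian_variable_moments:
  assumes W: "gaussian_variable M W" and mean: "expectation W = 0"
  shows "all_moments M W"
    and "expectation (\<lambda>x. W x ^ Suc (Suc n)) = real (Suc n) * expectation (\<lambda>x. (W x)\<^sup>2) * expectation (\<lambda>x. W x ^ n)"
proof -
  have Wm[measurable]: "W \<in> borel_measurable M" using W by (simp add: gaussian_variable_def)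
  consider (normal) \<mu> \<sigma> where "\<sigma> > 0" "distributed M lborel W (normal_density \<mu> \<sigma>)" | (const) \<mu> where "AE \<omega> in M. W \<omega> = \<mu>"
    using W unfolding gaussian_variable_def by blast
  then have "all_moments M W \<and> (\<forall>n. expectation (\<lambda>x. W x ^ Suc (Suc n)) = real (Suc n) * expectation (\<lambda>x. (W x)\<^sup>2) * expectation (\<lambda>x. W x ^ n))"
  proof cases
    case normal
    have "\<mu> = 0" using normal_distributed_expectation[OF normal] mean by simp
    note D = normal(2)[unfolded this]
    have am: "all_moments M W"
      unfolding all_moments_def
    proof (intro conjI allI)
      fix k
      have "integrable lborel (\<lambda>x. normal_density 0 \<sigma> x * \<bar>x\<bar> ^ k)"
        using integrable_normal_moment_abs[OF normal(1), of 0 k] by simp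
      then show "integrable M (\<lambda>x. norm (W x) ^ k)"
        using distributed_integrable[OF D, of "\<lambda>x. \<bar>x\<bar> ^ k"] by simp
    qed measurable
    have I: "expectation (\<lambda>x. W x ^ k) = (\<integral>x. normal_density 0 \<sigma> x * x ^ k \<partial>lborel)" for k
      using distributed_integral[OF D, of "\<lambda>x. x ^ k"] by simp
    have ev: "expectation (\<lambda>x. W x ^ (2 * k)) = fact (2 * k) / ((2 / \<sigma>\<^sup>2) ^ k * fact k)" for k
      unfolding I using integral_normal_moment_even[OF normal(1), of 0 k] by simp
    have od: "expectation (\<lambda>x. W x ^ (2 * k + 1)) = 0" for k
      unfolding I using integral_normal_moment_odd[OF normal(1), of 0 k] by simp
    have var: "expectation (\<lambda>x. (W x)\<^sup>2) = \<sigma>\<^sup>2" using ev[of 1] by simp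
    have "expectation (\<lambda>x. W x ^ Suc (Suc n)) = real (Suc n) * \<sigma>\<^sup>2 * expectation (\<lambda>x. W x ^ n)" for n
    proof (cases "even n")
      case True
      then obtain k where k: "n = 2 * k" by blast
      have "Suc (Suc n) = 2 * Suc k" using k by simp
      then have "expectation (\<lambda>x. W x ^ Suc (Suc n)) = fact (2 * Suc k) / ((2 / \<sigma>\<^sup>2) ^ Suc k * fact (Suc k))"
        using ev[of "Suc k"] by simp
      also have "\<dots> = (2 * real (Suc k)) * real (Suc (2 * k)) * fact (2 * k) / ((2 / \<sigma>\<^sup>2) * (2 / \<sigma>\<^sup>2) ^ k * (real (Suc k) * fact k))"
        by simp
      also have "\<dots> = real (Suc (2 * k)) * \<sigma>\<^sup>2 * (fact (2 * k) / ((2 / \<sigma>\<^sup>2) ^ k * fact k))"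
        using normal(1) by (simp del: of_nat_Suc add: power_divide)
      also have "\<dots> = real (Suc n) * \<sigma>\<^sup>2 * expectation (\<lambda>x. W x ^ n)"
        unfolding k ev ..
      finally show ?thesis .
    next
      case False
      then obtain k where k: "n = 2 * k + 1" by (elim oddE)
      have "Suc (Suc n) = 2 * Suc k + 1" using k by simp
      then show ?thesis using od[of k] od[of "Suc k"] k by simp
    qed
    then show ?thesis unfolding var using am by blast
  next
    case const
    have eq: "AE \<omega> in M. W \<omega> = 0"
    proof -
      have "expectation W = expectation (\<lambda>_. \<mu>)" by (rule integral_cong_AE) (use const in auto)
      then have "\<mu> = 0" using mean by (simp add: prob_space)
      then show ?thesis using const by simp
    qed
    have E: "expectation (\<lambda>x. W x ^ k) = (if k = 0 then 1 else 0)" for k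
    proof -
      have "expectation (\<lambda>x. W x ^ k) = expectation (\<lambda>_. 0 ^ k)"
        by (rule integral_cong_AE) (use eq in auto)
      then show ?thesis by (simp add: prob_space power_0_left)
    qed
    have "all_moments M W"
      unfolding all_moments_def
    proof (intro conjI allI)
      fix k
      have "integrable M (\<lambda>x. norm (W x) ^ k) \<longleftrightarrow> integrable M (\<lambda>_. (0::real) ^ k)"
        by (rule integrable_cong_AE) (use eq in auto)
      then show "integrable M (\<lambda>x. norm (W x) ^ k)" by simp
    qed measurable
    then show ?thesis unfolding E by simp
  qed
  then show "all_moments M W"
    and "expectation (\<lambda>x. W x ^ Suc (Suc n)) = real (Suc n) * expectation (\<lambda>x. (W x)\<^sup>2) * expectation (\<lambda>x. W x ^ n)"
    by blast+
qed

text \<open>The constant clause is excluded by the unit second moment; in the other clause mean and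
  variance determine the density.\<close>

lemma (in prob_space) gaussian_variable_standard_distr:
  assumes W: "gaussian_variable M W" and mean: "expectation W = 0" and var: "expectation (\<lambda>x. (W x)\<^sup>2) = 1"
  shows "distr M lborel W = std_gaussian"
proof -
  have Wm[measurable]: "W \<in> borel_measurable M" using W by (simp add: gaussian_variable_def)
  consider (normal) \<mu> \<sigma> where "\<sigma> > 0" "distributed M lborel W (normal_density \<mu> \<sigma>)" | (const) \<mu> where "AE \<omega> in M. W \<omega> = \<mu>"
    using W unfolding gaussian_variable_def by blast
  then show ?thesis
  proof cases
    case normal
    have \<mu>: "\<mu> = 0" using normal_distributed_expectation[OF normal] mean by simp
    have "\<sigma>\<^sup>2 = 1" using normal_distributed_variance[OF normal] mean var by simp
    then have "\<sigma> = 1" using normal(1) by (simp add: power2_eq_1_iff)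
    then show ?thesis using normal(2) \<mu> unfolding distributed_def std_gaussian_def by simp
  next
    case const
    have "expectation W = expectation (\<lambda>_. \<mu>)" by (rule integral_cong_AE) (use const in auto)
    then have "\<mu> = 0" using mean by (simp add: prob_space)
    have "expectation (\<lambda>x. (W x)\<^sup>2) = expectation (\<lambda>_. 0)"
      by (rule integral_cong_AE) (use const \<open>\<mu> = 0\<close> in auto)
    then show ?thesis using var by simp
  qed
qed

lemma hermite_measurable [measurable]: "hermite q \<in> borel_measurable borel"
proof (induction q rule: less_induct)
  case (less q)
  show ?case
  proof (cases q)
    case 0
    then have "hermite q = (\<lambda>_. 1)" by (simp add: fun_eq_iff)
    then show ?thesis by simp
  next
    case (Suc p)
    then have [measurable]: "hermite p \<in> borel_measurable borel" "hermite (p - 1) \<in> borel_measurable borel"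
      using less.IH by simp_all
    have e: "hermite q = (\<lambda>x. x * hermite p x - real p * hermite (p - 1) x)"
      by (simp add: Suc hermite_Suc fun_eq_iff)
    show ?thesis unfolding e by measurable
  qed
qed

definition linear_span :: "(nat \<Rightarrow> 'a \<Rightarrow> real) \<Rightarrow> ('a \<Rightarrow> real) set" where
  "linear_span X = {\<lambda>\<omega>. \<Sum>t\<in>F. b t * X t \<omega> |F b. finite F \<and> F \<subseteq> {1..}}"

lemma linear_spanI: "finite F \<Longrightarrow> F \<subseteq> {1..} \<Longrightarrow> W = (\<lambda>\<omega>. \<Sum>t\<in>F. b t * X t \<omega>) \<Longrightarrow> W \<in> linear_span X"
  unfolding linear_span_def by blast

lemma linear_span_base: "t \<ge> 1 \<Longrightarrow> X t \<in> linear_span X"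
  by (rule linear_spanI[of "{t}" _ "\<lambda>_. 1"]) auto

lemma gaussian_space_linear_span:
  assumes "prob_space M" and gauss: "gaussian_sequence M X"
    and mean: "\<And>t. t \<ge> 1 \<Longrightarrow> prob_space.expectation M (X t) = 0"
  shows "gaussian_space M (linear_span X)"
proof -
  interpret prob_space M by fact
  have gv: "gaussian_variable M (\<lambda>\<omega>. \<Sum>t\<in>F. b t * X t \<omega>)" if "finite F" "F \<subseteq> {1..}" for F b
    using gauss that unfolding gaussian_sequence_def by blast
  have gX: "gaussian_variable M (X t)" if "t \<ge> 1" for t
    using gv[of "{t}" "\<lambda>_. 1"] that by simp
  have iX: "integrable M (X t)" if "t \<ge> 1" for t
    by (rule all_moments_integrable[OF gaussian_variable_moments(1)[OF gX[OF that] mean[OF that]]])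
  have span: "gaussian_variable M W \<and> expectation W = 0" if W: "W \<in> linear_span X" for W
  proof -
    obtain F b where F: "finite F" "F \<subseteq> {1..}" and W: "W = (\<lambda>\<omega>. \<Sum>t\<in>F. b t * X t \<omega>)"
      using W unfolding linear_span_def by blast
    have "expectation W = (\<Sum>t\<in>F. b t * expectation (X t))"
      unfolding W using F iX by (subst Bochner_Integration.integral_sum) auto
    also have "\<dots> = 0" using F mean by (intro sum.neutral) auto
    finally show ?thesis using gv[OF F] unfolding W by blast
  qed
  show ?thesis
  proof
    fix V W assume "V \<in> linear_span X" "W \<in> linear_span X"
    then obtain F b F' b' where F: "finite F" "F \<subseteq> {1..}" "finite F'" "F' \<subseteq> {1..}"
      and V: "V = (\<lambda>\<omega>. \<Sum>t\<in>F. b t * X t \<omega>)" and W: "W = (\<lambda>\<omega>. \<Sum>t\<in>F'. b' t * X t \<omega>)"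
      unfolding linear_span_def by blast
    show "(\<lambda>x. V x + W x) \<in> linear_span X"
    proof (rule linear_spanI)
      show "finite (F \<union> F')" "F \<union> F' \<subseteq> {1..}" using F by auto
      have 1: "(\<Sum>t\<in>F. b t * X t x) = (\<Sum>t\<in>F \<union> F'. (if t \<in> F then b t else 0) * X t x)" for x
        using F by (intro sum.mono_neutral_cong_left) auto
      have 2: "(\<Sum>t\<in>F'. b' t * X t x) = (\<Sum>t\<in>F \<union> F'. (if t \<in> F' then b' t else 0) * X t x)" for x
        using F by (intro sum.mono_neutral_cong_left) auto
      show "(\<lambda>x. V x + W x) = (\<lambda>x. \<Sum>t\<in>F \<union> F'. ((if t \<in> F then b t else 0) + (if t \<in> F' then b' t else 0)) * X t x)"
        unfolding V W 1 2 by (simp add: distrib_right sum.distrib)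
    qed
  next
    fix W and k :: real assume "W \<in> linear_span X"
    then obtain F b where F: "finite F" "F \<subseteq> {1..}" and W: "W = (\<lambda>\<omega>. \<Sum>t\<in>F. b t * X t \<omega>)"
      unfolding linear_span_def by blast
    show "(\<lambda>x. k * W x) \<in> linear_span X"
      by (rule linear_spanI[OF F, of _ "\<lambda>t. k * b t"]) (simp add: W sum_distrib_left mult.assoc)
  next
    fix W assume "W \<in> linear_span X"
    note W = conjunct1[OF span[OF this]] conjunct2[OF span[OF this]]
    show "all_moments M W" "expectation W = 0"
      by (rule gaussian_variable_moments(1)[OF W], rule W(2))
    show "expectation (\<lambda>x. W x ^ Suc (Suc n)) = real (Suc n) * expectation (\<lambda>x. (W x)\<^sup>2) * expectation (\<lambda>x. W x ^ n)" for n
      by (rule gaussian_variable_moments(2)[OF W])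
  qed
qed

theorem theorem3p2:
  fixes M :: "'a measure"
    and X S :: "nat \<Rightarrow> 'a \<Rightarrow> real"
    and G L\<^sub>0 \<l>\<^sub>a :: "real \<Rightarrow> real"
    and \<rho> a A :: "nat \<Rightarrow> real"
    and c \<alpha> d :: real
    and m :: nat
  assumes "prob_space M"
    and "gaussian_sequence M X" and "stationary_sequence M X"
    and "\<And>t. t \<ge> 1 \<Longrightarrow> prob_space.expectation M (X t) = 0"
    and "\<And>t. t \<ge> 1 \<Longrightarrow> prob_space.expectation M (\<lambda>\<omega>. (X t \<omega>)\<^sup>2) = 1"
    and "\<And>t h. t \<ge> 1 \<Longrightarrow> \<rho> h = prob_space.expectation M (\<lambda>\<omega>. X t \<omega> * X (t + h) \<omega>)"
    and "c > 0" and "0 < \<alpha>" and "\<alpha> < 1" and "slowly_varying L\<^sub>0"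
    and "\<rho> \<sim>[at_top] (\<lambda>h. c * real h powr (- \<alpha>) * L\<^sub>0 (real h))"
    and "square_integrable std_gaussian G" and "m \<ge> 1" and "has_hermite_rank G m"
    and "slowly_varying \<l>\<^sub>a"
    and "\<And>n. n \<ge> 1 \<Longrightarrow> a n = real n powr (- d) * \<l>\<^sub>a (real n)"
    and "\<alpha> * real m < 1" and "2 * d + \<alpha> * real m < 1"
    and "\<And>n \<omega>. S n \<omega> = (\<Sum>t=1..n. a t * G (X t \<omega>))"
    and "\<And>n. A n = sqrt (prob_space.variance M (S n))"
  shows "\<exists>C_up::real. AE \<omega> in M.
    limsup (\<lambda>n. ereal (\<bar>S n \<omega>\<bar> / (A n * (2 * ln (ln (real n))) powr (real m / 2)))) \<le> ereal C_up"
proof -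
  interpret gaussian_space M "linear_span X"
    by (rule gaussian_space_linear_span[OF assms(1,2,4)])
  \<comment> \<open>The value at index 0, about which nothing is known, is replaced by
    \<open>X 1\<close>, so that every index gives a standard Gaussian in the span. Sums over
    positive indices do not change.\<close>
  define X' where "X' t = X (max 1 t)" for t
  have X'_in: "X' t \<in> linear_span X" for t unfolding X'_def by (rule linear_span_base) simp
  have X'_var: "expectation (\<lambda>\<omega>. (X' t \<omega>)\<^sup>2) = 1" for t unfolding X'_def by (rule assms(5)) simp
  have X'_cov: "expectation (\<lambda>\<omega>. X' s \<omega> * X' t \<omega>) = \<rho> (lag s t)" if "s \<ge> 1" "t \<ge> 1" for s t
  proof (cases "s \<le> t")
    case True
    then show ?thesis using assms(6)[of s "t - s"] that by (simp add: X'_def lag_def max_def)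
  next
    case False
    then show ?thesis using assms(6)[of t "s - t"] that by (simp add: X'_def lag_def max_def mult.commute)
  qed
  have X'_distr: "distr M lborel (X' t) = std_gaussian" for t
  proof (rule gaussian_variable_standard_distr)
    have "gaussian_variable M (\<lambda>\<omega>. \<Sum>u\<in>{max 1 t}. 1 * X u \<omega>)"
      by (rule assms(2)[unfolded gaussian_sequence_def, rule_format, of "{max 1 t}" "\<lambda>_. 1"]) simp
    then show "gaussian_variable M (X' t)" by (simp add: X'_def[abs_def])
    show "expectation (X' t) = 0" by (rule L_mean[OF X'_in])
  qed (rule X'_var)
  have X'_meas[measurable]: "X' t \<in> borel_measurable M" for t
    by (rule all_moments_measurable[OF L_moments[OF X'_in]])
  have G_meas[measurable]: "G \<in> borel_measurable borel"
    using assms(12) by (simp add: square_integrable_def std_gaussian_def)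
  have G_sq: "square_integrable M (\<lambda>\<omega>. G (X' t \<omega>))" for t
  proof -
    have "integrable (distr M lborel (X' t)) (\<lambda>x. (G x)\<^sup>2)"
      using assms(12) unfolding X'_distr square_integrable_def by blast
    then have "integrable M (\<lambda>\<omega>. (G (X' t \<omega>))\<^sup>2)"
      by (subst (asm) integrable_distr_eq) simp_all
    then show ?thesis unfolding square_integrable_def by simp
  qed
  define k where "k q = hermite_coeff G q / fact q" for q
  define e where "e N x = G x - (\<Sum>q=m..N. k q * hermite q x)" for N x
  have e_meas[measurable]: "e N \<in> borel_measurable borel" for N unfolding e_def[abs_def] by measurable
  define err where "err N = (\<integral>x. (e N x)\<^sup>2 \<partial>std_gaussian)" for N
  have err_eq: "expectation (\<lambda>\<omega>. (e N (X' t \<omega>))\<^sup>2) = err N" for N t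
    unfolding err_def X'_distr[of t, symmetric] by (subst integral_distr) simp_all
  have err_lim: "err \<longlonglongrightarrow> 0"
  \<comment> \<open>The rank condition is a statement about nonnegative integrals. To read them as
    \<open>err N\<close>, integrability is obtained on M, after pulling the error back along
    \<open>X' 1\<close>, whose law is \<open>std_gaussian\<close>.\<close>
  proof -
    have "(\<integral>\<^sup>+x. ennreal ((e N x)\<^sup>2) \<partial>std_gaussian) = ennreal (err N)" for N
    proof -
      have "square_integrable M (\<lambda>\<omega>. e N (X' 1 \<omega>))"
        unfolding e_def by (intro square_integrable_diff square_integrable_sum square_integrable_cmult G_sq
          all_moments_square_integrable all_moments_hermite X'_in)
      then have I: "integrable M (\<lambda>\<omega>. (e N (X' 1 \<omega>))\<^sup>2)" by (simp add: square_integrable_def)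
      have "(\<integral>\<^sup>+x. ennreal ((e N x)\<^sup>2) \<partial>std_gaussian) = (\<integral>\<^sup>+\<omega>. ennreal ((e N (X' 1 \<omega>))\<^sup>2) \<partial>M)"
        unfolding X'_distr[of 1, symmetric] by (subst nn_integral_distr) simp_all
      also have "\<dots> = ennreal (err N)"
        unfolding err_eq[of N 1, symmetric] by (rule nn_integral_eq_integral[OF I]) simp
      finally show ?thesis .
    qed
    then have "(\<lambda>N. ennreal (err N)) \<longlonglongrightarrow> ennreal 0"
      using assms(14) unfolding has_hermite_rank_def e_def k_def by simp
    then show ?thesis
      by (rule tendsto_ennrealD) (auto simp: err_def)
  qed
  have \<rho>_le: "\<bar>\<rho> h\<bar> \<le> 1" for h
  proof -
    have I: "integrable M (\<lambda>\<omega>. (X' 1 \<omega>)\<^sup>2)" "integrable M (\<lambda>\<omega>. (X' (1 + h) \<omega>)\<^sup>2)" "integrable M (\<lambda>\<omega>. X' 1 \<omega> * X' (1 + h) \<omega>)"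
      by (intro all_moments_integrable all_moments_mult all_moments_power L_moments X'_in)+
    have r: "expectation (\<lambda>\<omega>. X' 1 \<omega> * X' (1 + h) \<omega>) = \<rho> h" using X'_cov[of 1 "1 + h"] by (simp add: lag_def)
    have "0 \<le> expectation (\<lambda>\<omega>. (X' 1 \<omega> + X' (1 + h) \<omega>)\<^sup>2)" by simp
    also have "\<dots> = expectation (\<lambda>\<omega>. (X' 1 \<omega>)\<^sup>2 + (X' (1 + h) \<omega>)\<^sup>2 + 2 * (X' 1 \<omega> * X' (1 + h) \<omega>))"
      by (simp add: power2_sum mult.assoc)
    also have "\<dots> = 2 + 2 * \<rho> h" using I r X'_var by simp
    finally have 1: "0 \<le> 2 + 2 * \<rho> h" .
    have "0 \<le> expectation (\<lambda>\<omega>. (X' 1 \<omega> - X' (1 + h) \<omega>)\<^sup>2)" by simp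
    also have "\<dots> = expectation (\<lambda>\<omega>. (X' 1 \<omega>)\<^sup>2 + (X' (1 + h) \<omega>)\<^sup>2 - 2 * (X' 1 \<omega> * X' (1 + h) \<omega>))"
      by (simp add: power2_diff mult.assoc)
    also have "\<dots> = 2 - 2 * \<rho> h" using I r X'_var by simp
    finally show ?thesis using 1 by linarith
  qed
  interpret H: hermite_sum M "linear_span X" a \<rho> \<alpha> d m X' G k err
  proof
    show "regular_seq a (- d)"
      by (rule regular_seq_slowly_varying[OF assms(15), of 1]) (simp_all add: assms(16))
    show "regular_seq \<rho> (- \<alpha>)"
      by (rule regular_seq_asymp_equiv[OF regular_seq_slowly_varying[OF assms(10,7)] assms(11)]) simp
    show "2 * d < 1" using assms(18) mult_nonneg_nonneg[of \<alpha> "real m"] assms(8) by linarith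
    show "\<rho> 0 = 1" using X'_cov[of 1 1] X'_var[of 1] by (simp add: lag_def power2_eq_square)
    show "expectation (\<lambda>\<omega>. (G (X' t \<omega>) - (\<Sum>q=m..N. k q * hermite q (X' t \<omega>)))\<^sup>2) \<le> err N" for t N
      using err_eq[of N t] unfolding e_def by simp
    show "k m \<noteq> 0" using assms(14) by (simp add: has_hermite_rank_def k_def)
  qed (fact assms(8,13,17) \<rho>_le X'_in X'_var X'_cov G_sq err_lim)+
  have S_eq: "S n = H.S {0<..n}" for n
    unfolding H.S_def[abs_def] assms(19)[abs_def]
    by (intro ext sum.cong) (auto simp: X'_def max_def)
  obtain C where C: "AE \<omega> in M. eventually (\<lambda>n. \<bar>H.S {0<..n} \<omega>\<bar> /
    (sqrt (variance (H.S {0<..n})) * (2 * ln (ln (real n))) powr (real m / 2)) \<le> C) sequentially"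
    by (rule H.upper_lil)
  show ?thesis
  proof (intro exI)
    show "AE \<omega> in M. limsup (\<lambda>n. ereal (\<bar>S n \<omega>\<bar> / (A n * (2 * ln (ln (real n))) powr (real m / 2)))) \<le> ereal C"
      using C
    proof eventually_elim
      case (elim \<omega>)
      then show ?case
        unfolding assms(20) S_eq by (intro Limsup_bounded) (simp add: eventually_mono)
    qed
  qed
qed

end
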